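(* Let $1\le \ell<k$ be integers. Then $\Phi_{k,\ell}(x)=1-\left(1+(1-x)^{-1/(k-\ell)}\right)^{-(k-\ell)}$ is a transfer function of $\Pi^k_\ell$. Moreover, $\Psi(x)=\frac{1}{2-x}$ is a transfer function of $\Pi^k_\ell$ whenever $\frac{k}{2}\le \ell<k$, and $\Upsilon_k(x)=\left(\frac{k-1}{k-x}\right)^{k-1}$ is a transfer function of $\Pi^k_1=\Pi^k$.
   Context: A $k$-graph $H$ is a finite $k$-uniform hypergraph; it is non-empty if it has at least one edge. A $k$-graph is $F$-free if it contains no (not necessarily induced) subgraph isomorphic to $F$. For $1\le \ell<k$ and an $\ell$-set $S\subseteq V(H)$, $d_H(S)$ is the number of edges of $H$ containing $S$, and $\delta_\ell(H)$ is the minimum of $d_H(S)$ over all $\ell$-sets $S\subseteq V(H)$. For a non-empty $k$-graph $F$, $\mathrm{ex}_\ell(n,F)$ is the largest value of $\delta_\ell(H)$ over all $n$-vertex $F$-free $k$-graphs $H$, and the $\ell$-degree Turán density is $\pi_\ell(F)=\lim_{n\to\infty}\mathrm{ex}_\ell(n,F)/\binom{n-\ell}{k-\ell}$ (the limit is known to exist). The single $\ell$-degree Turán spectrum is $\Pi^k_\ell=\{\pi_\ell(F): F \text{ a single non-empty } k\text{-graph}\}$. The ordinary Turán density is $\pi(F)=\lim_{n\to\infty}\mathrm{ex}(n,F)/\binom nk$, where $\mathrm{ex}(n,F)$ is the maximum number of edges in an $n$-vertex $F$-free $k$-graph, and $\Pi^k=\{\pi(F): F\text{ a single non-empty } k\text{-graph}\}$;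 it is standard that $\pi_1(F)=\pi(F)$, so $\Pi^k_1=\Pi^k$. A function $f$ is called a transfer function of $\Pi^k_\ell$ if $f(\beta)\in\Pi^k_\ell$ for every $\beta\in\Pi^k_\ell$. *)

theory Defs
  imports Complex_Main
begin

type_synonym 'a hypergraph = "'a set \<times> 'a set set"

abbreviation verts :: "'a hypergraph \<Rightarrow> 'a set" where
  "verts H \<equiv> fst H"

abbreviation edges :: "'a hypergraph \<Rightarrow> 'a set set" where
  "edges H \<equiv> snd H"

definition kgraph :: "nat \<Rightarrow> 'a hypergraph \<Rightarrow> bool" where
  "kgraph k H \<longleftrightarrow> finite (verts H) \<and> (\<forall>e\<in>edges H. e \<subseteq> verts H \<and> card e = k)"

definition nonempty_hypergraph :: "'a hypergraph \<Rightarrow> bool" where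
  "nonempty_hypergraph H \<longleftrightarrow> edges H \<noteq> {}"

definition subhypergraph :: "'a hypergraph \<Rightarrow> 'a hypergraph \<Rightarrow> bool" where
  "subhypergraph G H \<longleftrightarrow> verts G \<subseteq> verts H \<and> edges G \<subseteq> edges H"

definition isomorphic_hypergraphs :: "'a hypergraph \<Rightarrow> 'b hypergraph \<Rightarrow> bool" where
  "isomorphic_hypergraphs F G \<longleftrightarrow>
     (\<exists>\<phi>. bij_betw \<phi> (verts F) (verts G) \<and> edges G = (\<lambda>e. \<phi> ` e) ` edges F)"

definition free_of :: "'a hypergraph \<Rightarrow> 'b hypergraph \<Rightarrow> bool" where
  "free_of F H \<longleftrightarrow> \<not> (\<exists>G. subhypergraph G H \<and> isomorphic_hypergraphs F G)"

definition set_degree :: "'a hypergraph \<Rightarrow> 'a set \<Rightarrow> nat" where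
  "set_degree H S = card {e \<in> edges H. S \<subseteq> e}"

text \<open>Only meaningful when \<open>H\<close> has at least \<open>l\<close> vertices; otherwise it is the unspecified
  \<open>Min {}\<close>, which does not affect any of the limits below.\<close>
definition min_degree :: "nat \<Rightarrow> 'a hypergraph \<Rightarrow> nat" where
  "min_degree l H = Min {set_degree H S | S. S \<subseteq> verts H \<and> card S = l}"

text \<open>Every finite hypergraph is isomorphic to one with vertices in \<open>nat\<close>, so it suffices to
  let the host and the forbidden hypergraphs range over the latter.\<close>
definition ex_degree :: "nat \<Rightarrow> nat \<Rightarrow> nat \<Rightarrow> nat hypergraph \<Rightarrow> nat" where
  "ex_degree k l n F =
     Max {min_degree l H | H :: nat hypergraph. kgraph k H \<and> card (verts H) = n \<and> free_of F H}"

definition ex_edges :: "nat \<Rightarrow> nat \<Rightarrow> nat hypergraph \<Rightarrow> nat" where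
  "ex_edges k n F =
     Max {card (edges H) | H :: nat hypergraph. kgraph k H \<and> card (verts H) = n \<and> free_of F H}"

definition degree_turan_density :: "nat \<Rightarrow> nat \<Rightarrow> nat hypergraph \<Rightarrow> real" where
  "degree_turan_density k l F =
     lim (\<lambda>n. real (ex_degree k l n F) / real ((n - l) choose (k - l)))"

definition turan_density :: "nat \<Rightarrow> nat hypergraph \<Rightarrow> real" where
  "turan_density k F = lim (\<lambda>n. real (ex_edges k n F) / real (n choose k))"

definition degree_turan_spectrum :: "nat \<Rightarrow> nat \<Rightarrow> real set" where
  "degree_turan_spectrum k l =
     {degree_turan_density k l F | F. kgraph k F \<and> nonempty_hypergraph F}"

definition turan_spectrum :: "nat \<Rightarrow> real set" where
  "turan_spectrum k = {turan_density k F | F. kgraph k F \<and> nonempty_hypergraph F}"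

definition transfer_function :: "real set \<Rightarrow> (real \<Rightarrow> real) \<Rightarrow> bool" where
  "transfer_function \<Pi> f \<longleftrightarrow> (\<forall>\<beta>\<in>\<Pi>. f \<beta> \<in> \<Pi>)"

text \<open>\<open>powr\<close> has its usual meaning here for \<open>x < 1\<close>, which covers every Turan density of a
  non-empty hypergraph.\<close>
definition Phi :: "nat \<Rightarrow> nat \<Rightarrow> real \<Rightarrow> real" where
  "Phi k l x = 1 - (1 + (1 - x) powr (- 1 / real (k - l))) powr (- real (k - l))"

definition Psi :: "real \<Rightarrow> real" where
  "Psi x = 1 / (2 - x)"

definition Upsilon :: "nat \<Rightarrow> real \<Rightarrow> real" where
  "Upsilon k x = ((real k - 1) / (real k - x)) ^ (k - 1)"

end

theory Submission
  imports Defs "HOL-Library.FuncSet" "HOL-Library.Countable"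
    "HOL-Combinatorics.Multiset_Permutations" "HOL-Real_Asymp.Real_Asymp"
begin

text \<open>Given \<open>F\<close> with density \<open>\<beta>\<close>, take the hypergraph on the words over \<open>verts F\<close> of length at most
  \<open>k\<close> that has a copy of \<open>F\<close> on the children of every word of length at most \<open>t\<close> and an edge along
  every branch. It does not embed into the host on \<open>A \<union> B\<close> with an \<open>F\<close>-free hypergraph inside \<open>A\<close>
  and all further edges meeting both sides and having at most \<open>t\<close> vertices in \<open>B\<close>: every copy of
  \<open>F\<close> has a vertex in \<open>B\<close>, so some branch starts with \<open>t + 1\<close> vertices in \<open>B\<close>. With
  \<open>t = k - 1\<close> and \<open>t = l\<close> and the right sizes of \<open>A\<close> and \<open>B\<close> this gives the lower bounds for \<open>Phi\<close>
  and for \<open>Psi\<close>, \<open>Upsilon\<close>. Conversely, in a host of larger minimum degree every vertex set of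
  about the size of \<open>A\<close> contains \<open>F\<close>, and the tree can be embedded greedily by choosing each copy
  of \<open>F\<close> among the vertices from which the branch can still be completed.

  That the density exists as a limit is shown by sampling: by a Chernoff bound, a random vertex
  subset of bounded size inherits the minimum degree.\<close>

section \<open>Embeddings, induced subgraphs and degrees\<close>

text \<open>The size of \<open>A\<close> is where two degrees balance. Let r = k - l, let \<beta> be
  the density of \<open>F\<close> and a the fraction of vertices in \<open>A\<close>. For t = k - 1,
  sets inside \<open>A\<close> have relative degree 1 - (1 - \<beta>) a^r and all others at least 1
  - (1 - a)^r; equality gives \<open>Phi\<close>. For t = l the others get a^r, and k - l <= l keeps
  the first value, so a^r = 1/(2 - \<beta>), which is \<open>Psi\<close>. For l = t = 1 an edge
  meeting \<open>B\<close> has one vertex there, the degree inside \<open>A\<close> is \<beta>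
  a^(k-1) + (k-1)(1-a) a^(k-2), and equality with a^(k-1) gives a = (k-1)/(k-\<beta>).

  In the upper bounds for \<open>Phi\<close> and \<open>Psi\<close>, large sets contain
  \<open>F\<close> because the non-edges at an l-set are too few to spoil the density inside. For
  \<open>Upsilon\<close> and k > 2 that count is too weak, because it only reaches
  \<open>Psi\<close>, which is larger. Instead a nearly extremal host is used: as \<pi>_1 = \<pi>,
  its minimum and average degree nearly agree, and an \<open>F\<close>-free set has too few inner
  edges to supply the degrees of its vertices.\<close>

definition embeds :: "'a hypergraph \<Rightarrow> 'b hypergraph \<Rightarrow> bool" where
  "embeds F H \<longleftrightarrow>
     (\<exists>\<phi>. inj_on \<phi> (verts F) \<and> \<phi> ` verts F \<subseteq> verts H \<and> (\<forall>e\<in>edges F. \<phi> ` e \<in> edges H))"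

definition induced :: "'a hypergraph \<Rightarrow> 'a set \<Rightarrow> 'a hypergraph" where
  "induced H A = (A, {e \<in> edges H. e \<subseteq> A})"

text \<open>Degrees are measured against n^(k-l) / (k-l)! instead of the binomial coefficient. The
  limits agree, and a power scales cleanly when a host is replaced by a part of it.\<close>

definition ldense :: "nat \<Rightarrow> nat \<Rightarrow> real \<Rightarrow> 'a hypergraph \<Rightarrow> bool" where
  "ldense k l c H \<longleftrightarrow>
     (\<forall>S. S \<subseteq> verts H \<and> card S = l \<longrightarrow>
        c * real (card (verts H)) ^ (k - l) / fact (k - l) \<le> real (set_degree H S))"

lemma free_of_iff_not_embeds: "free_of F H \<longleftrightarrow> \<not> embeds F H"
proof -
  have "(\<exists>G. subhypergraph G H \<and> isomorphic_hypergraphs F G) \<longleftrightarrow> embeds F H"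
  proof
    assume "\<exists>G. subhypergraph G H \<and> isomorphic_hypergraphs F G"
    then obtain G \<phi> where G: "verts G \<subseteq> verts H" "edges G \<subseteq> edges H"
      "inj_on \<phi> (verts F)" "\<phi> ` verts F = verts G" "edges G = (\<lambda>e. \<phi> ` e) ` edges F"
      unfolding subhypergraph_def isomorphic_hypergraphs_def bij_betw_def by auto
    then have "\<forall>e\<in>edges F. \<phi> ` e \<in> edges H" by auto
    with G show "embeds F H" unfolding embeds_def by (intro exI[of _ \<phi>]) auto
  next
    assume "embeds F H"
    then obtain \<phi> where "inj_on \<phi> (verts F)" "\<phi> ` verts F \<subseteq> verts H" "\<forall>e\<in>edges F. \<phi> ` e \<in> edges H"
      unfolding embeds_def by blast
    then show "\<exists>G. subhypergraph G H \<and> isomorphic_hypergraphs F G"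
      unfolding subhypergraph_def isomorphic_hypergraphs_def bij_betw_def
      by (intro exI[of _ "(\<phi> ` verts F, (\<lambda>e. \<phi> ` e) ` edges F)"]) auto
  qed
  then show ?thesis unfolding free_of_def by blast
qed

lemma verts_induced [simp]: "verts (induced H A) = A"
  by (simp add: induced_def)

lemma edges_induced [simp]: "edges (induced H A) = {e \<in> edges H. e \<subseteq> A}"
  by (simp add: induced_def)

lemma kgraph_induced:
  assumes "kgraph k H" "A \<subseteq> verts H"
  shows "kgraph k (induced H A)"
  using assms finite_subset unfolding kgraph_def by auto

lemma embeds_mono:
  assumes "embeds F G" "verts G \<subseteq> verts H" "edges G \<subseteq> edges H"
  shows "embeds F H"
proof -
  from assms(1) obtain \<phi> where "inj_on \<phi> (verts F)" "\<phi> ` verts F \<subseteq> verts G"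
    "\<forall>e\<in>edges F. \<phi> ` e \<in> edges G"
    unfolding embeds_def by auto
  then show ?thesis
    unfolding embeds_def using assms(2,3) by (intro exI[of _ \<phi>]) (meson order_trans subsetD)
qed

lemma embeds_relabel_iff:
  assumes "inj_on g (verts F)" "\<And>e. e \<in> edges F \<Longrightarrow> e \<subseteq> verts F"
  shows "embeds (g ` verts F, (\<lambda>e. g ` e) ` edges F) H \<longleftrightarrow> embeds F H"
proof
  assume "embeds (g ` verts F, (\<lambda>e. g ` e) ` edges F) H"
  then obtain \<phi> where "inj_on \<phi> (g ` verts F)" "\<phi> ` g ` verts F \<subseteq> verts H"
    "\<forall>e\<in>edges F. \<phi> ` g ` e \<in> edges H"
    unfolding embeds_def by auto
  then show "embeds F H"
    unfolding embeds_def
    using assms(1) by (intro exI[of _ "\<phi> \<circ> g"]) (auto simp: comp_inj_on image_comp)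
next
  assume "embeds F H"
  then obtain \<phi> where \<phi>: "inj_on \<phi> (verts F)" "\<phi> ` verts F \<subseteq> verts H"
    "\<forall>e\<in>edges F. \<phi> ` e \<in> edges H"
    unfolding embeds_def by auto
  define h where "h = inv_into (verts F) g"
  have h: "h (g x) = x" if "x \<in> verts F" for x
    using assms(1) that by (simp add: h_def)
  have "inj_on (\<phi> \<circ> h) (g ` verts F)"
    using \<phi>(1) by (auto simp: inj_on_def h)
  moreover have "(\<phi> \<circ> h) ` g ` e = \<phi> ` e" if "e \<subseteq> verts F" for e
    unfolding image_image by (rule image_cong) (use that h in auto)
  ultimately show "embeds (g ` verts F, (\<lambda>e. g ` e) ` edges F) H"
    unfolding embeds_def using \<phi> assms(2) by (intro exI[of _ "\<phi> \<circ> h"]) auto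
qed

lemma finite_edges:
  assumes "kgraph k H" shows "finite (edges H)"
proof -
  have "edges H \<subseteq> Pow (verts H)" using assms unfolding kgraph_def by auto
  then show ?thesis using assms finite_subset unfolding kgraph_def by blast
qed

lemma card_edges_le:
  assumes "kgraph k H" shows "card (edges H) \<le> card (verts H) choose k"
proof -
  have "edges H \<subseteq> {e. e \<subseteq> verts H \<and> card e = k}" using assms unfolding kgraph_def by auto
  moreover have fin: "finite (verts H)" using assms unfolding kgraph_def by auto
  ultimately have "card (edges H) \<le> card {e. e \<subseteq> verts H \<and> card e = k}"
    by (intro card_mono) auto
  then show ?thesis by (simp add: n_subsets[OF fin])
qed

lemma set_degree_link:
  assumes "kgraph k H" "S \<subseteq> verts H"
  shows "set_degree H S = card {R. R \<subseteq> verts H - S \<and> card R = k - card S \<and> S \<union> R \<in> edges H}"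
proof -
  have fS: "finite S" using assms finite_subset unfolding kgraph_def by auto
  have "bij_betw (\<lambda>R. S \<union> R) {R. R \<subseteq> verts H - S \<and> card R = k - card S \<and> S \<union> R \<in> edges H}
      {e \<in> edges H. S \<subseteq> e}"
    unfolding bij_betw_def
  proof
    show "inj_on (\<lambda>R. S \<union> R) {R. R \<subseteq> verts H - S \<and> card R = k - card S \<and> S \<union> R \<in> edges H}"
      by (auto simp: inj_on_def)
    show "(\<lambda>R. S \<union> R) ` {R. R \<subseteq> verts H - S \<and> card R = k - card S \<and> S \<union> R \<in> edges H}
       = {e \<in> edges H. S \<subseteq> e}"
    proof safe
      fix e assume e: "e \<in> edges H" "S \<subseteq> e"
      then have "e = S \<union> (e - S)" "e - S \<subseteq> verts H - S" "card (e - S) = k - card S"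
        using assms fS unfolding kgraph_def by (auto simp: card_Diff_subset)
      then show "e \<in> (\<lambda>R. S \<union> R) ` {R. R \<subseteq> verts H - S \<and> card R = k - card S \<and> S \<union> R \<in> edges H}"
        using e by (intro image_eqI[of _ _ "e - S"]) simp_all
    qed
  qed
  from bij_betw_same_card[OF this] show ?thesis unfolding set_degree_def by simp
qed

lemma set_degree_ge_card:
  assumes "kgraph k H" "S \<subseteq> verts H"
    and "\<And>R. R \<in> \<R> \<Longrightarrow> R \<subseteq> verts H - S \<and> card R = k - card S \<and> S \<union> R \<in> edges H"
  shows "card \<R> \<le> set_degree H S"
proof -
  have "finite {R. R \<subseteq> verts H - S \<and> card R = k - card S \<and> S \<union> R \<in> edges H}"
    using assms(1) unfolding kgraph_def by auto
  then show ?thesis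
    unfolding set_degree_link[OF assms(1,2)] using assms(3) by (intro card_mono) auto
qed

lemma set_degree_le:
  assumes "kgraph k H" "S \<subseteq> verts H"
  shows "set_degree H S \<le> (card (verts H) - card S) choose (k - card S)"
proof -
  have fS: "finite S" "finite (verts H)" using assms finite_subset unfolding kgraph_def by auto
  have "set_degree H S \<le> card {R. R \<subseteq> verts H - S \<and> card R = k - card S}"
    unfolding set_degree_link[OF assms(1,2)] by (rule card_mono) (use fS in auto)
  also have "\<dots> = (card (verts H) - card S) choose (k - card S)"
    using fS assms(2) by (subst n_subsets) (auto simp: card_Diff_subset)
  finally show ?thesis .
qed

lemma card_subsets_not_inside:
  assumes "finite V" "A \<subseteq> V"
  shows "card {R. R \<subseteq> V \<and> card R = r \<and> \<not> R \<subseteq> A} = (card V choose r) - (card A choose r)"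
proof -
  have "{R. R \<subseteq> V \<and> card R = r \<and> \<not> R \<subseteq> A} = {R. R \<subseteq> V \<and> card R = r} - {R. R \<subseteq> A \<and> card R = r}"
    by auto
  also have "card \<dots> = card {R. R \<subseteq> V \<and> card R = r} - card {R. R \<subseteq> A \<and> card R = r}"
    using assms finite_subset by (intro card_Diff_subset) auto
  finally show ?thesis using assms finite_subset[OF assms(2,1)] by (simp add: n_subsets)
qed

text \<open>Restricting to \<open>A\<close> loses only link sets that leave \<open>A\<close>, even
  if all of these were edges. The additive form avoids subtraction on naturals.\<close>

lemma set_degree_induced_ge:
  assumes "kgraph k H" "A \<subseteq> verts H" "S \<subseteq> A" "card S = l"
  shows "set_degree H S + ((card A - l) choose (k - l))
    \<le> set_degree (induced H A) S + ((card (verts H) - l) choose (k - l))"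
proof -
  have fin: "finite (verts H)" using assms(1) unfolding kgraph_def by auto
  then have fin: "finite (verts H)" "finite A" "finite S"
    using finite_subset[OF assms(2)] finite_subset[OF assms(3)] by auto
  define X where "X = {R. R \<subseteq> verts H - S \<and> card R = k - l \<and> \<not> R \<subseteq> A - S}"
  have "set_degree H S \<le> card ({R. R \<subseteq> A - S \<and> card R = k - l \<and> S \<union> R \<in> edges H} \<union> X)"
    unfolding set_degree_link[OF assms(1) order_trans[OF assms(3,2)]]
    by (rule card_mono) (use fin in \<open>auto simp: X_def assms(4)\<close>)
  also have "\<dots> \<le> card {R. R \<subseteq> A - S \<and> card R = k - l \<and> S \<union> R \<in> edges H} + card X"
    by (rule card_Un_le)
  also have "{R. R \<subseteq> A - S \<and> card R = k - l \<and> S \<union> R \<in> edges H}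
     = {R. R \<subseteq> verts (induced H A) - S \<and> card R = k - card S \<and> S \<union> R \<in> edges (induced H A)}"
    using assms(3,4) by auto
  also have "card \<dots> = set_degree (induced H A) S"
    using set_degree_link[OF kgraph_induced[OF assms(1,2)], of S] assms(3) by simp
  also have "card X = ((card (verts H) - l) choose (k - l)) - ((card A - l) choose (k - l))"
    unfolding X_def using fin assms
    by (subst card_subsets_not_inside) (auto simp: card_Diff_subset)
  finally have "set_degree H S \<le> set_degree (induced H A) S +
      (((card (verts H) - l) choose (k - l)) - ((card A - l) choose (k - l)))" .
  moreover have "((card A - l) choose (k - l)) \<le> ((card (verts H) - l) choose (k - l))"
    using card_mono[OF fin(1) assms(2)] by (intro binomial_right_mono) auto
  ultimately show ?thesis by linarith
qed

section \<open>Binomial coefficients compared with powers\<close>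

lemma fact_mult_choose_le: "fact r * real (n choose r) \<le> real n ^ r"
proof -
  have "(n choose r) * fact r \<le> n ^ r" by (rule binomial_fact_pow)
  then have "real ((n choose r) * fact r) \<le> real (n ^ r)" by (simp only: of_nat_le_iff)
  then show ?thesis by (simp add: mult.commute)
qed

lemma fact_mult_choose_shift_le: "fact r * real ((n - l) choose r) \<le> real n ^ r"
  by (rule order_trans[OF fact_mult_choose_le]) (simp add: power_mono)

lemma fact_mult_choose_ge:
  assumes "r \<le> n" shows "(real n - real r) ^ r \<le> fact r * real (n choose r)"
proof -
  have "(real n - real r) ^ r = (\<Prod>i\<in>{0..<r}. (real n - real r))" by simp
  also have "\<dots> \<le> (\<Prod>i\<in>{0..<r}. real n - real i)" by (rule prod_mono) (use assms in auto)
  also have "\<dots> = fact r * (real n gchoose r)"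
    by (simp add: gbinomial_prod_rev)
  also have "\<dots> = fact r * real (n choose r)"
    by (simp add: binomial_gbinomial)
  finally show ?thesis .
qed

lemma power_diff_shift_ge:
  fixes x K :: real
  assumes "0 \<le> K" "K \<le> x"
  shows "x ^ r - r * K * x ^ (r - 1) \<le> (x - K) ^ r"
proof (cases "x = 0")
  case True then show ?thesis using assms by (cases r) auto
next
  case False
  then have x: "x > 0" using assms by auto
  have "1 + r * (- K / x) \<le> (1 + (- K / x)) ^ r"
    by (rule Bernoulli_inequality) (use x assms in auto)
  then have "x ^ r * (1 + r * (- K / x)) \<le> x ^ r * (1 + (- K / x)) ^ r"
    using x by simp
  also have "\<dots> = (x - K) ^ r"
    using x by (simp add: power_mult_distrib[symmetric] field_simps)
  also have "x ^ r * (1 + r * (- K / x)) = x ^ r - r * K * x ^ (r - 1)"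
    using x by (cases r) (auto simp: field_simps)
  finally show ?thesis .
qed

text \<open>The error is stated in n rather than m so that it is uniform over all m <= n. For m < l
  + r the estimate is trivial because its left side is not positive.\<close>

lemma fact_mult_choose_shift_ge:
  assumes "m \<le> n" "1 \<le> r"
  shows "real m ^ r - real r * real (l + r) * real n ^ (r - 1) \<le> fact r * real ((m - l) choose r)"
proof (cases "l + r \<le> m")
  case True
  have "real m ^ r - real r * real (l + r) * real n ^ (r - 1)
      \<le> real m ^ r - real r * real (l + r) * real m ^ (r - 1)"
    using assms by (intro diff_left_mono mult_left_mono power_mono) auto
  also have "\<dots> \<le> (real m - real (l + r)) ^ r"
    by (rule power_diff_shift_ge) (use True in auto)
  also have "\<dots> = (real (m - l) - real r) ^ r" using True by (simp add: of_nat_diff algebra_simps)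
  also have "\<dots> \<le> fact r * real ((m - l) choose r)"
    by (rule fact_mult_choose_ge) (use True in auto)
  finally show ?thesis .
next
  case False
  have "real m ^ r = real m * real m ^ (r - 1)" using assms by (cases r) auto
  also have "\<dots> \<le> real (l + r) * real n ^ (r - 1)"
    using False assms by (intro mult_mono power_mono) auto
  also have "\<dots> \<le> real r * (real (l + r) * real n ^ (r - 1))"
    using mult_right_mono[of 1 "real r" "real (l + r) * real n ^ (r - 1)"] assms by simp
  finally have "real m ^ r - real r * real (l + r) * real n ^ (r - 1) \<le> 0"
    by (simp only: mult.assoc diff_le_0_iff_le)
  also have "0 \<le> fact r * real ((m - l) choose r)" by simp
  finally show ?thesis .
qed

lemma eventually_power_le:
  fixes K \<epsilon> :: real
  assumes "0 < \<epsilon>" "1 \<le> r"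
  shows "\<forall>\<^sub>F n in sequentially. K * real n ^ (r - 1) \<le> \<epsilon> * real n ^ r"
proof -
  have "\<forall>\<^sub>F n in sequentially. K / \<epsilon> \<le> real n"
    by (metis eventually_at_top_linorderI filterlim_at_top filterlim_real_sequentially)
  then show ?thesis
  proof eventually_elim
    case (elim n)
    then have "K \<le> \<epsilon> * real n" using assms by (simp add: field_simps)
    then have "K * real n ^ (r - 1) \<le> \<epsilon> * real n * real n ^ (r - 1)"
      by (intro mult_right_mono) auto
    also have "\<dots> = \<epsilon> * real n ^ r" using assms by (cases r) auto
    finally show ?case .
  qed
qed

lemma eventually_choose_ge:
  fixes \<epsilon> :: real
  assumes "0 < \<epsilon>" "1 \<le> r"
  shows "\<forall>\<^sub>F n in sequentially. \<forall>m\<le>n. real m ^ r - \<epsilon> * real n ^ r \<le> fact r * real ((m - l) choose r)"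
  using eventually_power_le[OF assms, of "real r * real (l + r)"]
proof eventually_elim
  case (elim n)
  show ?case
  proof (intro allI impI)
    fix m assume "m \<le> n"
    from fact_mult_choose_shift_ge[OF this assms(2), of l] elim
    show "real m ^ r - \<epsilon> * real n ^ r \<le> fact r * real ((m - l) choose r)" by linarith
  qed
qed

text \<open>Also covers exponent 0, which occurs as k - 2 for graphs in the \<open>Upsilon\<close>
  bound.\<close>

lemma eventually_choose_ge':
  fixes \<epsilon> :: real
  assumes "0 < \<epsilon>"
  shows "\<forall>\<^sub>F n in sequentially. \<forall>m\<le>n. real m ^ j - \<epsilon> * real n ^ j \<le> fact j * real ((m - l) choose j)"
proof (cases "j = 0")
  case True then show ?thesis using assms by simp
next
  case False then show ?thesis using eventually_choose_ge[OF assms, of j l] by simp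
qed

section \<open>Sampling\<close>

text \<open>Completions are counted as words, with order and with repetitions, so that peeling off
  one letter is an exact recursion and a random completion has independent letters.\<close>

definition num_ext :: "'a set \<Rightarrow> nat \<Rightarrow> ('a list \<Rightarrow> bool) \<Rightarrow> 'a list \<Rightarrow> nat" where
  "num_ext V j Q w = card {u. length u = j \<and> set u \<subseteq> V \<and> Q (w @ u)}"

lemma finite_lists_pred:
  assumes "finite V" shows "finite {u. length u = j \<and> set u \<subseteq> V \<and> Q u}"
  by (rule finite_subset[OF _ finite_lists_length_eq[OF assms, of j]]) auto

lemma num_ext_0: "num_ext V 0 Q w = (if Q w then 1 else 0)"
proof -
  have "{u. length u = 0 \<and> set u \<subseteq> V \<and> Q (w @ u)} = (if Q w then {[]} else {})" by auto
  then show ?thesis by (simp add: num_ext_def)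
qed

lemma num_ext_Suc:
  assumes "finite V"
  shows "num_ext V (Suc j) Q w = (\<Sum>v\<in>V. num_ext V j Q (w @ [v]))"
proof -
  define X where "X v = {u. length u = j \<and> set u \<subseteq> V \<and> Q ((w @ [v]) @ u)}" for v
  have "{u. length u = Suc j \<and> set u \<subseteq> V \<and> Q (w @ u)} = (\<Union>v\<in>V. (#) v ` X v)"
  proof (intro set_eqI iffI)
    fix u assume "u \<in> {u. length u = Suc j \<and> set u \<subseteq> V \<and> Q (w @ u)}"
    then obtain v u' where "u = v # u'" "length u' = j" "v \<in> V" "set u' \<subseteq> V" "Q (w @ u)"
      by (cases u) auto
    then show "u \<in> (\<Union>v\<in>V. (#) v ` X v)" by (auto simp: X_def)
  qed (auto simp: X_def)
  moreover have "card (\<Union>v\<in>V. (#) v ` X v) = (\<Sum>v\<in>V. card ((#) v ` X v))"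
    by (rule card_UN_disjoint) (use assms finite_lists_pred[OF assms] in \<open>auto simp: X_def\<close>)
  moreover have "card ((#) v ` X v) = num_ext V j Q (w @ [v])" for v
    by (subst card_image) (auto simp: num_ext_def X_def)
  ultimately show ?thesis by (simp add: num_ext_def)
qed

lemma num_ext_plus_not:
  assumes "finite V"
  shows "num_ext V j Q w + num_ext V j (\<lambda>x. \<not> Q x) w = card V ^ j"
proof -
  have "card V ^ j = card {u. set u \<subseteq> V \<and> length u = j}"
    by (simp add: card_lists_length_eq assms)
  also have "{u. set u \<subseteq> V \<and> length u = j} =
     {u. length u = j \<and> set u \<subseteq> V \<and> Q (w @ u)} \<union> {u. length u = j \<and> set u \<subseteq> V \<and> \<not> Q (w @ u)}"
    by auto
  also have "card \<dots> = num_ext V j Q w + num_ext V j (\<lambda>x. \<not> Q x) w"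
    unfolding num_ext_def by (rule card_Un_disjoint) (use assms finite_lists_pred in auto)
  finally show ?thesis by simp
qed

text \<open>Repetitions do no harm: a word of length k whose letters form an edge must be distinct.
  Hence each link set is counted once for each of its orderings.\<close>

lemma num_ext_edges:
  assumes H: "kgraph k H" and w: "distinct w" "set w \<subseteq> verts H" "length w \<le> k"
  shows "num_ext (verts H) (k - length w) (\<lambda>x. set x \<in> edges H) w
     = fact (k - length w) * set_degree H (set w)"
proof -
  define r where "r = k - length w"
  have cw: "card (set w) = length w" using w by (simp add: distinct_card)
  define L where "L = {R. R \<subseteq> verts H - set w \<and> card R = r \<and> set w \<union> R \<in> edges H}"
  have fin: "finite (verts H)" using H by (simp add: kgraph_def)
  then have finL: "finite L" and finR: "R \<in> L \<Longrightarrow> finite R" for R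
    unfolding L_def using finite_subset by auto
  have "{u. length u = r \<and> set u \<subseteq> verts H \<and> set (w @ u) \<in> edges H} = (\<Union>R\<in>L. permutations_of_set R)"
  proof (intro set_eqI iffI)
    fix u assume "u \<in> {u. length u = r \<and> set u \<subseteq> verts H \<and> set (w @ u) \<in> edges H}"
    then have u: "length u = r" "set u \<subseteq> verts H" "set (w @ u) \<in> edges H" by auto
    then have "card (set (w @ u)) = length (w @ u)"
      using H w(3) unfolding kgraph_def by (simp add: r_def)
    then have d: "distinct (w @ u)" by (rule card_distinct)
    then have "set u \<in> L" using u by (auto simp: L_def distinct_card)
    then show "u \<in> (\<Union>R\<in>L. permutations_of_set R)" using d by (auto simp: permutations_of_set_def)
  next
    fix u assume "u \<in> (\<Union>R\<in>L. permutations_of_set R)"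
    then show "u \<in> {u. length u = r \<and> set u \<subseteq> verts H \<and> set (w @ u) \<in> edges H}"
      by (auto simp: L_def permutations_of_set_def distinct_card)
  qed
  moreover have "card (\<Union>R\<in>L. permutations_of_set R) = (\<Sum>R\<in>L. card (permutations_of_set R))"
    by (rule card_UN_disjoint[OF finL]) (auto dest!: permutations_of_setD(1))
  moreover have "(\<Sum>R\<in>L. card (permutations_of_set R)) = (\<Sum>R\<in>L. fact r)"
  proof (rule sum.cong[OF refl])
    fix R assume R: "R \<in> L"
    then have "card R = r" by (simp add: L_def)
    then show "card (permutations_of_set R) = fact r" using finR[OF R] by simp
  qed
  moreover have "set_degree H (set w) = card L"
    unfolding set_degree_link[OF H w(2)] L_def cw r_def by simp
  ultimately show ?thesis by (simp add: num_ext_def r_def[symmetric])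
qed

section \<open>A Chernoff bound\<close>

lemma exp_minus_le: "exp (- x) \<le> 1 - x + x\<^sup>2" if "0 \<le> x" for x :: real
proof -
  \<comment> \<open>The product equals 1 + x^3, so the quadratic bound holds for every nonnegative
    x, not only for small ones.\<close>
  have "1 \<le> (1 + x) * (1 - x + x\<^sup>2)"
    using that by (simp add: algebra_simps power2_eq_square)
  then have "1 / (1 + x) \<le> 1 - x + x\<^sup>2" using that by (simp add: field_simps)
  moreover have "exp (- x) \<le> 1 / (1 + x)"
    unfolding exp_minus inverse_eq_divide using that by (intro divide_left_mono) auto
  ultimately show ?thesis by linarith
qed

text \<open>Independence in counting form: the factors see the coordinates in \<open>J\<close> and
  one coordinate in \<open>K\<close> each, so the coordinates in \<open>K\<close> can be summed out
  one by one, each at the price of a factor \<open>C\<close>.\<close>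

lemma sum_prod_PiE_le:
  fixes \<phi> :: "('i \<Rightarrow> 'a) \<Rightarrow> 'a \<Rightarrow> real"
  assumes "finite J" "finite V" "finite K" "J \<inter> K = {}"
    and loc: "\<And>f g v. (\<And>j. j \<in> J \<Longrightarrow> f j = g j) \<Longrightarrow> \<phi> f v = \<phi> g v"
    and nn: "\<And>f v. 0 \<le> \<phi> f v"
    and C: "\<And>f. f \<in> J \<rightarrow>\<^sub>E V \<Longrightarrow> (\<Sum>v\<in>V. \<phi> f v) \<le> C"
  shows "(\<Sum>f\<in>(J \<union> K) \<rightarrow>\<^sub>E V. \<Prod>i\<in>K. \<phi> f (f i)) \<le> real (card V) ^ card J * C ^ card K"
  using assms(3,4)
proof (induction K rule: finite_induct)
  case empty
  show ?case using assms(1,2) by (simp add: card_PiE)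
next
  case (insert i K)
  have iJK: "i \<notin> J \<union> K" using insert by auto
  have fin: "finite ((J \<union> K) \<rightarrow>\<^sub>E V)" using assms(1,2) insert(1) by (intro finite_PiE) auto
  have "((J \<union> insert i K) \<rightarrow>\<^sub>E V) = (\<lambda>(y, g). g(i := y)) ` (V \<times> ((J \<union> K) \<rightarrow>\<^sub>E V))"
    using PiE_insert_eq[of i "J \<union> K" "\<lambda>_. V"] by simp
  moreover have "inj_on (\<lambda>(y, g). g(i := y)) (V \<times> ((J \<union> K) \<rightarrow>\<^sub>E V))"
    using inj_combinator[OF iJK, of "\<lambda>_. V"] by simp
  ultimately have "(\<Sum>f\<in>(J \<union> insert i K) \<rightarrow>\<^sub>E V. \<Prod>i\<in>insert i K. \<phi> f (f i)) =
     (\<Sum>(y, g)\<in>V \<times> ((J \<union> K) \<rightarrow>\<^sub>E V). \<Prod>j\<in>insert i K. \<phi> (g(i := y)) ((g(i := y)) j))"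
    by (simp add: sum.reindex case_prod_unfold)
  also have "\<dots> = (\<Sum>(y, g)\<in>V \<times> ((J \<union> K) \<rightarrow>\<^sub>E V). \<phi> g y * (\<Prod>j\<in>K. \<phi> g (g j)))"
  proof (intro sum.cong refl, clarify)
    fix y g
    have *: "\<phi> (g(i := y)) v = \<phi> g v" for v by (rule loc) (use insert in auto)
    have "(\<Prod>j\<in>insert i K. \<phi> (g(i := y)) ((g(i := y)) j)) = \<phi> g y * (\<Prod>j\<in>K. \<phi> g ((g(i := y)) j))"
      using insert(1,2) by (simp add: *)
    also have "(\<Prod>j\<in>K. \<phi> g ((g(i := y)) j)) = (\<Prod>j\<in>K. \<phi> g (g j))"
      by (rule prod.cong) (use insert(2) in auto)
    finally show "(\<Prod>j\<in>insert i K. \<phi> (g(i := y)) ((g(i := y)) j)) = \<phi> g y * (\<Prod>j\<in>K. \<phi> g (g j))" .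
  qed
  also have "\<dots> = (\<Sum>y\<in>V. \<Sum>g\<in>(J \<union> K) \<rightarrow>\<^sub>E V. \<phi> g y * (\<Prod>j\<in>K. \<phi> g (g j)))"
    by (simp add: sum.cartesian_product)
  also have "\<dots> = (\<Sum>g\<in>(J \<union> K) \<rightarrow>\<^sub>E V. \<Sum>y\<in>V. \<phi> g y * (\<Prod>j\<in>K. \<phi> g (g j)))"
    by (rule sum.swap)
  also have "\<dots> = (\<Sum>g\<in>(J \<union> K) \<rightarrow>\<^sub>E V. (\<Sum>y\<in>V. \<phi> g y) * (\<Prod>j\<in>K. \<phi> g (g j)))"
    by (simp add: sum_distrib_right)
  also have "\<dots> \<le> (\<Sum>g\<in>(J \<union> K) \<rightarrow>\<^sub>E V. C * (\<Prod>j\<in>K. \<phi> g (g j)))"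
  proof (rule sum_mono, rule mult_right_mono)
    fix g assume g: "g \<in> (J \<union> K) \<rightarrow>\<^sub>E V"
    have "(\<Sum>y\<in>V. \<phi> g y) = (\<Sum>y\<in>V. \<phi> (restrict g J) y)"
      by (intro sum.cong refl loc) auto
    also have "\<dots> \<le> C" by (rule C) (use g in auto)
    finally show "(\<Sum>y\<in>V. \<phi> g y) \<le> C" .
    show "0 \<le> (\<Prod>j\<in>K. \<phi> g (g j))" by (intro prod_nonneg nn)
  qed
  also have "\<dots> = C * (\<Sum>g\<in>(J \<union> K) \<rightarrow>\<^sub>E V. \<Prod>j\<in>K. \<phi> g (g j))"
    by (simp add: sum_distrib_left)
  also have "\<dots> \<le> C * (real (card V) ^ card J * C ^ card K)"
  \<comment> \<open>\<open>C\<close> is known to be nonnegative only if some function is there to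
    bound a sum of \<phi>; otherwise both sides vanish.\<close>
  proof (cases "J \<rightarrow>\<^sub>E V = {}")
    case True
    then have "(J \<union> K) \<rightarrow>\<^sub>E V = {}" by (auto simp: PiE_eq_empty_iff)
    moreover have "real (card V) ^ card J = 0"
    proof -
      have "V = {}" "J \<noteq> {}" using True by (auto simp: PiE_eq_empty_iff)
      then show ?thesis using assms(1) by (simp add: card_gt_0_iff)
    qed
    ultimately show ?thesis by (simp only: sum.empty mult_zero_left mult_zero_right order_refl)
  next
    case False
    then obtain f where "f \<in> J \<rightarrow>\<^sub>E V" by auto
    then have "0 \<le> C" using C sum_nonneg[of V "\<phi> f"] nn by (meson order_trans)
    then show ?thesis using insert by (intro mult_left_mono) auto
  qed
  finally show ?case using insert(1,2) by (simp add: algebra_simps)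
qed

text \<open>A Chernoff bound for sampling with replacement: the coordinates in \<open>K\<close> are independent of
  those in \<open>J\<close>, on which the sampled function \<open>g\<close> may depend.\<close>

lemma card_low_samples_le:
  fixes g :: "('i \<Rightarrow> 'a) \<Rightarrow> 'a \<Rightarrow> real"
  assumes fin: "finite J" "finite V" "finite K" "J \<inter> K = {}" and "0 < \<epsilon>"
    and loc: "\<And>f h v. (\<And>j. j \<in> J \<Longrightarrow> f j = h j) \<Longrightarrow> g f v = g h v"
    and g01: "\<And>f v. 0 \<le> g f v" "\<And>f v. g f v \<le> 1"
    and \<mu>: "\<And>f. (\<Sum>v\<in>V. g f v) = real (card V) * \<mu> f"
      "\<And>f h. (\<And>j. j \<in> J \<Longrightarrow> f j = h j) \<Longrightarrow> \<mu> f = \<mu> h"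
  shows "real (card {f \<in> (J \<union> K) \<rightarrow>\<^sub>E V. (\<Sum>i\<in>K. g f (f i)) \<le> real (card K) * (\<mu> f - \<epsilon>)})
    \<le> real (card V) ^ card (J \<union> K) * exp (- \<epsilon>\<^sup>2 / 4 * real (card K))"
proof -
  \<comment> \<open>Exponential weight with parameter s = \<epsilon>/2, the minimiser of the
    exponent s^2 - s \<epsilon> that comes out of \<open>exp_minus_le\<close>; this is the origin of
    \<epsilon>^2/4.\<close>
  define \<phi> where "\<phi> f v = exp (- (\<epsilon> / 2) * (g f v - \<mu> f + \<epsilon>))" for f v
  define C where "C = real (card V) * exp (- \<epsilon>\<^sup>2 / 4)"
  define B where "B = {f \<in> (J \<union> K) \<rightarrow>\<^sub>E V. (\<Sum>i\<in>K. g f (f i)) \<le> real (card K) * (\<mu> f - \<epsilon>)}"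
  have finP: "finite ((J \<union> K) \<rightarrow>\<^sub>E V)" using fin by (intro finite_PiE) auto
  have C: "(\<Sum>v\<in>V. \<phi> f v) \<le> C" for f
  proof -
    have "(\<Sum>v\<in>V. \<phi> f v) = (\<Sum>v\<in>V. exp (- (\<epsilon> / 2 * g f v)) * exp ((\<epsilon> / 2) * (\<mu> f - \<epsilon>)))"
    proof (rule sum.cong[OF refl])
      fix v
      have "- (\<epsilon> / 2) * (g f v - \<mu> f + \<epsilon>) = - (\<epsilon> / 2 * g f v) + (\<epsilon> / 2) * (\<mu> f - \<epsilon>)"
        by (simp add: field_simps)
      then show "\<phi> f v = exp (- (\<epsilon> / 2 * g f v)) * exp ((\<epsilon> / 2) * (\<mu> f - \<epsilon>))"
        unfolding \<phi>_def by (simp only: exp_add)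
    qed
    also have "\<dots> = (\<Sum>v\<in>V. exp (- (\<epsilon> / 2 * g f v))) * exp ((\<epsilon> / 2) * (\<mu> f - \<epsilon>))"
      by (simp add: sum_distrib_right)
    also have "\<dots> \<le> (real (card V) * exp (- (\<epsilon> / 2) * \<mu> f + (\<epsilon> / 2)\<^sup>2)) * exp ((\<epsilon> / 2) * (\<mu> f - \<epsilon>))"
    proof (rule mult_right_mono)
      have "(\<Sum>v\<in>V. exp (- (\<epsilon> / 2 * g f v))) \<le> (\<Sum>v\<in>V. 1 - \<epsilon> / 2 * g f v + (\<epsilon> / 2)\<^sup>2)"
      proof (rule sum_mono)
        fix v
        have "exp (- (\<epsilon> / 2 * g f v)) \<le> 1 - \<epsilon> / 2 * g f v + (\<epsilon> / 2 * g f v)\<^sup>2"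
          by (rule exp_minus_le) (use g01 \<open>0 < \<epsilon>\<close> in auto)
        also have "(\<epsilon> / 2 * g f v)\<^sup>2 \<le> (\<epsilon> / 2)\<^sup>2"
          using g01[of f v] \<open>0 < \<epsilon>\<close> by (intro power_mono) (auto simp: mult_le_cancel_left1)
        finally show "exp (- (\<epsilon> / 2 * g f v)) \<le> 1 - \<epsilon> / 2 * g f v + (\<epsilon> / 2)\<^sup>2" by simp
      qed
      also have "\<dots> = real (card V) * (1 + (- (\<epsilon> / 2) * \<mu> f + (\<epsilon> / 2)\<^sup>2))"
        by (simp add: sum.distrib sum_subtractf \<mu>(1) sum_distrib_left[symmetric] sum_divide_distrib[symmetric] algebra_simps)
      also have "\<dots> \<le> real (card V) * exp (- (\<epsilon> / 2) * \<mu> f + (\<epsilon> / 2)\<^sup>2)"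
        by (intro mult_left_mono exp_ge_add_one_self) auto
      finally show "(\<Sum>v\<in>V. exp (- (\<epsilon> / 2 * g f v))) \<le> real (card V) * exp (- (\<epsilon> / 2) * \<mu> f + (\<epsilon> / 2)\<^sup>2)" .
    qed auto
    also have "\<dots> = real (card V) * exp ((- (\<epsilon> / 2) * \<mu> f + (\<epsilon> / 2)\<^sup>2) + (\<epsilon> / 2) * (\<mu> f - \<epsilon>))"
      by (simp only: exp_add mult.assoc)
    also have "(- (\<epsilon> / 2) * \<mu> f + (\<epsilon> / 2)\<^sup>2) + (\<epsilon> / 2) * (\<mu> f - \<epsilon>) = - \<epsilon>\<^sup>2 / 4"
      by (simp add: field_simps power2_eq_square)
    finally show ?thesis by (simp add: C_def)
  qed
  have loc': "\<phi> f v = \<phi> h v" if "\<And>j. j \<in> J \<Longrightarrow> f j = h j" for f h v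
    unfolding \<phi>_def using loc[OF that] \<mu>(2)[OF that] by simp
  have "real (card B) = (\<Sum>f\<in>B. 1)" by simp
  \<comment> \<open>Markov's inequality: on the bad set the product of the weights is at least
    1.\<close>
  also have "\<dots> \<le> (\<Sum>f\<in>B. \<Prod>i\<in>K. \<phi> f (f i))"
  proof (rule sum_mono)
    fix f assume "f \<in> B"
    then have "(\<Sum>i\<in>K. g f (f i)) - real (card K) * (\<mu> f - \<epsilon>) \<le> 0" by (simp add: B_def)
    moreover have "(\<Prod>i\<in>K. \<phi> f (f i)) = exp (- (\<epsilon> / 2) * ((\<Sum>i\<in>K. g f (f i)) - real (card K) * (\<mu> f - \<epsilon>)))"
    proof -
      have "(\<Prod>i\<in>K. \<phi> f (f i)) = exp (\<Sum>i\<in>K. - (\<epsilon> / 2) * (g f (f i) - \<mu> f + \<epsilon>))"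
        unfolding \<phi>_def by (simp add: exp_sum fin)
      also have "(\<Sum>i\<in>K. - (\<epsilon> / 2) * (g f (f i) - \<mu> f + \<epsilon>))
         = - (\<epsilon> / 2) * (\<Sum>i\<in>K. g f (f i) - (\<mu> f - \<epsilon>))"
        by (simp add: sum_distrib_left algebra_simps)
      also have "(\<Sum>i\<in>K. g f (f i) - (\<mu> f - \<epsilon>)) = (\<Sum>i\<in>K. g f (f i)) - real (card K) * (\<mu> f - \<epsilon>)"
        by (simp add: sum_subtractf)
      finally show ?thesis .
    qed
    ultimately show "1 \<le> (\<Prod>i\<in>K. \<phi> f (f i))"
      using \<open>0 < \<epsilon>\<close> by (simp add: mult_le_0_iff zero_le_mult_iff mult_nonneg_nonpos)
  qed
  also have "\<dots> \<le> (\<Sum>f\<in>(J \<union> K) \<rightarrow>\<^sub>E V. \<Prod>i\<in>K. \<phi> f (f i))"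
    by (rule sum_mono2) (use finP in \<open>auto simp: B_def \<phi>_def intro!: prod_nonneg\<close>)
  also have "\<dots> \<le> real (card V) ^ card J * C ^ card K"
    by (rule sum_prod_PiE_le[OF fin loc' _ C]) (auto simp: \<phi>_def)
  also have "C ^ card K = real (card V) ^ card K * exp (- \<epsilon>\<^sup>2 / 4 * real (card K))"
    unfolding C_def by (simp add: power_mult_distrib exp_of_nat_mult[symmetric] mult.commute)
  finally show ?thesis unfolding B_def using fin by (simp add: card_Un_disjoint power_add)
qed

text \<open>The birthday bound: for 2 m^2 <= n at least half of all maps are injective. Sampling is
  done with replacement for the sake of independence, and this makes it possible to discard samples
  with collisions.\<close>

lemma card_injections_ge:
  assumes "finite V" "2 * m\<^sup>2 \<le> card V"
  shows "real (card V) ^ m \<le> 2 * real (card {f \<in> {..<m} \<rightarrow>\<^sub>E V. inj_on f {..<m}})"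
proof (cases "m = 0")
  case True then show ?thesis by simp
next
  case False
  define n where "n = card V"
  have mn: "m \<le> n"
    using assms(2) False unfolding n_def by (metis le_trans le_square le_add2 mult_2 power2_eq_square)
  have "real (card {f \<in> {..<m} \<rightarrow>\<^sub>E V. inj_on f {..<m}}) = (\<Prod>i\<in>{0..<m}. real n - real i)"
    by (subst card_inj_on_subset_funcset) (use assms mn in \<open>auto simp: of_nat_diff n_def\<close>)
  also have "\<dots> \<ge> (\<Prod>i\<in>{0..<m}. real n - real m)"
    by (rule prod_mono) (use mn in auto)
  also have "(\<Prod>i\<in>{0..<m}. real n - real m) = (real n - real m) ^ m" by simp
  finally have 1: "(real n - real m) ^ m \<le> real (card {f \<in> {..<m} \<rightarrow>\<^sub>E V. inj_on f {..<m}})" .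
  have "2 * real m ^ 2 \<le> real n" using assms(2) unfolding n_def
    by (metis of_nat_le_iff of_nat_mult of_nat_numeral of_nat_power)
  then have "(2 * real m ^ 2) * real n ^ (m - 1) \<le> real n * real n ^ (m - 1)"
    by (rule mult_right_mono) simp
  also have "real n * real n ^ (m - 1) = real n ^ m" using False by (cases m) auto
  finally have "real n ^ m \<le> 2 * (real n ^ m - real m * real m * real n ^ (m - 1))"
    by (simp add: power2_eq_square algebra_simps)
  also have "\<dots> \<le> 2 * (real n - real m) ^ m"
    using power_diff_shift_ge[of "real m" "real n" m] mn by simp
  finally show ?thesis using 1 by (simp add: n_def)
qed

text \<open>The probability that a uniformly random completion of \<open>w\<close> spans an edge;
  for a listing of an l-set it is the normalised degree. It is a martingale in \<open>w\<close>
  (\<open>completion_density_step\<close>), so sampling errors can be controlled one vertex at a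
  time.\<close>

definition completion_density :: "nat \<Rightarrow> 'a hypergraph \<Rightarrow> 'a list \<Rightarrow> real" where
  "completion_density k H w =
     real (num_ext (verts H) (k - length w) (\<lambda>x. set x \<in> edges H) w)
       / real (card (verts H)) ^ (k - length w)"

lemma completion_density_bounds:
  assumes "finite (verts H)"
  shows "0 \<le> completion_density k H w" "completion_density k H w \<le> 1"
proof -
  show "0 \<le> completion_density k H w" by (simp add: completion_density_def)
  have "num_ext (verts H) (k - length w) (\<lambda>x. set x \<in> edges H) w \<le> card (verts H) ^ (k - length w)"
    using num_ext_plus_not[OF assms, of "k - length w" "\<lambda>x. set x \<in> edges H" w] by linarith
  then have "real (num_ext (verts H) (k - length w) (\<lambda>x. set x \<in> edges H) w)
     \<le> real (card (verts H)) ^ (k - length w)" by (metis of_nat_le_iff of_nat_power)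
  moreover have "a / b \<le> 1" if "0 \<le> a" "a \<le> b" for a b :: real
    using that by (cases "b = 0") (auto simp: divide_le_eq_1)
  ultimately show "completion_density k H w \<le> 1"
    unfolding completion_density_def by simp
qed

lemma completion_density_step:
  assumes "finite (verts H)" "verts H \<noteq> {}" "length w < k"
  shows "(\<Sum>v\<in>verts H. completion_density k H (w @ [v]))
     = real (card (verts H)) * completion_density k H w"
proof -
  obtain j where j: "k - length w = Suc j" using assms(3) by (metis Suc_diff_Suc)
  then have j': "k - Suc (length w) = j" by simp
  have "card (verts H) > 0" using assms by (simp add: card_gt_0_iff)
  then show ?thesis
    unfolding completion_density_def
    by (simp add: j j' num_ext_Suc[OF assms(1)] sum_divide_distrib[symmetric])
qed

lemma eventually_sampling_error_small:
  fixes c :: real assumes "0 < c"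
  shows "\<forall>\<^sub>F m in sequentially. real k * real m ^ k * exp (- c * (real m - real k)) < 1 / 2"
proof -
  have "(\<lambda>m. real k * real m ^ k * exp (- c * (real m - real k))) \<longlonglongrightarrow> 0"
    using assms by real_asymp
  then show ?thesis by (rule order_tendstoD) simp
qed

text \<open>The word \<open>js\<close> lists sample positions, and every length below k is included
  because degrees in the sample are estimated letter by letter. The positions in \<open>js\<close>
  are left out of the sum since only the others are independent of \<open>map f js\<close>.\<close>

definition good_sample :: "nat \<Rightarrow> real \<Rightarrow> 'a hypergraph \<Rightarrow> nat \<Rightarrow> (nat \<Rightarrow> 'a) \<Rightarrow> bool" where
  "good_sample k \<epsilon> H m f \<longleftrightarrow> (\<forall>js. set js \<subseteq> {..<m} \<and> length js < k \<longrightarrow>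
     real (card ({..<m} - set js)) * (completion_density k H (map f js) - \<epsilon>)
       < (\<Sum>i\<in>{..<m} - set js. completion_density k H (map f js @ [f i])))"

text \<open>Union bound over the at most k m^k words \<open>js\<close>: the exponentially small
  failure probabilities sum to less than 1/2, whereas at least half of the maps are injective. The
  threshold for m does not depend on the host, which only has to be large compared with m.\<close>

lemma eventually_good_sample:
  fixes \<epsilon> :: real
  assumes "0 < \<epsilon>"
  shows "\<forall>\<^sub>F m in sequentially. \<forall>H :: 'a hypergraph. kgraph k H \<longrightarrow> 2 * m\<^sup>2 \<le> card (verts H) \<longrightarrow>
    (\<exists>f \<in> {..<m} \<rightarrow>\<^sub>E verts H. inj_on f {..<m} \<and> good_sample k \<epsilon> H m f)"
proof -
  have "0 < \<epsilon>\<^sup>2 / 4" using assms by simp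
  from eventually_sampling_error_small[OF this, of k] eventually_gt_at_top[of 0]
  show ?thesis
  proof eventually_elim
    case (elim m)
    show ?case
    proof (intro allI impI)
      fix H :: "'a hypergraph" assume H: "kgraph k H" "2 * m\<^sup>2 \<le> card (verts H)"
      define V where "V = verts H"
      define n where "n = card V"
      define h where "h = completion_density k H"
      have fV: "finite V" using H(1) by (simp add: kgraph_def V_def)
      have n0: "n > 0" using H(2) elim(2) by (metis V_def n_def le_zero_eq mult_is_0 not_gr_zero power_not_zero zero_neq_numeral)
      have Vne: "V \<noteq> {}" using n0 n_def by auto
      define bad where "bad js = {f \<in> {..<m} \<rightarrow>\<^sub>E V.
          (\<Sum>i\<in>{..<m} - set js. h (map f js @ [f i])) \<le> real (card ({..<m} - set js)) * (h (map f js) - \<epsilon>)}" for js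
      define JS where "JS = {js. set js \<subseteq> {..<m} \<and> length js < k}"
      have finJS: "finite JS"
        by (rule finite_subset[OF _ finite_lists_length_le[of "{..<m}" k]]) (auto simp: JS_def)
      have cardJS: "card JS \<le> k * m ^ k"
      proof -
        have "JS = (\<Union>j<k. {js. set js \<subseteq> {..<m} \<and> length js = j})" by (auto simp: JS_def)
        then have "card JS \<le> (\<Sum>j<k. card {js. set js \<subseteq> {..<m} \<and> length js = j})"
          by (simp only:) (rule card_UN_le, simp)
        also have "\<dots> = (\<Sum>j<k. m ^ j)" by (simp add: card_lists_length_eq)
        also have "\<dots> \<le> (\<Sum>j<k. m ^ k)" by (rule sum_mono) (use elim(2) in \<open>auto intro: power_increasing\<close>)
        finally show ?thesis by simp
      qed
      \<comment> \<open>The exponent has m - k in place of m because up to k positions are taken by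
        \<open>js\<close>.\<close>
      define q where "q = real n ^ m * exp (- (\<epsilon>\<^sup>2 / 4) * (real m - real k))"
      have card_bad: "real (card (bad js)) \<le> q" if js: "js \<in> JS" for js
      proof -
        have u: "set js \<union> ({..<m} - set js) = {..<m}" using js by (auto simp: JS_def)
        have "real (card {f \<in> (set js \<union> ({..<m} - set js)) \<rightarrow>\<^sub>E V.
            (\<Sum>i\<in>{..<m} - set js. h (map f js @ [f i])) \<le> real (card ({..<m} - set js)) * (h (map f js) - \<epsilon>)})
          \<le> real (card V) ^ card (set js \<union> ({..<m} - set js)) * exp (- \<epsilon>\<^sup>2 / 4 * real (card ({..<m} - set js)))"
        proof (rule card_low_samples_le[where g = "\<lambda>f v. h (map f js @ [v])" and \<mu> = "\<lambda>f. h (map f js)"])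
          show "0 \<le> h (map f js @ [v])" "h (map f js @ [v]) \<le> 1" for f v
            using completion_density_bounds[OF fV[unfolded V_def]] by (auto simp: h_def)
          show "(\<Sum>v\<in>V. h (map f js @ [v])) = real (card V) * h (map f js)" for f
            unfolding h_def V_def by (rule completion_density_step) (use fV Vne js in \<open>auto simp: V_def JS_def\<close>)
          show "h (map f js @ [v]) = h (map g js @ [v])" if "\<And>j. j \<in> set js \<Longrightarrow> f j = g j" for f g v
          proof -
            have "map f js = map g js" using that by auto
            then show ?thesis by (simp only:)
          qed
          show "h (map f js) = h (map g js)" if "\<And>j. j \<in> set js \<Longrightarrow> f j = g j" for f g
          proof -
            have "map f js = map g js" using that by auto
            then show ?thesis by (simp only:)
          qed
        qed (use fV assms in auto)
        also have "\<dots> \<le> q"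
        proof -
          have "m - k \<le> card ({..<m} - set js)"
          proof -
            have "card (set js) \<le> k" using js card_length[of js] by (auto simp: JS_def)
            then show ?thesis using diff_card_le_card_Diff[of "set js" "{..<m}"] by simp
          qed
          then have "real m - real k \<le> real (card ({..<m} - set js))" by linarith
          then have "- \<epsilon>\<^sup>2 / 4 * real (card ({..<m} - set js)) \<le> - (\<epsilon>\<^sup>2 / 4) * (real m - real k)"
            by (simp add: mult_left_mono)
          then show ?thesis unfolding u q_def n_def by (intro mult_mono) auto
        qed
        finally show ?thesis unfolding bad_def u .
      qed
      have "\<exists>f\<in>{f \<in> {..<m} \<rightarrow>\<^sub>E V. inj_on f {..<m}}. f \<notin> (\<Union>js\<in>JS. bad js)"
      proof (rule ccontr)
        assume "\<not> ?thesis"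
        then have sub: "{f \<in> {..<m} \<rightarrow>\<^sub>E V. inj_on f {..<m}} \<subseteq> (\<Union>js\<in>JS. bad js)" by blast
        have "finite (bad js)" for js
          by (rule finite_subset[of _ "{..<m} \<rightarrow>\<^sub>E V"]) (use fV in \<open>auto simp: bad_def intro: finite_PiE\<close>)
        then have "card {f \<in> {..<m} \<rightarrow>\<^sub>E V. inj_on f {..<m}} \<le> card (\<Union>js\<in>JS. bad js)"
          using finJS by (intro card_mono sub) auto
        also have "\<dots> \<le> (\<Sum>js\<in>JS. card (bad js))" by (rule card_UN_le[OF finJS])
        finally have "real (card {f \<in> {..<m} \<rightarrow>\<^sub>E V. inj_on f {..<m}}) \<le> (\<Sum>js\<in>JS. real (card (bad js)))"
          by (metis of_nat_le_iff of_nat_sum)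
        also have "\<dots> \<le> (\<Sum>js\<in>JS. q)" by (intro sum_mono card_bad)
        also have "\<dots> = real (card JS) * q" by simp
        also have "\<dots> \<le> real (k * m ^ k) * q"
          using cardJS by (intro mult_right_mono iffD2[OF of_nat_le_iff]) (simp_all add: q_def)
        also have "\<dots> = real n ^ m * (real k * real m ^ k * exp (- (\<epsilon>\<^sup>2 / 4) * (real m - real k)))"
          by (simp add: q_def)
        also have "\<dots> < real n ^ m * (1 / 2)"
          using elim(1) n0 by (intro mult_strict_left_mono) auto
        finally show False using card_injections_ge[OF fV, of m] H(2) by (simp add: n_def V_def)
      qed
      then obtain f where f: "f \<in> {..<m} \<rightarrow>\<^sub>E V" "inj_on f {..<m}" "f \<notin> (\<Union>js\<in>JS. bad js)" by blast
      show "\<exists>f\<in>{..<m} \<rightarrow>\<^sub>E verts H. inj_on f {..<m} \<and> good_sample k \<epsilon> H m f"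
        unfolding good_sample_def
      proof (rule bexI[of _ f], intro conjI allI impI)
        fix js assume "set js \<subseteq> {..<m} \<and> length js < k"
        then have "js \<in> JS" by (simp add: JS_def)
        then have "f \<notin> bad js" using f(3) by blast
        then show "real (card ({..<m} - set js)) * (completion_density k H (map f js) - \<epsilon>)
            < (\<Sum>i\<in>{..<m} - set js. completion_density k H (map f js @ [f i]))"
          using f(1) by (simp add: bad_def h_def not_le)
      qed (use f in \<open>auto simp: V_def\<close>)
    qed
  qed
qed

text \<open>Each of the d letters costs 2 \<epsilon>: one \<epsilon> for the deviation of the
  sample, the other for the at most k positions already in \<open>js\<close>, a share of at most
  \<epsilon> by the assumption on m.\<close>

lemma num_ext_sample_ge:
  fixes \<epsilon> :: real
  assumes "0 < \<epsilon>" "real k \<le> \<epsilon> * real m" and fin: "finite (verts H)"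
    and good: "good_sample k \<epsilon> H m f"
  shows "set js \<subseteq> {..<m} \<Longrightarrow> length js + d = k \<Longrightarrow>
    real m ^ d * (completion_density k H (map f js) - 2 * \<epsilon> * real d)
      \<le> real (num_ext {..<m} d (\<lambda>x. set (map f x) \<in> edges H) js)"
proof (induction d arbitrary: js)
  case 0
  then show ?case by (auto simp: completion_density_def num_ext_0)
next
  case (Suc d)
  define h where "h = completion_density k H"
  have h01: "0 \<le> h w" "h w \<le> 1" for w
    unfolding h_def by (rule completion_density_bounds[OF fin])+
  have len: "length js < k" "length js \<le> k" using Suc.prems by auto
  define K where "K = {..<m} - set js"
  have cK: "card K \<le> m" "m - k \<le> card K"
  proof -
    show "card K \<le> m" unfolding K_def using card_mono[of "{..<m}" "{..<m} - set js"] by auto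
    have "card (set js) \<le> k" using len card_length[of js] by auto
    then show "m - k \<le> card K" unfolding K_def
      using diff_card_le_card_Diff[of "set js" "{..<m}"] by simp
  qed
  have "real m * (h (map f js) - 2 * \<epsilon>) \<le> real m * (h (map f js) - \<epsilon>) - real k"
    using assms(2) by (simp add: algebra_simps)
  also have "\<dots> \<le> real (card K) * (h (map f js) - \<epsilon>)"
  proof (cases "h (map f js) - \<epsilon> \<ge> 0")
    case True
    have "real m - real k \<le> real (card K)" using cK(2) by linarith
    then have "(real m - real k) * (h (map f js) - \<epsilon>) \<le> real (card K) * (h (map f js) - \<epsilon>)"
      using True by (rule mult_right_mono)
    moreover have "real k * (h (map f js) - \<epsilon>) \<le> real k * 1"
      using h01(2)[of "map f js"] assms(1) by (intro mult_left_mono) auto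
    ultimately show ?thesis by (simp add: algebra_simps)
  next
    case False
    then have "real m * (h (map f js) - \<epsilon>) \<le> real (card K) * (h (map f js) - \<epsilon>)"
      using cK(1) by (intro mult_right_mono_neg) auto
    then show ?thesis by simp
  qed
  also have "\<dots> \<le> (\<Sum>i\<in>K. h (map f js @ [f i]))"
    using good Suc.prems(1) len(1) unfolding h_def K_def good_sample_def by (intro less_imp_le) blast
  also have "\<dots> \<le> (\<Sum>i<m. h (map f js @ [f i]))"
    by (rule sum_mono2) (auto simp: K_def h01)
  finally have step: "real m * (h (map f js) - 2 * \<epsilon>) \<le> (\<Sum>i<m. h (map f js @ [f i]))" .
  have "real m ^ Suc d * (h (map f js) - 2 * \<epsilon> * real (Suc d))
     = real m ^ d * (real m * (h (map f js) - 2 * \<epsilon>) - real m * (2 * \<epsilon> * real d))"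
    by (simp add: algebra_simps)
  also have "\<dots> \<le> real m ^ d * ((\<Sum>i<m. h (map f js @ [f i])) - real m * (2 * \<epsilon> * real d))"
    using step by (intro mult_left_mono) auto
  also have "\<dots> = (\<Sum>i<m. real m ^ d * (h (map f (js @ [i])) - 2 * \<epsilon> * real d))"
    by (simp add: sum_subtractf sum_distrib_left right_diff_distrib)
  also have "\<dots> \<le> (\<Sum>i<m. real (num_ext {..<m} d (\<lambda>x. set (map f x) \<in> edges H) (js @ [i])))"
    unfolding h_def by (rule sum_mono, rule Suc.IH) (use Suc.prems in auto)
  also have "\<dots> = real (num_ext {..<m} (Suc d) (\<lambda>x. set (map f x) \<in> edges H) js)"
    by (simp add: num_ext_Suc)
  finally show ?case by (simp add: h_def)
qed

lemma num_ext_image: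
  assumes "inj_on f I" "set js \<subseteq> I" "finite I"
  shows "num_ext I d (\<lambda>x. Q (map f x)) js = num_ext (f ` I) d Q (map f js)"
proof -
  have "bij_betw (map f) {u. length u = d \<and> set u \<subseteq> I \<and> Q (map f (js @ u))}
     {u. length u = d \<and> set u \<subseteq> f ` I \<and> Q (map f js @ u)}"
    unfolding bij_betw_def
  proof
    show "inj_on (map f) {u. length u = d \<and> set u \<subseteq> I \<and> Q (map f (js @ u))}"
      by (rule inj_onI) (auto intro!: map_inj_on[of f] inj_on_subset[OF assms(1)])
    show "map f ` {u. length u = d \<and> set u \<subseteq> I \<and> Q (map f (js @ u))} =
      {u. length u = d \<and> set u \<subseteq> f ` I \<and> Q (map f js @ u)}"
    proof (intro set_eqI iffI)
      fix u assume u: "u \<in> {u. length u = d \<and> set u \<subseteq> f ` I \<and> Q (map f js @ u)}"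
      define u' where "u' = map (inv_into I f) u"
      have "map f u' = u" unfolding u'_def map_map
        by (rule map_idI) (use u in \<open>auto simp: f_inv_into_f\<close>)
      moreover have "set u' \<subseteq> I" using u by (auto simp: u'_def intro: inv_into_into)
      moreover have "length u' = d" using u by (simp add: u'_def)
      ultimately show "u \<in> map f ` {u. length u = d \<and> set u \<subseteq> I \<and> Q (map f (js @ u))}"
        using u by (intro image_eqI[of _ _ u']) auto
    qed (auto intro!: imageI)
  qed
  from bij_betw_same_card[OF this] show ?thesis by (simp add: num_ext_def)
qed

lemma num_ext_induced:
  assumes "A \<subseteq> verts H" "set w \<subseteq> A"
  shows "num_ext A d (\<lambda>x. set x \<in> edges (induced H A)) w = num_ext A d (\<lambda>x. set x \<in> edges H) w"
proof -
  have "{u. length u = d \<and> set u \<subseteq> A \<and> set (w @ u) \<in> edges (induced H A)}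
    = {u. length u = d \<and> set u \<subseteq> A \<and> set (w @ u) \<in> edges H}" using assms by auto
  then show ?thesis by (simp add: num_ext_def)
qed

text \<open>The order of quantifiers matters: one m serves all hosts of at least 2 m^2 vertices and
  all densities c. This is what later compares the extremal value at m with all later ones.\<close>

lemma ldense_sample:
  fixes \<epsilon> :: real
  assumes "l < k" "0 < \<epsilon>"
  shows "\<forall>\<^sub>F m in sequentially. \<forall>(H :: 'a hypergraph) c. kgraph k H \<longrightarrow> 2 * m\<^sup>2 \<le> card (verts H) \<longrightarrow>
    ldense k l c H \<longrightarrow> (\<exists>M\<subseteq>verts H. card M = m \<and> ldense k l (c - \<epsilon>) (induced H M))"
proof -
  \<comment> \<open>There are k - l <= k letters to complete, each costing 2 \<epsilon>'.\<close>
  define \<epsilon>' where "\<epsilon>' = \<epsilon> / (2 * real k)"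
  have e': "0 < \<epsilon>'" using assms by (simp add: \<epsilon>'_def)
  have "\<forall>\<^sub>F m in sequentially. real k / \<epsilon>' \<le> real m"
    by (metis eventually_at_top_linorderI filterlim_at_top filterlim_real_sequentially)
  then have "\<forall>\<^sub>F m in sequentially. real k \<le> \<epsilon>' * real m"
    by eventually_elim (use e' in \<open>simp add: field_simps\<close>)
  with eventually_good_sample[OF e', where ?'a = 'a, of k] eventually_gt_at_top[of 0]
  show ?thesis
  proof eventually_elim
    case (elim m)
    show ?case
    proof (intro allI impI)
      fix H :: "'a hypergraph" and c
      assume H: "kgraph k H" "2 * m\<^sup>2 \<le> card (verts H)" "ldense k l c H"
      then have fin: "finite (verts H)" by (simp add: kgraph_def)
      from elim(1)[rule_format, OF H(1,2)] obtain f
        where f: "f \<in> {..<m} \<rightarrow>\<^sub>E verts H" "inj_on f {..<m}" and good: "good_sample k \<epsilon>' H m f"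
        by (elim bexE conjE)
      define M where "M = f ` {..<m}"
      have M: "M \<subseteq> verts H" "card M = m"
        using f by (auto simp: M_def card_image PiE_def Pi_def)
      have "ldense k l (c - \<epsilon>) (induced H M)"
        unfolding ldense_def
      proof (intro allI impI)
        fix S assume "S \<subseteq> verts (induced H M) \<and> card S = l"
        then have S: "S \<subseteq> M" "card S = l" by auto
        have finS: "finite S" using S(1) M(1) fin finite_subset by metis
        obtain J where J: "J \<subseteq> {..<m}" "S = f ` J" "inj_on f J"
          using S(1) f(2) unfolding M_def by (metis subset_imageE inj_on_subset)
        have fJ: "finite J" using J(1) finite_subset by blast
        obtain js where js: "set js = J" "distinct js" using finite_distinct_list[OF fJ] by blast
        define w where "w = map f js"
        have w: "set w = S" "distinct w" "length w = l"
        proof -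
          show "set w = S" by (simp add: w_def js J)
          show "distinct w" using js J by (simp add: w_def distinct_map)
          then show "length w = l" using \<open>set w = S\<close> S(2) by (metis distinct_card)
        qed
        define r where "r = k - l"
        have SV: "S \<subseteq> verts H" using S M by auto
        have n0: "card (verts H) > 0"
          using M elim(2) fin by (metis card_gt_0_iff card_mono le_zero_eq not_gr_zero)
        have "c \<le> completion_density k H w"
        proof -
          have "c * real (card (verts H)) ^ r / fact r \<le> real (set_degree H S)"
            using H(3) SV S(2) unfolding ldense_def r_def by blast
          then have "c * real (card (verts H)) ^ r \<le> fact r * real (set_degree H S)"
            by (simp add: field_simps)
          also have "\<dots> = real (num_ext (verts H) r (\<lambda>x. set x \<in> edges H) w)"
            using num_ext_edges[OF H(1) w(2)] w(1,3) SV assms(1) unfolding r_def by simp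
          finally show ?thesis unfolding completion_density_def w(3) r_def[symmetric]
            using n0 by (simp add: field_simps)
        qed
        moreover have "2 * \<epsilon>' * real r \<le> \<epsilon>"
        proof -
          have "2 * \<epsilon>' * real r = \<epsilon> * (real r / real k)" by (simp add: \<epsilon>'_def)
          also have "\<dots> \<le> \<epsilon> * 1" using assms by (intro mult_left_mono) (auto simp: r_def)
          finally show ?thesis by simp
        qed
        ultimately have "real m ^ r * (c - \<epsilon>) \<le> real m ^ r * (completion_density k H w - 2 * \<epsilon>' * real r)"
          by (intro mult_left_mono) auto
        also have "\<dots> \<le> real (num_ext {..<m} r (\<lambda>x. set (map f x) \<in> edges H) js)"
          unfolding w_def
          by (rule num_ext_sample_ge[OF e' elim(3) fin good])
            (use js J w assms in \<open>auto simp: w_def r_def\<close>)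
        also have "num_ext {..<m} r (\<lambda>x. set (map f x) \<in> edges H) js = num_ext M r (\<lambda>x. set x \<in> edges H) w"
          unfolding M_def w_def
          by (rule num_ext_image[OF f(2), where Q = "\<lambda>x. set x \<in> edges H"]) (use js J in auto)
        also have "\<dots> = num_ext M r (\<lambda>x. set x \<in> edges (induced H M)) w"
          by (rule num_ext_induced[symmetric]) (use M S w in auto)
        also have "\<dots> = fact r * set_degree (induced H M) S"
          using num_ext_edges[OF kgraph_induced[OF H(1) M(1)] w(2)] w(1,3) S assms(1) unfolding r_def by simp
        finally show "(c - \<epsilon>) * real (card (verts (induced H M))) ^ (k - l) / fact (k - l)
          \<le> real (set_degree (induced H M) S)"
          by (simp add: M(2) r_def field_simps)
      qed
      then show "\<exists>M\<subseteq>verts H. card M = m \<and> ldense k l (c - \<epsilon>) (induced H M)" using M by blast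
    qed
  qed
qed

section \<open>The density as a limit\<close>

text \<open>A monotone subsequence supplies the limit L. Late terms of the subsequence are nearly
  below any given late term, so the sequence stays above L up to an error; one subsequence term
  close to L keeps all later terms nearly below L.\<close>

lemma convergent_if_almost_decreasing:
  fixes d :: "nat \<Rightarrow> real"
  assumes "\<And>n. a \<le> d n" "\<And>n. d n \<le> b"
    and dec: "\<And>\<epsilon>. 0 < \<epsilon> \<Longrightarrow> \<forall>\<^sub>F m in sequentially. \<forall>\<^sub>F n in sequentially. d n \<le> d m + \<epsilon>"
  shows "convergent d"
proof -
  have "Bseq d"
    by (rule BseqI'[of _ "\<bar>a\<bar> + \<bar>b\<bar>"]) (use assms(1,2) in \<open>auto simp: abs_le_iff, (smt (verit))+\<close>)
  obtain s where s: "strict_mono s" "monoseq (\<lambda>n. d (s n))"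
    using seq_monosub[of d] by (auto simp: o_def)
  have "Bseq (\<lambda>n. d (s n))" by (rule Bseq_subseq[OF \<open>Bseq d\<close>])
  then obtain L where L: "(\<lambda>n. d (s n)) \<longlonglongrightarrow> L"
    using Bseq_monoseq_convergent s(2) convergent_def by metis
  have "d \<longlonglongrightarrow> L"
  proof (rule tendstoI)
    fix e :: real assume "0 < e"
    then have e: "0 < e / 3" by simp
    have fs: "filterlim s sequentially sequentially" by (rule filterlim_subseq[OF s(1)])
    have lower: "\<forall>\<^sub>F m in sequentially. L \<le> d m + e / 3"
      using dec[OF e]
    proof eventually_elim
      case (elim m)
      have "\<forall>\<^sub>F n in sequentially. d (s n) \<le> d m + e / 3"
        using eventually_compose_filterlim[OF elim fs] .
      then show ?case by (rule tendsto_upperbound[OF L]) simp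
    qed
    have "\<forall>\<^sub>F i in sequentially. d (s i) < L + e / 3"
      using order_tendstoD(2)[OF L] e by simp
    moreover have "\<forall>\<^sub>F i in sequentially. \<forall>\<^sub>F n in sequentially. d n \<le> d (s i) + e / 3"
      using eventually_compose_filterlim[OF dec[OF e] fs] .
    ultimately have "\<exists>i. d (s i) < L + e / 3 \<and> (\<forall>\<^sub>F n in sequentially. d n \<le> d (s i) + e / 3)"
      using eventually_happens'[OF _ eventually_conj] by (metis (no_types, lifting) sequentially_bot)
    then obtain i where i: "d (s i) < L + e / 3" "\<forall>\<^sub>F n in sequentially. d n \<le> d (s i) + e / 3" by blast
    from lower i(2) show "\<forall>\<^sub>F n in sequentially. dist (d n) L < e"
      by eventually_elim (use i(1) e in \<open>auto simp: dist_real_def abs_less_iff\<close>)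
  qed
  then show ?thesis by (auto simp: convergent_def)
qed

lemma min_degree_eq_set_degree:
  assumes "finite (verts H)" "l \<le> card (verts H)"
  obtains S where "S \<subseteq> verts H" "card S = l" "min_degree l H = set_degree H S"
    "\<And>T. T \<subseteq> verts H \<Longrightarrow> card T = l \<Longrightarrow> min_degree l H \<le> set_degree H T"
proof -
  define D where "D = {set_degree H S | S. S \<subseteq> verts H \<and> card S = l}"
  have "D = set_degree H ` {S \<in> Pow (verts H). card S = l}" by (auto simp: D_def)
  then have "finite D" using assms(1) by simp
  moreover obtain S0 where "S0 \<subseteq> verts H" "card S0 = l"
    using obtain_subset_with_card_n[OF assms(2)] by metis
  then have "D \<noteq> {}" by (auto simp: D_def)
  ultimately have m: "Min D \<in> D" "\<And>x. x \<in> D \<Longrightarrow> Min D \<le> x" by auto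
  have md: "min_degree l H = Min D" by (simp add: min_degree_def D_def)
  from m(1) obtain S where S: "S \<subseteq> verts H" "card S = l" "Min D = set_degree H S"
    by (auto simp: D_def)
  show thesis
  proof (rule that[OF S(1,2)])
    show "min_degree l H = set_degree H S" by (simp add: md S)
    show "min_degree l H \<le> set_degree H T" if "T \<subseteq> verts H" "card T = l" for T
      unfolding md by (rule m(2)) (use that in \<open>auto simp: D_def\<close>)
  qed
qed

lemma ldense_iff_min_degree:
  assumes "finite (verts H)" "l \<le> card (verts H)"
  shows "ldense k l c H \<longleftrightarrow> c * real (card (verts H)) ^ (k - l) / fact (k - l) \<le> real (min_degree l H)"
proof -
  obtain S where S: "S \<subseteq> verts H" "card S = l" "min_degree l H = set_degree H S"
    "\<And>T. T \<subseteq> verts H \<Longrightarrow> card T = l \<Longrightarrow> min_degree l H \<le> set_degree H T"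
    using min_degree_eq_set_degree[OF assms] by blast
  show ?thesis
  proof
    assume "ldense k l c H"
    then show "c * real (card (verts H)) ^ (k - l) / fact (k - l) \<le> real (min_degree l H)"
      unfolding ldense_def S(3) using S(1,2) by blast
  next
    assume a: "c * real (card (verts H)) ^ (k - l) / fact (k - l) \<le> real (min_degree l H)"
    show "ldense k l c H"
      unfolding ldense_def
    proof (intro allI impI)
      fix T assume "T \<subseteq> verts H \<and> card T = l"
      then have "real (min_degree l H) \<le> real (set_degree H T)" using S(4) by simp
      with a show "c * real (card (verts H)) ^ (k - l) / fact (k - l) \<le> real (set_degree H T)"
        by linarith
    qed
  qed
qed

lemma edgeless_kgraph: "kgraph k ({..<n::nat}, {})"
  by (simp add: kgraph_def)

lemma edgeless_free:
  assumes "edges F \<noteq> {}" shows "\<not> embeds F (V, {})"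
  using assms by (auto simp: embeds_def)

text \<open>Turns \<open>Max\<close> and \<open>Min\<close> into an extremal host and a bound.
  Although infinitely many hosts compete, their minimum degrees are bounded by a binomial
  coefficient, and the edgeless host is always admissible. The hypothesis l <= n keeps
  \<open>Min\<close> away from the empty set.\<close>

lemma ex_degree_extremal:
  assumes "edges F \<noteq> {}" "l \<le> n"
  obtains H :: "nat hypergraph" where "kgraph k H" "card (verts H) = n" "\<not> embeds F H"
    "min_degree l H = ex_degree k l n F"
    "\<And>G :: nat hypergraph. kgraph k G \<Longrightarrow> card (verts G) = n \<Longrightarrow> \<not> embeds F G \<Longrightarrow>
       min_degree l G \<le> ex_degree k l n F"
proof -
  define D where "D = {min_degree l H | H :: nat hypergraph. kgraph k H \<and> card (verts H) = n \<and> free_of F H}"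
  have "D \<subseteq> {..(n - l) choose (k - l)}"
  proof
    fix x assume "x \<in> D"
    then obtain H :: "nat hypergraph" where H: "x = min_degree l H" "kgraph k H" "card (verts H) = n"
      by (auto simp: D_def)
    have "finite (verts H)" using H by (simp add: kgraph_def)
    then obtain S where "S \<subseteq> verts H" "card S = l" "min_degree l H = set_degree H S"
      using min_degree_eq_set_degree[of H l] H(3) assms(2) by blast
    then show "x \<in> {..(n - l) choose (k - l)}" using set_degree_le[OF H(2), of S] H by simp
  qed
  then have fD: "finite D" by (rule finite_subset) simp
  have "min_degree l ({..<n}, {} :: nat set set) \<in> D"
    unfolding D_def using edgeless_kgraph[of k n] edgeless_free[OF assms(1), of "{..<n}"]
    by (intro CollectI exI[of _ "({..<n}, {})"]) (simp add: free_of_iff_not_embeds)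
  then have "D \<noteq> {}" by blast
  then have m: "Max D \<in> D" "\<And>x. x \<in> D \<Longrightarrow> x \<le> Max D"
    using Max_in[OF fD] Max_ge[OF fD] by simp_all
  have md: "ex_degree k l n F = Max D" by (simp add: ex_degree_def D_def)
  from m(1) obtain H :: "nat hypergraph" where
    H: "Max D = min_degree l H" "kgraph k H" "card (verts H) = n" "free_of F H"
    unfolding D_def by blast
  show thesis
  proof (rule that[OF H(2,3)])
    show "\<not> embeds F H" using H(4) by (simp add: free_of_iff_not_embeds)
    show "min_degree l H = ex_degree k l n F" by (simp add: md H)
    fix G :: "nat hypergraph"
    assume "kgraph k G" "card (verts G) = n" "\<not> embeds F G"
    then show "min_degree l G \<le> ex_degree k l n F"
      unfolding md D_def
      by (intro m(2)[unfolded D_def] CollectI exI[of _ G]) (simp add: free_of_iff_not_embeds)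
  qed
qed

lemma ex_edges_extremal:
  assumes "edges F \<noteq> {}"
  obtains H :: "nat hypergraph" where "kgraph k H" "card (verts H) = n" "\<not> embeds F H"
    "card (edges H) = ex_edges k n F"
    "\<And>G :: nat hypergraph. kgraph k G \<Longrightarrow> card (verts G) = n \<Longrightarrow> \<not> embeds F G \<Longrightarrow>
       card (edges G) \<le> ex_edges k n F"
proof -
  define D where "D = {card (edges H) | H :: nat hypergraph. kgraph k H \<and> card (verts H) = n \<and> free_of F H}"
  have "D \<subseteq> {..n choose k}"
  proof
    fix x assume "x \<in> D"
    then obtain H :: "nat hypergraph" where "x = card (edges H)" "kgraph k H" "card (verts H) = n"
      by (auto simp: D_def)
    then show "x \<in> {..n choose k}" using card_edges_le[of k H] by simp
  qed
  then have fD: "finite D" by (rule finite_subset) simp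
  have "card ({} :: nat set set) \<in> D"
    unfolding D_def using edgeless_kgraph[of k n] edgeless_free[OF assms(1), of "{..<n}"]
    by (intro CollectI exI[of _ "({..<n}, {})"]) (simp add: free_of_iff_not_embeds)
  then have "D \<noteq> {}" by blast
  then have m: "Max D \<in> D" "\<And>x. x \<in> D \<Longrightarrow> x \<le> Max D"
    using Max_in[OF fD] Max_ge[OF fD] by simp_all
  have md: "ex_edges k n F = Max D" by (simp add: ex_edges_def D_def)
  from m(1) obtain H :: "nat hypergraph" where
    H: "Max D = card (edges H)" "kgraph k H" "card (verts H) = n" "free_of F H"
    unfolding D_def by blast
  show thesis
  proof (rule that[OF H(2,3)])
    show "\<not> embeds F H" using H(4) by (simp add: free_of_iff_not_embeds)
    show "card (edges H) = ex_edges k n F" by (simp add: md H)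
    fix G :: "nat hypergraph"
    assume "kgraph k G" "card (verts G) = n" "\<not> embeds F G"
    then show "card (edges G) \<le> ex_edges k n F"
      unfolding md D_def
      by (intro m(2)[unfolded D_def] CollectI exI[of _ G]) (simp add: free_of_iff_not_embeds)
  qed
qed

section \<open>Normalised extremal degrees and their convergence\<close>

definition norm_ex_degree :: "nat \<Rightarrow> nat \<Rightarrow> nat hypergraph \<Rightarrow> nat \<Rightarrow> real" where
  "norm_ex_degree k l F n = fact (k - l) * real (ex_degree k l n F) / real n ^ (k - l)"

lemma ex_degree_eq_norm:
  assumes "0 < n"
  shows "real (ex_degree k l n F) = norm_ex_degree k l F n * real n ^ (k - l) / fact (k - l)"
  using assms by (simp add: norm_ex_degree_def)

lemma norm_ex_degree_extremal:
  assumes "edges F \<noteq> {}" "l \<le> n" "0 < n"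
  obtains H :: "nat hypergraph" where "kgraph k H" "card (verts H) = n" "\<not> embeds F H"
    "ldense k l (norm_ex_degree k l F n) H"
proof -
  obtain H :: "nat hypergraph" where H: "kgraph k H" "card (verts H) = n" "\<not> embeds F H"
    "min_degree l H = ex_degree k l n F"
    using ex_degree_extremal[OF assms(1,2)] by metis
  have "ldense k l (norm_ex_degree k l F n) H"
    by (subst ldense_iff_min_degree)
      (use H assms ex_degree_eq_norm[OF assms(3), of k l F] in \<open>auto simp: kgraph_def\<close>)
  with H that show thesis by blast
qed

lemma norm_ex_degree_ge:
  fixes H :: "nat hypergraph"
  assumes "edges F \<noteq> {}" "l \<le> n" "0 < n" "kgraph k H" "card (verts H) = n" "\<not> embeds F H" "ldense k l c H"
  shows "c \<le> norm_ex_degree k l F n"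
proof -
  have "c * real n ^ (k - l) / fact (k - l) \<le> real (min_degree l H)"
    using assms ldense_iff_min_degree[of H l k c] by (simp add: kgraph_def)
  also have "min_degree l H \<le> ex_degree k l n F"
    by (rule ex_degree_extremal[OF assms(1,2), of k]) (use assms in blast)
  finally have "c * real n ^ (k - l) / fact (k - l) \<le> norm_ex_degree k l F n * real n ^ (k - l) / fact (k - l)"
    using ex_degree_eq_norm[OF assms(3), of k l F] by simp
  then show ?thesis using assms(3) by (simp add: divide_le_cancel)
qed

lemma norm_ex_degree_bounds:
  assumes "edges F \<noteq> {}" "l < k"
  shows "0 \<le> norm_ex_degree k l F n" "l \<le> n \<Longrightarrow> norm_ex_degree k l F n \<le> 1"
proof -
  show "0 \<le> norm_ex_degree k l F n" by (simp add: norm_ex_degree_def)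
  assume ln: "l \<le> n"
  obtain H :: "nat hypergraph" where H: "kgraph k H" "card (verts H) = n"
    "min_degree l H = ex_degree k l n F"
    using ex_degree_extremal[OF assms(1) ln] by metis
  obtain S where S: "S \<subseteq> verts H" "card S = l" "min_degree l H = set_degree H S"
    using min_degree_eq_set_degree[of H l] H(1,2) ln unfolding kgraph_def by metis
  have "ex_degree k l n F \<le> (n - l) choose (k - l)"
    using set_degree_le[OF H(1) S(1)] S H by simp
  then have "fact (k - l) * real (ex_degree k l n F) \<le> fact (k - l) * real ((n - l) choose (k - l))"
    by simp
  also have "\<dots> \<le> real n ^ (k - l)" by (rule fact_mult_choose_shift_le)
  finally have "fact (k - l) * real (ex_degree k l n F) \<le> real n ^ (k - l)" .
  moreover have "a / b \<le> 1" if "0 \<le> b" "a \<le> b" for a b :: real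
    using that by (cases "b = 0") (auto simp: divide_le_eq_1)
  ultimately show "norm_ex_degree k l F n \<le> 1"
    unfolding norm_ex_degree_def by simp
qed

lemma fact_choose_shift_ratio_tendsto:
  "(\<lambda>n. fact r * real ((n - l) choose r) / real n ^ r) \<longlonglongrightarrow> 1"
proof (cases "r = 0")
  case True then show ?thesis by simp
next
  case False
  show ?thesis
  proof (rule tendstoI)
    fix e :: real assume e: "0 < e"
    have "\<forall>\<^sub>F n in sequentially. \<forall>m\<le>n. real m ^ r - (e / 2) * real n ^ r \<le> fact r * real ((m - l) choose r)"
      by (rule eventually_choose_ge) (use e False in auto)
    then show "\<forall>\<^sub>F n in sequentially. dist (fact r * real ((n - l) choose r) / real n ^ r) 1 < e"
      using eventually_gt_at_top[of 0]
    proof eventually_elim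
      case (elim n)
      define x where "x = fact r * real ((n - l) choose r)"
      have p: "real n ^ r > 0" using elim(2) by simp
      have "(1 - e / 2) * real n ^ r \<le> x" using elim(1) by (auto simp: x_def algebra_simps)
      then have "1 - e / 2 \<le> x / real n ^ r" using p by (simp add: pos_le_divide_eq)
      moreover have "x \<le> 1 * real n ^ r" unfolding x_def using fact_mult_choose_shift_le by simp
      then have "x / real n ^ r \<le> 1" using p by (simp add: pos_divide_le_eq)
      ultimately show ?case unfolding x_def[symmetric] dist_real_def using e by (simp add: abs_less_iff)
    qed
  qed
qed

text \<open>A good m-vertex sample of an extremal host is again \<open>F\<close>-free and hardly
  less dense, so the normalised values almost decrease.\<close>

lemma norm_ex_degree_convergent:
  assumes "edges F \<noteq> {}" "l < k"
  shows "convergent (norm_ex_degree k l F)"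
proof -
  \<comment> \<open>The shift skips n < l, where the minimum degree is unspecified, and n = 0, where
    the normalisation divides by zero; from there on the values lie between 0 and 1.\<close>
  define d where "d n = norm_ex_degree k l F (n + l + 1)" for n
  have "convergent d"
  proof (rule convergent_if_almost_decreasing[of 0 _ 1])
    show "0 \<le> d n" "d n \<le> 1" for n using norm_ex_degree_bounds[OF assms] by (auto simp: d_def)
    fix \<epsilon> :: real assume e: "0 < \<epsilon>"
    define P where "P m \<longleftrightarrow> (\<forall>(H :: nat hypergraph) c. kgraph k H \<longrightarrow> 2 * m\<^sup>2 \<le> card (verts H) \<longrightarrow>
      ldense k l c H \<longrightarrow> (\<exists>M\<subseteq>verts H. card M = m \<and> ldense k l (c - \<epsilon>) (induced H M)))" for m
    have "\<forall>\<^sub>F m in sequentially. P m" unfolding P_def by (rule ldense_sample[OF assms(2) e])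
    then have "\<forall>\<^sub>F m in sequentially. P (m + (l + 1))"
      by (rule sequentially_offset)
    then show "\<forall>\<^sub>F m in sequentially. \<forall>\<^sub>F n in sequentially. d n \<le> d m + \<epsilon>"
    proof eventually_elim
      case (elim m)
      define m' where "m' = m + l + 1"
      have Pm: "P m'" using elim by (simp add: m'_def add.assoc)
      have "d n \<le> d m + \<epsilon>" if n: "2 * m'\<^sup>2 \<le> n" for n
      proof -
        define n' where "n' = n + l + 1"
        obtain H :: "nat hypergraph" where H: "kgraph k H" "card (verts H) = n'" "\<not> embeds F H"
          "ldense k l (norm_ex_degree k l F n') H"
          using norm_ex_degree_extremal[OF assms(1), of l n' k] by (auto simp: n'_def)
        have "2 * m'\<^sup>2 \<le> card (verts H)" using H(2) n by (simp add: n'_def)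
        from Pm[unfolded P_def, rule_format, OF H(1) this H(4)] obtain M where
          M: "M \<subseteq> verts H" "card M = m'" "ldense k l (norm_ex_degree k l F n' - \<epsilon>) (induced H M)"
          by blast
        have "\<not> embeds F (induced H M)"
          using H(3) embeds_mono[of F "induced H M" H] M(1) by auto
        then have "norm_ex_degree k l F n' - \<epsilon> \<le> norm_ex_degree k l F m'"
          by (intro norm_ex_degree_ge[OF assms(1) _ _ kgraph_induced[OF H(1) M(1)] _ _ M(3)])
            (auto simp: M(2) m'_def)
        then show ?thesis by (simp add: d_def n'_def m'_def)
      qed
      then show ?case by (auto simp: eventually_sequentially)
    qed
  qed
  then have "convergent (\<lambda>n. norm_ex_degree k l F (n + (l + 1)))" by (simp add: d_def[abs_def] add.assoc)
  then show ?thesis unfolding convergent_ignore_initial_segment .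
qed

text \<open>\<open>lim\<close> has a usable value only thanks to the convergence above; the quotient
  of the two normalisations tends to 1.\<close>

lemma norm_ex_degree_tendsto:
  assumes "edges F \<noteq> {}" "l < k"
  shows "norm_ex_degree k l F \<longlonglongrightarrow> degree_turan_density k l F"
proof -
  obtain L where L: "norm_ex_degree k l F \<longlonglongrightarrow> L"
    using norm_ex_degree_convergent[OF assms] by (auto simp: convergent_def)
  have "(\<lambda>n. norm_ex_degree k l F n / (fact (k - l) * real ((n - l) choose (k - l)) / real n ^ (k - l))) \<longlonglongrightarrow> L / 1"
    by (intro tendsto_divide L fact_choose_shift_ratio_tendsto) simp
  moreover have "\<forall>\<^sub>F n in sequentially. norm_ex_degree k l F n / (fact (k - l) * real ((n - l) choose (k - l)) / real n ^ (k - l))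
      = real (ex_degree k l n F) / real ((n - l) choose (k - l))"
    using eventually_gt_at_top[of 0] by eventually_elim (simp add: norm_ex_degree_def)
  ultimately have "(\<lambda>n. real (ex_degree k l n F) / real ((n - l) choose (k - l))) \<longlonglongrightarrow> L"
    using Lim_transform_eventually by force
  then have "degree_turan_density k l F = L" unfolding degree_turan_density_def by (rule limI)
  with L show ?thesis by simp
qed

lemma degree_turan_density_bounds:
  assumes "edges F \<noteq> {}" "l < k"
  shows "0 \<le> degree_turan_density k l F" "degree_turan_density k l F \<le> 1"
proof -
  show "0 \<le> degree_turan_density k l F"
    by (rule tendsto_lowerbound[OF norm_ex_degree_tendsto[OF assms]])
      (use norm_ex_degree_bounds[OF assms] in auto)
  show "degree_turan_density k l F \<le> 1"
    by (rule tendsto_upperbound[OF norm_ex_degree_tendsto[OF assms]])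
      (use norm_ex_degree_bounds[OF assms] in \<open>auto simp: eventually_sequentially\<close>)
qed

lemma eventually_embeds_above_density:
  assumes "edges F \<noteq> {}" "l < k" "degree_turan_density k l F < c"
  shows "\<forall>\<^sub>F n in sequentially. \<forall>H :: nat hypergraph.
    kgraph k H \<longrightarrow> card (verts H) = n \<longrightarrow> ldense k l c H \<longrightarrow> embeds F H"
  using order_tendstoD(2)[OF norm_ex_degree_tendsto[OF assms(1,2)] assms(3)]
    eventually_ge_at_top[of l] eventually_gt_at_top[of 0]
proof eventually_elim
  case (elim n)
  show ?case
  proof (intro allI impI, rule ccontr)
    fix H :: "nat hypergraph"
    assume "kgraph k H" "card (verts H) = n" "ldense k l c H" "\<not> embeds F H"
    then have "c \<le> norm_ex_degree k l F n" by (intro norm_ex_degree_ge[OF assms(1) elim(2,3)])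
    with elim(1) show False by simp
  qed
qed

lemma eventually_free_below_density:
  assumes "edges F \<noteq> {}" "l < k" "c < degree_turan_density k l F"
  shows "\<forall>\<^sub>F n in sequentially. \<exists>H :: nat hypergraph.
    kgraph k H \<and> card (verts H) = n \<and> \<not> embeds F H \<and> ldense k l c H"
  using order_tendstoD(1)[OF norm_ex_degree_tendsto[OF assms(1,2)] assms(3)]
    eventually_ge_at_top[of l] eventually_gt_at_top[of 0]
proof eventually_elim
  case (elim n)
  obtain H :: "nat hypergraph" where H: "kgraph k H" "card (verts H) = n" "\<not> embeds F H"
    "ldense k l (norm_ex_degree k l F n) H"
    using norm_ex_degree_extremal[OF assms(1) elim(2,3)] by metis
  have "ldense k l c H"
    unfolding ldense_def
  proof (intro allI impI)
    fix S assume S: "S \<subseteq> verts H \<and> card S = l"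
    have "c * real (card (verts H)) ^ (k - l) / fact (k - l)
      \<le> norm_ex_degree k l F n * real (card (verts H)) ^ (k - l) / fact (k - l)"
      using elim(1) by (intro divide_right_mono mult_right_mono) auto
    also have "\<dots> \<le> real (set_degree H S)" using H(4) S unfolding ldense_def by blast
    finally show "c * real (card (verts H)) ^ (k - l) / fact (k - l) \<le> real (set_degree H S)" .
  qed
  with H show ?case by blast
qed

lemma degree_turan_density_ge:
  assumes "edges F \<noteq> {}" "l < k"
    and "\<And>\<epsilon>. 0 < \<epsilon> \<Longrightarrow> \<forall>\<^sub>F n in sequentially. \<exists>H :: nat hypergraph.
      kgraph k H \<and> card (verts H) = n \<and> \<not> embeds F H \<and> ldense k l (x - \<epsilon>) H"
  shows "x \<le> degree_turan_density k l F"
proof (rule ccontr)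
  assume "\<not> ?thesis"
  then have gap: "0 < (x - degree_turan_density k l F) / 2" by simp
  define c where "c = x - (x - degree_turan_density k l F) / 2"
  have "degree_turan_density k l F < c" using gap by (simp add: c_def field_simps)
  from eventually_happens'[OF sequentially_bot
      eventually_conj[OF eventually_embeds_above_density[OF assms(1,2) this] assms(3)[OF gap, folded c_def]]]
  obtain n and H :: "nat hypergraph" where
    all: "\<forall>H :: nat hypergraph. kgraph k H \<longrightarrow> card (verts H) = n \<longrightarrow> ldense k l c H \<longrightarrow> embeds F H"
    and H: "kgraph k H" "card (verts H) = n" "\<not> embeds F H" "ldense k l c H"
    by (elim exE conjE)
  from all[rule_format, OF H(1,2,4)] H(3) show False by contradiction
qed

text \<open>Only c < 1 has to be considered because the density is at most 1. For \<open>Phi\<close>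
  this keeps 1 - c positive, so that roots can be taken.\<close>

lemma degree_turan_density_le:
  assumes "edges F \<noteq> {}" "l < k" "x < 1"
    and "\<And>c. x < c \<Longrightarrow> c < 1 \<Longrightarrow> \<forall>\<^sub>F n in sequentially. \<forall>H :: nat hypergraph.
      kgraph k H \<longrightarrow> card (verts H) = n \<longrightarrow> ldense k l c H \<longrightarrow> embeds F H"
  shows "degree_turan_density k l F \<le> x"
proof (rule ccontr)
  assume "\<not> ?thesis"
  then have gap: "x < degree_turan_density k l F" by simp
  obtain c where c: "x < c" "c < degree_turan_density k l F" using dense[OF gap] by blast
  have "c < 1" using c(2) degree_turan_density_bounds(2)[OF assms(1,2)] by simp
  from eventually_happens'[OF sequentially_bot
      eventually_conj[OF assms(4)[OF c(1) this] eventually_free_below_density[OF assms(1,2) c(2)]]]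
  obtain n and H :: "nat hypergraph" where
    all: "\<forall>H :: nat hypergraph. kgraph k H \<longrightarrow> card (verts H) = n \<longrightarrow> ldense k l c H \<longrightarrow> embeds F H"
    and H: "kgraph k H" "card (verts H) = n" "\<not> embeds F H" "ldense k l c H"
    by (elim exE conjE)
  from all[rule_format, OF H(1,2,4)] H(3) show False by contradiction
qed

section \<open>Edge densities\<close>

lemma sum_degrees:
  assumes "kgraph k H"
  shows "(\<Sum>v\<in>verts H. set_degree H {v}) = k * card (edges H)"
proof -
  have fin: "finite (verts H)" "finite (edges H)"
    using assms finite_edges[OF assms] by (auto simp: kgraph_def)
  have "(\<Sum>v\<in>verts H. set_degree H {v}) = (\<Sum>v\<in>verts H. \<Sum>e\<in>edges H. if v \<in> e then 1 else 0)"
    by (rule sum.cong[OF refl]) (simp add: set_degree_def fin(2) sum.If_cases Int_def)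
  also have "\<dots> = (\<Sum>e\<in>edges H. \<Sum>v\<in>verts H. if v \<in> e then 1 else 0)" by (rule sum.swap)
  also have "\<dots> = (\<Sum>e\<in>edges H. k)"
  proof (rule sum.cong[OF refl])
    fix e assume "e \<in> edges H"
    then have e: "e \<subseteq> verts H" "card e = k" using assms by (auto simp: kgraph_def)
    then have "{v \<in> verts H. v \<in> e} = e" by auto
    then show "(\<Sum>v\<in>verts H. if v \<in> e then 1 else 0) = k"
      using e(2) fin(1) by (simp add: sum.If_cases Int_def)
  qed
  finally show ?thesis by simp
qed

lemma card_edges_delete_vertex:
  assumes "kgraph k H"
  shows "card (edges H) = card (edges (induced H (verts H - {v}))) + set_degree H {v}"
proof -
  have fin: "finite (edges H)" by (rule finite_edges[OF assms])
  have sub: "\<And>e. e \<in> edges H \<Longrightarrow> e \<subseteq> verts H" using assms by (simp add: kgraph_def)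
  have "edges H = {e \<in> edges H. e \<subseteq> verts H - {v}} \<union> {e \<in> edges H. {v} \<subseteq> e}"
    using sub by auto
  then have "card (edges H) = card ({e \<in> edges H. e \<subseteq> verts H - {v}} \<union> {e \<in> edges H. {v} \<subseteq> e})"
    by (rule arg_cong)
  also have "\<dots> = card {e \<in> edges H. e \<subseteq> verts H - {v}} + card {e \<in> edges H. {v} \<subseteq> e}"
    by (rule card_Un_disjoint) (use fin in auto)
  finally show ?thesis by (simp add: set_degree_def)
qed

text \<open>Delete a vertex of minimum degree from an extremal host: the vertex removes at most the
  extremal minimum degree, and the rest is still \<open>F\<close>-free.\<close>

lemma ex_edges_Suc_le:
  assumes "edges F \<noteq> {}"
  shows "ex_edges k (Suc n) F \<le> ex_edges k n F + ex_degree k 1 (Suc n) F"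
proof -
  obtain H :: "nat hypergraph" where H: "kgraph k H" "card (verts H) = Suc n" "\<not> embeds F H"
    "card (edges H) = ex_edges k (Suc n) F"
    using ex_edges_extremal[OF assms, of k "Suc n"] by metis
  have fin: "finite (verts H)" using H by (simp add: kgraph_def)
  have one: "1 \<le> card (verts H)" using H(2) by simp
  obtain S where S: "S \<subseteq> verts H" "card S = 1" "min_degree 1 H = set_degree H S"
    by (rule min_degree_eq_set_degree[OF fin one])
  then obtain v where v: "S = {v}" using card_1_singletonE by metis
  have "min_degree 1 H \<le> ex_degree k 1 (Suc n) F"
    by (rule ex_degree_extremal[OF assms, of 1 "Suc n" k]) (use H in auto)
  moreover have "card (edges (induced H (verts H - {v}))) \<le> ex_edges k n F"
  proof (rule ex_edges_extremal[OF assms, of k n])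
    assume *: "\<And>G :: nat hypergraph. kgraph k G \<Longrightarrow> card (verts G) = n \<Longrightarrow> \<not> embeds F G \<Longrightarrow>
       card (edges G) \<le> ex_edges k n F"
    show ?thesis
    proof (rule *)
      show "kgraph k (induced H (verts H - {v}))" by (rule kgraph_induced[OF H(1)]) auto
      show "card (verts (induced H (verts H - {v}))) = n" using H(2) S(1) v fin by simp
      show "\<not> embeds F (induced H (verts H - {v}))"
        using H(3) embeds_mono[of F "induced H (verts H - {v})" H] by auto
    qed
  qed
  ultimately show ?thesis
    using card_edges_delete_vertex[OF H(1), of v] H(4) S(3) v by simp
qed

lemma mult_ex_degree_le_ex_edges:
  assumes "edges F \<noteq> {}" "1 \<le> n"
  shows "n * ex_degree k 1 n F \<le> k * ex_edges k n F"
proof -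
  obtain H :: "nat hypergraph" where H: "kgraph k H" "card (verts H) = n" "\<not> embeds F H"
    "min_degree 1 H = ex_degree k 1 n F"
    using ex_degree_extremal[OF assms, of k] by metis
  have fin: "finite (verts H)" using H by (simp add: kgraph_def)
  have "card (edges H) \<le> ex_edges k n F"
    by (rule ex_edges_extremal[OF assms(1), of k n]) (use H in blast)
  have "n * ex_degree k 1 n F = (\<Sum>v\<in>verts H. ex_degree k 1 n F)" using H(2) by simp
  also have "\<dots> \<le> (\<Sum>v\<in>verts H. set_degree H {v})"
  proof (rule sum_mono)
    fix v assume v: "v \<in> verts H"
    have one: "1 \<le> card (verts H)" using H(2) assms(2) by simp
    have "min_degree 1 H \<le> set_degree H {v}"
      by (rule min_degree_eq_set_degree[OF fin one]) (use v in simp)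
    then show "ex_degree k 1 n F \<le> set_degree H {v}" using H(4) by simp
  qed
  also have "\<dots> = k * card (edges H)" by (rule sum_degrees[OF H(1)])
  also have "\<dots> \<le> k * ex_edges k n F" using \<open>card (edges H) \<le> ex_edges k n F\<close> by simp
  finally show ?thesis .
qed

text \<open>The discrete derivative of n^k, used to make degree bounds telescope into a bound on the
  number of edges.\<close>

lemma mult_power_le_diff_power:
  "real k * real n ^ (k - 1) \<le> real (Suc n) ^ k - real n ^ k"
proof (induction k)
  case (Suc k)
  have "real (Suc k) * real n ^ (Suc k - 1) = real n ^ k + real n * (real k * real n ^ (k - 1))"
    by (cases k) (auto simp: algebra_simps)
  also have "\<dots> \<le> real n ^ k + real n * (real (Suc n) ^ k - real n ^ k)"
    using Suc by (intro add_left_mono mult_left_mono) auto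
  also have "\<dots> \<le> real (Suc n) ^ Suc k - real n ^ Suc k"
    using power_mono[of "real n" "real (Suc n)" k] by (simp add: algebra_simps)
  finally show ?case .
qed simp

definition norm_ex_edges :: "nat \<Rightarrow> nat hypergraph \<Rightarrow> nat \<Rightarrow> real" where
  "norm_ex_edges k F n = fact k * real (ex_edges k n F) / real n ^ k"

lemma norm_ex_degree_le_norm_ex_edges:
  assumes "edges F \<noteq> {}" "1 < k" "1 \<le> n"
  shows "norm_ex_degree k 1 F n \<le> norm_ex_edges k F n"
proof -
  obtain j where j: "k = Suc j" using assms(2) by (cases k) auto
  have "real (n * ex_degree k 1 n F) \<le> real (k * ex_edges k n F)"
    using mult_ex_degree_le_ex_edges[OF assms(1,3), of k] by (simp only: of_nat_le_iff)
  then have "fact j * (real n * real (ex_degree k 1 n F)) \<le> fact j * (real k * real (ex_edges k n F))"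
    by simp
  then have "fact j * real (ex_degree k 1 n F) * real n / real n ^ k
    \<le> fact k * real (ex_edges k n F) / real n ^ k"
    by (intro divide_right_mono) (simp_all add: j algebra_simps)
  then show ?thesis using assms(3) by (simp add: norm_ex_degree_def norm_ex_edges_def j)
qed

text \<open>The lower bound is that a minimum degree is at most the average. For the upper bound,
  minimum-degree vertices are deleted one at a time; once the normalised degrees are below c, the
  increments add up to at most c n^k and the starting value is negligible.\<close>

lemma norm_ex_edges_tendsto:
  assumes "edges F \<noteq> {}" "1 < k"
  shows "norm_ex_edges k F \<longlonglongrightarrow> degree_turan_density k 1 F"
proof (rule order_tendstoI)
  fix a assume "a < degree_turan_density k 1 F"
  from order_tendstoD(1)[OF norm_ex_degree_tendsto[OF assms] this] eventually_ge_at_top[of 1]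
  show "\<forall>\<^sub>F n in sequentially. a < norm_ex_edges k F n"
    by eventually_elim (use norm_ex_degree_le_norm_ex_edges[OF assms] in \<open>auto intro: less_le_trans\<close>)
next
  fix a assume "degree_turan_density k 1 F < a"
  then obtain c where c: "degree_turan_density k 1 F < c" "c < a" using dense by blast
  have c0: "0 \<le> c" using c(1) degree_turan_density_bounds(1)[OF assms] by simp
  from order_tendstoD(2)[OF norm_ex_degree_tendsto[OF assms] c(1)]
  obtain N where N: "\<And>n. N \<le> n \<Longrightarrow> norm_ex_degree k 1 F n < c"
    by (auto simp: eventually_sequentially)
  have kf: "(fact k :: real) = real k * fact (k - 1)" using assms(2) by (simp add: fact_reduce)
  \<comment> \<open>The power is of the successor because the increment at n is bounded by the
    difference from n^k to (n+1)^k.\<close>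
  have bound: "fact k * real (ex_edges k (N + i) F) \<le> fact k * real (ex_edges k N F) + c * real (Suc (N + i)) ^ k" for i
  proof (induction i)
    case 0 then show ?case using c0 by simp
  next
    case (Suc i)
    let ?n = "Suc (N + i)"
    have "real (ex_degree k 1 ?n F) = norm_ex_degree k 1 F ?n * real ?n ^ (k - 1) / fact (k - 1)"
      by (rule ex_degree_eq_norm) simp
    then have "fact (k - 1) * real (ex_degree k 1 ?n F) = norm_ex_degree k 1 F ?n * real ?n ^ (k - 1)"
      by simp
    also have "\<dots> \<le> c * real ?n ^ (k - 1)"
      using N[of ?n] by (intro mult_right_mono) auto
    finally have "real k * (fact (k - 1) * real (ex_degree k 1 ?n F)) \<le> real k * (c * real ?n ^ (k - 1))"
      by (intro mult_left_mono) auto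
    then have "fact k * real (ex_degree k 1 ?n F) \<le> c * (real k * real ?n ^ (k - 1))"
      unfolding kf by (simp add: algebra_simps)
    also have "\<dots> \<le> c * (real (Suc ?n) ^ k - real ?n ^ k)"
      by (intro mult_left_mono mult_power_le_diff_power c0)
    finally have d: "fact k * real (ex_degree k 1 ?n F) \<le> c * (real (Suc ?n) ^ k - real ?n ^ k)" .
    have "real (ex_edges k ?n F) \<le> real (ex_edges k (N + i) F + ex_degree k 1 ?n F)"
      using ex_edges_Suc_le[OF assms(1), of k "N + i"] by (simp only: of_nat_le_iff)
    then have "fact k * real (ex_edges k ?n F) \<le> fact k * (real (ex_edges k (N + i) F) + real (ex_degree k 1 ?n F))"
      by (intro mult_left_mono) auto
    then show ?case using d Suc by (simp add: algebra_simps)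
  qed
  define K where "K = fact k * real (ex_edges k N F)"
  have "(\<lambda>n. K / real n ^ k + c * (real (Suc n) / real n) ^ k) \<longlonglongrightarrow> 0 + c * 1 ^ k"
  proof (intro tendsto_add tendsto_mult tendsto_power tendsto_const)
    show "(\<lambda>n. K / real n ^ k) \<longlonglongrightarrow> 0" using assms(2) by real_asymp
    show "(\<lambda>n. real (Suc n) / real n) \<longlonglongrightarrow> 1" by real_asymp
  qed
  then have "\<forall>\<^sub>F n in sequentially. K / real n ^ k + c * (real (Suc n) / real n) ^ k < a"
    using c(2) by (intro order_tendstoD(2)) auto
  then show "\<forall>\<^sub>F n in sequentially. norm_ex_edges k F n < a"
    using eventually_ge_at_top[of N] eventually_gt_at_top[of 0]
  proof eventually_elim
    case (elim n)
    have "fact k * real (ex_edges k n F) \<le> K + c * real (Suc n) ^ k"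
      using bound[of "n - N"] elim(2) by (simp add: K_def)
    then have "norm_ex_edges k F n \<le> (K + c * real (Suc n) ^ k) / real n ^ k"
      unfolding norm_ex_edges_def by (intro divide_right_mono) auto
    also have "\<dots> = K / real n ^ k + c * (real (Suc n) / real n) ^ k"
      by (simp only: add_divide_distrib power_divide times_divide_eq_right)
    finally show ?case using elim(1) by simp
  qed
qed

lemma turan_density_eq:
  assumes "edges F \<noteq> {}" "1 < k"
  shows "turan_density k F = degree_turan_density k 1 F"
proof -
  have "(\<lambda>n. norm_ex_edges k F n / (fact k * real ((n - 0) choose k) / real n ^ k))
      \<longlonglongrightarrow> degree_turan_density k 1 F / 1"
    by (intro tendsto_divide norm_ex_edges_tendsto[OF assms] fact_choose_shift_ratio_tendsto) simp
  moreover have "\<forall>\<^sub>F n in sequentially. norm_ex_edges k F n / (fact k * real ((n - 0) choose k) / real n ^ k)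
      = real (ex_edges k n F) / real (n choose k)"
    using eventually_gt_at_top[of 0] by eventually_elim (simp add: norm_ex_edges_def)
  ultimately have "(\<lambda>n. real (ex_edges k n F) / real (n choose k)) \<longlonglongrightarrow> degree_turan_density k 1 F"
    using Lim_transform_eventually by force
  then show ?thesis unfolding turan_density_def by (rule limI)
qed

lemma degree_turan_spectrum_one:
  assumes "1 < k"
  shows "degree_turan_spectrum k 1 = turan_spectrum k"
  unfolding degree_turan_spectrum_def turan_spectrum_def nonempty_hypergraph_def
  using turan_density_eq[OF _ assms] by metis

lemma eventually_card_edges_le:
  assumes "edges F \<noteq> {}" "1 < k" "degree_turan_density k 1 F < c"
  shows "\<forall>\<^sub>F n in sequentially. \<forall>H :: nat hypergraph.
    kgraph k H \<longrightarrow> card (verts H) = n \<longrightarrow> \<not> embeds F H \<longrightarrow> fact k * real (card (edges H)) \<le> c * real n ^ k"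
  using order_tendstoD(2)[OF norm_ex_edges_tendsto[OF assms(1,2)] assms(3)] eventually_gt_at_top[of 0]
proof eventually_elim
  case (elim n)
  show ?case
  proof (intro allI impI)
    fix H :: "nat hypergraph"
    assume H: "kgraph k H" "card (verts H) = n" "\<not> embeds F H"
    have "card (edges H) \<le> ex_edges k n F"
      by (rule ex_edges_extremal[OF assms(1), of k n]) (use H in blast)
    then have "fact k * real (card (edges H)) \<le> fact k * real (ex_edges k n F)" by simp
    also have "\<dots> = norm_ex_edges k F n * real n ^ k" using elim(2) by (simp add: norm_ex_edges_def)
    also have "\<dots> \<le> c * real n ^ k" using elim(1) by (intro mult_right_mono) auto
    finally show "fact k * real (card (edges H)) \<le> c * real n ^ k" .
  qed
qed

section \<open>Tree hypergraphs\<close>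

text \<open>The empty word is not a vertex, but its children carry the topmost copy of
  \<open>F\<close>. A vertex remembers its whole history, so copies below different words are
  disjoint, and the k nonempty prefixes of a word of length k form its branch.\<close>

definition tree_hypergraph :: "nat \<Rightarrow> nat \<Rightarrow> 'a hypergraph \<Rightarrow> 'a list hypergraph" where
  "tree_hypergraph k t F =
    ({w. w \<noteq> [] \<and> length w \<le> k \<and> set w \<subseteq> verts F},
     {(\<lambda>x. u @ [x]) ` e | u e. length u \<le> t \<and> set u \<subseteq> verts F \<and> e \<in> edges F} \<union>
     {(\<lambda>i. take (Suc i) w) ` {..<k} | w. length w = k \<and> set w \<subseteq> verts F})"

lemma inj_on_prefixes:
  assumes "length w = k" shows "inj_on (\<lambda>i. take (Suc i) w) {..<k}"
proof (rule inj_onI)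
  fix i j assume ij: "i \<in> {..<k}" "j \<in> {..<k}" "take (Suc i) w = take (Suc j) w"
  have "length (take (Suc i) w) = Suc i" "length (take (Suc j) w) = Suc j" using ij(1,2) assms by auto
  then show "i = j" unfolding ij(3) by linarith
qed

lemma kgraph_tree_hypergraph:
  assumes "kgraph k F" "t < k"
  shows "kgraph k (tree_hypergraph k t F)"
  unfolding kgraph_def
proof (intro conjI ballI)
  have fin: "finite (verts F)" using assms(1) by (simp add: kgraph_def)
  show "finite (verts (tree_hypergraph k t F))"
    by (rule finite_subset[OF _ finite_lists_length_le[OF fin, of k]]) (auto simp: tree_hypergraph_def)
  fix e assume "e \<in> edges (tree_hypergraph k t F)"
  then consider (copy) u e' where "e = (\<lambda>x. u @ [x]) ` e'" "length u \<le> t" "set u \<subseteq> verts F" "e' \<in> edges F"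
    | (branch) w where "e = (\<lambda>i. take (Suc i) w) ` {..<k}" "length w = k" "set w \<subseteq> verts F"
    by (auto simp: tree_hypergraph_def)
  then have "e \<subseteq> verts (tree_hypergraph k t F) \<and> card e = k"
  proof cases
    case copy
    then have e': "e' \<subseteq> verts F" "card e' = k" using assms(1) by (auto simp: kgraph_def)
    have "e \<subseteq> verts (tree_hypergraph k t F)"
      using copy e'(1) assms(2) by (auto simp: tree_hypergraph_def)
    moreover have "card e = k"
      unfolding copy(1) by (subst card_image) (auto simp: inj_on_def e')
    ultimately show ?thesis by blast
  next
    case branch
    have "e \<subseteq> verts (tree_hypergraph k t F)"
      using branch by (auto simp: tree_hypergraph_def dest: in_set_takeD)
    moreover have "card e = k"
      unfolding branch(1) by (subst card_image[OF inj_on_prefixes[OF branch(2)]]) simp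
    ultimately show ?thesis by blast
  qed
  then show "e \<subseteq> verts (tree_hypergraph k t F)" "card e = k" by blast+
qed

lemma not_embeds_tree_hypergraph:
  assumes F: "kgraph k F" "verts F \<noteq> {}" and "t < k" and H: "kgraph k H"
    and free: "\<not> embeds F (induced H A)"
    and small: "\<And>e. e \<in> edges H \<Longrightarrow> card (e - A) \<le> t"
  shows "\<not> embeds (tree_hypergraph k t F) H"
proof
  assume "embeds (tree_hypergraph k t F) H"
  then obtain \<phi> where inj: "inj_on \<phi> (verts (tree_hypergraph k t F))"
    and ed: "\<forall>e\<in>edges (tree_hypergraph k t F). \<phi> ` e \<in> edges H"
    unfolding embeds_def by (elim exE conjE)
  have vt: "w \<in> verts (tree_hypergraph k t F) \<longleftrightarrow> w \<noteq> [] \<and> length w \<le> k \<and> set w \<subseteq> verts F" for w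
    by (simp add: tree_hypergraph_def)
  have eF: "e \<subseteq> verts F" if "e \<in> edges F" for e using F that by (simp add: kgraph_def)
  have "\<exists>w. length w = i \<and> set w \<subseteq> verts F \<and> (\<forall>j<i. \<phi> (take (Suc j) w) \<notin> A)" if "i \<le> Suc t" for i
    using that
  proof (induction i)
    case 0 show ?case by (intro exI[of _ "[]"]) auto
  next
    case (Suc i)
    then obtain w where w: "length w = i" "set w \<subseteq> verts F" "\<forall>j<i. \<phi> (take (Suc j) w) \<notin> A" by auto
    have "\<exists>x\<in>verts F. \<phi> (w @ [x]) \<notin> A"
    proof (rule ccontr)
      assume "\<not> ?thesis"
      then have inA: "\<And>x. x \<in> verts F \<Longrightarrow> \<phi> (w @ [x]) \<in> A" by blast
      have "embeds F (induced H A)"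
        unfolding embeds_def
      proof (intro exI[of _ "\<lambda>x. \<phi> (w @ [x])"] conjI ballI)
        show "inj_on (\<lambda>x. \<phi> (w @ [x])) (verts F)"
        proof (rule inj_onI)
          fix x y assume xy: "x \<in> verts F" "y \<in> verts F" "\<phi> (w @ [x]) = \<phi> (w @ [y])"
          have "w @ [x] = w @ [y]"
            by (rule inj_onD[OF inj xy(3)]) (use xy w Suc.prems \<open>t < k\<close> in \<open>auto simp: vt\<close>)
          then show "x = y" by simp
        qed
        show "(\<lambda>x. \<phi> (w @ [x])) ` verts F \<subseteq> verts (induced H A)" using inA by auto
        fix e assume e: "e \<in> edges F"
        have "(\<lambda>x. w @ [x]) ` e \<in> edges (tree_hypergraph k t F)"
          using e w Suc.prems unfolding tree_hypergraph_def by auto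
        then have "\<phi> ` (\<lambda>x. w @ [x]) ` e \<in> edges H" using ed by blast
        then have "(\<lambda>x. \<phi> (w @ [x])) ` e \<in> edges H" by (simp add: image_image)
        then show "(\<lambda>x. \<phi> (w @ [x])) ` e \<in> edges (induced H A)" using inA eF[OF e] by auto
      qed
      with free show False by contradiction
    qed
    then obtain x where x: "x \<in> verts F" "\<phi> (w @ [x]) \<notin> A" by blast
    have "\<phi> (take (Suc j) (w @ [x])) \<notin> A" if "j < Suc i" for j
      using that w x by (cases "j = i") auto
    then show ?case using w x by (intro exI[of _ "w @ [x]"]) auto
  qed
  then obtain w where w: "length w = Suc t" "set w \<subseteq> verts F" "\<forall>j<Suc t. \<phi> (take (Suc j) w) \<notin> A"
    by blast
  obtain x where x: "x \<in> verts F" using F(2) by blast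
  \<comment> \<open>Only complete branches are edges, so the word found so far is padded with an
    arbitrary letter; its first t + 1 prefixes already go outside \<open>A\<close>.\<close>
  define w' where "w' = w @ replicate (k - Suc t) x"
  have w': "length w' = k" "set w' \<subseteq> verts F" using w x \<open>t < k\<close> by (auto simp: w'_def)
  have inj': "inj_on (\<lambda>i. \<phi> (take (Suc i) w')) {..<k}"
  proof (rule inj_onI)
    fix i j assume ij: "i \<in> {..<k}" "j \<in> {..<k}" "\<phi> (take (Suc i) w') = \<phi> (take (Suc j) w')"
    have "take (Suc i) w' = take (Suc j) w'"
      by (rule inj_onD[OF inj ij(3)]) (use ij w' in \<open>auto simp: vt dest: in_set_takeD\<close>)
    then show "i = j" using inj_onD[OF inj_on_prefixes[OF w'(1)]] ij by blast
  qed
  have "(\<lambda>i. take (Suc i) w') ` {..<k} \<in> edges (tree_hypergraph k t F)"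
    using w' unfolding tree_hypergraph_def by auto
  then have "\<phi> ` (\<lambda>i. take (Suc i) w') ` {..<k} \<in> edges H" using ed by blast
  then have e: "(\<lambda>i. \<phi> (take (Suc i) w')) ` {..<k} \<in> edges H" by (simp add: image_image)
  have "Suc t = card ((\<lambda>i. \<phi> (take (Suc i) w')) ` {..<Suc t})"
    by (subst card_image) (use \<open>t < k\<close> in \<open>auto intro: inj_on_subset[OF inj']\<close>)
  also have "\<dots> \<le> card ((\<lambda>i. \<phi> (take (Suc i) w')) ` {..<k} - A)"
  proof (rule card_mono)
    have notA: "\<phi> (take (Suc i) w') \<notin> A" if "i < Suc t" for i
      using w(1,3) that by (simp add: w'_def)
    show "(\<lambda>i. \<phi> (take (Suc i) w')) ` {..<Suc t} \<subseteq> (\<lambda>i. \<phi> (take (Suc i) w')) ` {..<k} - A"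
    proof (intro subsetI DiffI)
      fix y assume "y \<in> (\<lambda>i. \<phi> (take (Suc i) w')) ` {..<Suc t}"
      then obtain i where i: "i < Suc t" "y = \<phi> (take (Suc i) w')" by (elim imageE) simp
      show "y \<in> (\<lambda>i. \<phi> (take (Suc i) w')) ` {..<k}"
        unfolding i(2) by (rule imageI) (use i(1) \<open>t < k\<close> in simp)
      show "y \<notin> A" unfolding i(2) by (rule notA[OF i(1)])
    qed
  qed simp
  also have "\<dots> \<le> t" by (rule small[OF e])
  finally show False by simp
qed

text \<open>The host vertices met on the way down to \<open>w\<close>, in order. Invariants of the
  embedding are predicates on such sequences, independent of the tree.\<close>

definition branch_image :: "('a list \<Rightarrow> 'b) \<Rightarrow> 'a list \<Rightarrow> 'b list" where
  "branch_image \<Phi> w = map (\<lambda>i. \<Phi> (take (Suc i) w)) [0..<length w]"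

lemma branch_image_snoc: "branch_image \<Phi> (w @ [x]) = branch_image \<Phi> w @ [\<Phi> (w @ [x])]"
  by (auto simp: branch_image_def)

lemma length_branch_image [simp]: "length (branch_image \<Phi> w) = length w"
  by (simp add: branch_image_def)

lemma set_branch_image: "set (branch_image \<Phi> w) = (\<lambda>i. \<Phi> (take (Suc i) w)) ` {..<length w}"
  by (auto simp: branch_image_def)

text \<open>Greedy embedding with an arbitrary invariant \<open>Good\<close>. The set
  \<open>U\<close> holds all vertices used so far; its size is bounded by the size of the tree, a
  constant independent of the host. Beyond level t, \<open>step\<close> only has to supply an
  injection that preserves \<open>Good\<close>.\<close>

lemma embeds_tree_hypergraph:
  fixes H :: "'b hypergraph" and F :: "'a hypergraph"
  assumes F: "kgraph k F" and root: "Good []"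
    and step: "\<And>w U. length w < k \<Longrightarrow> Good w \<Longrightarrow> distinct w \<Longrightarrow> set w \<subseteq> verts H \<Longrightarrow> finite U \<Longrightarrow>
      card U \<le> card (verts (tree_hypergraph k t F)) \<Longrightarrow> set w \<subseteq> U \<Longrightarrow>
      \<exists>\<phi>. inj_on \<phi> (verts F) \<and> \<phi> ` verts F \<subseteq> verts H - U \<and> (\<forall>x\<in>verts F. Good (w @ [\<phi> x])) \<and>
        (length w \<le> t \<longrightarrow> (\<forall>e\<in>edges F. \<phi> ` e \<in> edges H))"
    and leaf: "\<And>w. length w = k \<Longrightarrow> Good w \<Longrightarrow> distinct w \<Longrightarrow> set w \<subseteq> verts H \<Longrightarrow> set w \<in> edges H"
    and "t < k"
  shows "embeds (tree_hypergraph k t F) H"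
proof -
  define W where "W = verts F"
  define T where "T = verts (tree_hypergraph k t F)"
  have finW: "finite W" using F by (simp add: kgraph_def W_def)
  have finT: "finite T" using kgraph_tree_hypergraph[OF F \<open>t < k\<close>] by (simp add: kgraph_def T_def)
  have T: "w \<in> T \<longleftrightarrow> w \<noteq> [] \<and> length w \<le> k \<and> set w \<subseteq> W" for w
    by (simp add: tree_hypergraph_def T_def W_def)
  define ch where "ch X = {w @ [x] | w x. w \<in> X \<and> x \<in> W}" for X
  define N where "N = {w. length w < k \<and> set w \<subseteq> W}"
  have finN: "finite N" unfolding N_def
    by (rule finite_subset[OF _ finite_lists_length_le[OF finW, of k]]) auto
  \<comment> \<open>\<open>X\<close> is the set of words whose children have been placed. It is kept
    closed under prefixes, so that the branch to every word in it is already embedded.\<close>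
  define P where "P X \<Phi> \<longleftrightarrow> inj_on \<Phi> (ch X) \<and> \<Phi> ` ch X \<subseteq> verts H \<and>
    (\<forall>w\<in>X \<union> ch X. Good (branch_image \<Phi> w)) \<and>
    (\<forall>u\<in>X. length u \<le> t \<longrightarrow> (\<forall>e\<in>edges F. \<Phi> ` (\<lambda>x. u @ [x]) ` e \<in> edges H))"
    for X and \<Phi> :: "'a list \<Rightarrow> 'b"
  have main: "\<exists>\<Phi>. P X \<Phi>" if "card X = n" "X \<subseteq> N" "\<And>w i. w \<in> X \<Longrightarrow> take i w \<in> X" for X n
    using that
  proof (induction n arbitrary: X)
    case 0
    then have "X = {}" using finN finite_subset by fastforce
    then show ?case by (auto simp: P_def ch_def)
  next
    case (Suc n)
    have finX: "finite X" using Suc.prems(2) finN finite_subset by blast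
    have "X \<noteq> {}" using Suc.prems(1) by auto
    \<comment> \<open>A longest word is removed: the rest stays closed under prefixes, and no branch
      to another word passes through the new children, so their images can be chosen last.\<close>
    then obtain w where w: "w \<in> X" "\<And>v. v \<in> X \<Longrightarrow> length v \<le> length w"
      using Max_in[of "length ` X"] Max_ge[of "length ` X"] finX
      by (metis (no_types, lifting) finite_imageI image_iff image_is_empty)
    define X' where "X' = X - {w}"
    have wN: "length w < k" "set w \<subseteq> W" using w(1) Suc.prems(2) by (auto simp: N_def)
    have take_ne: "take i v \<noteq> w" if "v \<in> X" "i < length v" for v i
      using w(2)[OF that(1)] that(2) by (metis length_take min.absorb4 not_le)
    have take_ne': "take i v \<noteq> w" if "v \<in> X'" for v i
    proof
      assume "take i v = w"
      moreover have "length v \<le> length w" using w(2) that by (simp add: X'_def)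
      ultimately have "v = w" by (metis length_take min.cobounded1 nle_le min_def take_all)
      then show False using that by (simp add: X'_def)
    qed
    have "\<exists>\<Phi>. P X' \<Phi>"
    proof (rule Suc.IH)
      show "card X' = n" using Suc.prems(1) w(1) finX by (simp add: X'_def)
      show "X' \<subseteq> N" using Suc.prems(2) by (auto simp: X'_def)
      show "take i v \<in> X'" if "v \<in> X'" for v i
        using Suc.prems(3)[of v i] take_ne'[OF that] that by (auto simp: X'_def)
    qed
    then obtain \<Phi>' where \<Phi>': "inj_on \<Phi>' (ch X')" "\<Phi>' ` ch X' \<subseteq> verts H"
      "\<forall>w\<in>X' \<union> ch X'. Good (branch_image \<Phi>' w)"
      "\<forall>u\<in>X'. length u \<le> t \<longrightarrow> (\<forall>e\<in>edges F. \<Phi>' ` (\<lambda>x. u @ [x]) ` e \<in> edges H)"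
      unfolding P_def by (elim exE conjE)
    have prefix_ch: "take (Suc i) w \<in> ch X'" if "i < length w" for i
    proof -
      have "take (Suc i) w = take i w @ [w ! i]" using that by (rule take_Suc_conv_app_nth)
      moreover have "take i w \<in> X'"
        using Suc.prems(3)[OF w(1), of i] take_ne[OF w(1) that] by (simp add: X'_def)
      moreover have "w ! i \<in> W" using wN(2) that by auto
      ultimately show ?thesis unfolding ch_def by blast
    qed
    have w_ch: "w = [] \<or> w \<in> ch X'"
    proof (cases "w = []")
      case False
      then show ?thesis using prefix_ch[of "length w - 1"] by simp
    qed simp
    have chT: "ch Y \<subseteq> T" if "Y \<subseteq> N" for Y
      using that by (auto simp: ch_def N_def T)
    have X'N: "X' \<subseteq> N" using Suc.prems(2) by (auto simp: X'_def)
    define U where "U = \<Phi>' ` ch X'"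
    have "\<exists>\<phi>. inj_on \<phi> (verts F) \<and> \<phi> ` verts F \<subseteq> verts H - U \<and>
       (\<forall>x\<in>verts F. Good (branch_image \<Phi>' w @ [\<phi> x])) \<and>
        (length (branch_image \<Phi>' w) \<le> t \<longrightarrow> (\<forall>e\<in>edges F. \<phi> ` e \<in> edges H))"
    proof (rule step)
      show "length (branch_image \<Phi>' w) < k" using wN by simp
      show "Good (branch_image \<Phi>' w)" using w_ch \<Phi>'(3) root by (auto simp: branch_image_def)
      show sU: "set (branch_image \<Phi>' w) \<subseteq> U"
        unfolding set_branch_image U_def using prefix_ch by auto
      then show "set (branch_image \<Phi>' w) \<subseteq> verts H" using \<Phi>'(2) by (auto simp: U_def)
      show "finite U" unfolding U_def using finite_subset[OF chT[OF X'N] finT] by simp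
      show "card U \<le> card (verts (tree_hypergraph k t F))"
        unfolding U_def T_def[symmetric]
        by (rule order_trans[OF card_image_le card_mono[OF finT chT[OF X'N]]])
          (rule finite_subset[OF chT[OF X'N] finT])
      show "distinct (branch_image \<Phi>' w)"
        unfolding branch_image_def distinct_map
      proof
        show "inj_on (\<lambda>i. \<Phi>' (take (Suc i) w)) (set [0..<length w])"
        proof (rule inj_onI)
          fix i j assume ij: "i \<in> set [0..<length w]" "j \<in> set [0..<length w]"
            "\<Phi>' (take (Suc i) w) = \<Phi>' (take (Suc j) w)"
          then have "take (Suc i) w = take (Suc j) w"
            by (intro inj_onD[OF \<Phi>'(1)] prefix_ch) auto
          then show "i = j" using inj_onD[OF inj_on_prefixes[OF refl, of w]] ij by auto
        qed
      qed simp
    qed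
    then obtain \<phi> where \<phi>: "inj_on \<phi> W" "\<phi> ` W \<subseteq> verts H - U"
      "\<forall>x\<in>W. Good (branch_image \<Phi>' w @ [\<phi> x])"
      "length w \<le> t \<longrightarrow> (\<forall>e\<in>edges F. \<phi> ` e \<in> edges H)"
      unfolding length_branch_image W_def by (elim exE conjE)
    define \<Phi> where "\<Phi> u = (if u \<noteq> [] \<and> butlast u = w then \<phi> (last u) else \<Phi>' u)" for u
    have \<Phi>_new: "\<Phi> (w @ [x]) = \<phi> x" for x by (simp add: \<Phi>_def)
    have \<Phi>_old: "\<Phi> u = \<Phi>' u" if "u \<in> ch X'" for u
      using that by (auto simp: \<Phi>_def ch_def X'_def)
    have ch_X: "ch X = ch X' \<union> (\<lambda>x. w @ [x]) ` W" using w(1) by (auto simp: ch_def X'_def)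
    have branch_old: "branch_image \<Phi> u = branch_image \<Phi>' u" if "u \<in> X \<union> ch X'" for u
    proof -
      have "\<Phi> (take (Suc i) u) = \<Phi>' (take (Suc i) u)" if i: "i < length u" for i
      proof -
        have "take i u \<noteq> w"
        proof (cases "u \<in> X")
          case True then show ?thesis using take_ne i by blast
        next
          case False
          then obtain v x where v: "u = v @ [x]" "v \<in> X'" using \<open>u \<in> X \<union> ch X'\<close> by (auto simp: ch_def)
          then have "take i u = take i v" using i by simp
          then show ?thesis using take_ne'[OF v(2)] by simp
        qed
        moreover have "butlast (take (Suc i) u) = take i u" using i by (simp add: butlast_take)
        ultimately show ?thesis by (simp add: \<Phi>_def)
      qed
      then show ?thesis by (auto simp: branch_image_def)
    qed
    have "P X \<Phi>"
      unfolding P_def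
    proof (intro conjI ballI impI)
      show "inj_on \<Phi> (ch X)"
        unfolding ch_X
      proof (subst inj_on_Un, intro conjI)
        show "inj_on \<Phi> (ch X')" using \<Phi>'(1) \<Phi>_old by (simp cong: inj_on_cong)
        show "inj_on \<Phi> ((\<lambda>x. w @ [x]) ` W)"
          using \<phi>(1) by (auto simp: inj_on_def \<Phi>_new)
        have "\<Phi> ` (ch X' - (\<lambda>x. w @ [x]) ` W) \<subseteq> U"
          using \<Phi>_old by (auto simp: U_def)
        moreover have "\<Phi> ` ((\<lambda>x. w @ [x]) ` W - ch X') \<subseteq> verts H - U"
          using \<phi>(2) by (auto simp: \<Phi>_new)
        ultimately show "\<Phi> ` (ch X' - (\<lambda>x. w @ [x]) ` W) \<inter> \<Phi> ` ((\<lambda>x. w @ [x]) ` W - ch X') = {}"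
          by blast
      qed
      have "\<Phi> ` ch X' = U" using \<Phi>_old by (simp add: U_def)
      moreover have "\<Phi> ` (\<lambda>x. w @ [x]) ` W = \<phi> ` W" by (simp add: image_image \<Phi>_new)
      ultimately show "\<Phi> ` ch X \<subseteq> verts H"
        unfolding ch_X image_Un using \<Phi>'(2) \<phi>(2) U_def by auto
      fix u assume u: "u \<in> X \<union> ch X"
      show "Good (branch_image \<Phi> u)"
      proof (cases "u \<in> X \<union> ch X'")
        case True
        then have "u \<in> X' \<union> ch X' \<or> u = w" by (auto simp: X'_def)
        then have "Good (branch_image \<Phi>' u)"
          using \<Phi>'(3) w_ch root by (auto simp: branch_image_def)
        then show ?thesis using branch_old[OF True] by simp
      next
        case False
        then obtain x where x: "u = w @ [x]" "x \<in> W" using u ch_X by blast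
        then show ?thesis
          using \<phi>(3) branch_old[of w] w(1) by (simp add: branch_image_snoc \<Phi>_new)
      qed
    next
      fix u e assume u: "u \<in> X" "length u \<le> t" "e \<in> edges F"
      have eW: "e \<subseteq> W" using F u(3) by (simp add: kgraph_def W_def)
      show "\<Phi> ` (\<lambda>x. u @ [x]) ` e \<in> edges H"
      proof (cases "u = w")
        case True
        then have "\<Phi> ` (\<lambda>x. u @ [x]) ` e = \<phi> ` e" by (simp add: image_image \<Phi>_new)
        then show ?thesis using \<phi>(4) u True by simp
      next
        case False
        then have "u \<in> X'" using u by (simp add: X'_def)
        have "\<Phi> ` (\<lambda>x. u @ [x]) ` e = \<Phi>' ` (\<lambda>x. u @ [x]) ` e"
          unfolding image_image
          by (rule image_cong[OF refl], rule \<Phi>_old) (use \<open>u \<in> X'\<close> eW in \<open>auto simp: ch_def\<close>)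
        then show ?thesis using \<Phi>'(4) \<open>u \<in> X'\<close> u by simp
      qed
    qed
    then show ?case by blast
  qed
  have "\<exists>\<Phi>. P N \<Phi>" by (rule main[OF refl order_refl]) (auto simp: N_def dest: in_set_takeD)
  then obtain \<Phi> where \<Phi>: "inj_on \<Phi> (ch N)" "\<Phi> ` ch N \<subseteq> verts H"
      "\<forall>w\<in>N \<union> ch N. Good (branch_image \<Phi> w)"
      "\<forall>u\<in>N. length u \<le> t \<longrightarrow> (\<forall>e\<in>edges F. \<Phi> ` (\<lambda>x. u @ [x]) ` e \<in> edges H)"
      unfolding P_def by (elim exE conjE)
  have chN: "ch N = T"
  proof (intro set_eqI iffI)
    fix u assume "u \<in> T"
    then have u: "u \<noteq> []" "length u \<le> k" "set u \<subseteq> W" by (simp_all add: T)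
    have "u = butlast u @ [last u]" using u(1) by simp
    moreover have "last u \<in> W" using u(3) last_in_set[OF u(1)] by (rule subsetD)
    moreover have "set (butlast u) \<subseteq> W" using u(3) by (meson in_set_butlastD subset_iff)
    then have "butlast u \<in> N"
      using u(1,2) \<open>t < k\<close> by (simp add: N_def)
    ultimately show "u \<in> ch N" unfolding ch_def by blast
  qed (auto simp: ch_def N_def T)
  show ?thesis
    unfolding embeds_def
  proof (intro exI[of _ \<Phi>] conjI ballI)
    show "inj_on \<Phi> (verts (tree_hypergraph k t F))" "\<Phi> ` verts (tree_hypergraph k t F) \<subseteq> verts H"
      using \<Phi>(1,2) chN by (simp_all add: T_def)
    fix e assume "e \<in> edges (tree_hypergraph k t F)"
    then consider (copy) u e' where "e = (\<lambda>x. u @ [x]) ` e'" "length u \<le> t" "set u \<subseteq> verts F" "e' \<in> edges F"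
    | (branch) w where "e = (\<lambda>i. take (Suc i) w) ` {..<k}" "length w = k" "set w \<subseteq> verts F"
      by (auto simp: tree_hypergraph_def)
    then show "\<Phi> ` e \<in> edges H"
    proof cases
      case copy
      then have "u \<in> N" using \<open>t < k\<close> by (simp add: N_def W_def)
      then show ?thesis using \<Phi>(4) copy by blast
    next
      case branch
      have wT: "take (Suc i) w \<in> T" if "i < k" for i
        using branch that by (auto simp: T W_def dest: in_set_takeD)
      have s: "set (branch_image \<Phi> w) = \<Phi> ` e"
        unfolding set_branch_image branch(1,2) by (simp add: image_image)
      have "w \<in> T" using wT[of "k - 1"] branch(2) \<open>t < k\<close> by simp
      have "set (branch_image \<Phi> w) \<in> edges H"
      proof (rule leaf)
        show "length (branch_image \<Phi> w) = k" using branch by simp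
        show "Good (branch_image \<Phi> w)" using \<Phi>(3) \<open>w \<in> T\<close> chN by blast
        show "set (branch_image \<Phi> w) \<subseteq> verts H"
          unfolding set_branch_image using \<Phi>(2) wT chN branch(2) by blast
        show "distinct (branch_image \<Phi> w)"
          unfolding branch_image_def distinct_map
        proof
          show "inj_on (\<lambda>i. \<Phi> (take (Suc i) w)) (set [0..<length w])"
          proof (rule inj_onI)
            fix i j assume ij: "i \<in> set [0..<length w]" "j \<in> set [0..<length w]"
              "\<Phi> (take (Suc i) w) = \<Phi> (take (Suc j) w)"
            then have "take (Suc i) w = take (Suc j) w"
              using wT chN branch(2) by (intro inj_onD[OF \<Phi>(1)]) auto
            then show "i = j" using inj_onD[OF inj_on_prefixes[OF refl, of w]] ij by auto
          qed
        qed simp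
      qed
      then show ?thesis by (simp only: s)
    qed
  qed
qed

section \<open>Embedding tree hypergraphs\<close>

lemma embeds_inducedE:
  assumes "embeds F (induced H A)"
  obtains \<phi> where "inj_on \<phi> (verts F)" "\<phi> ` verts F \<subseteq> A" "\<forall>e\<in>edges F. \<phi> ` e \<in> edges H"
proof -
  from assms obtain \<phi> where "inj_on \<phi> (verts F)" "\<phi> ` verts F \<subseteq> verts (induced H A)"
    "\<forall>e\<in>edges F. \<phi> ` e \<in> edges (induced H A)"
    unfolding embeds_def by (elim exE conjE)
  then show thesis by (intro that[of \<phi>]) auto
qed

text \<open>An l-set misses at most a share 1 - c of its completions. Even if all of these lie in a
  set with a share \<gamma> of the vertices, they make up at most (1 - c) / \<gamma>^(k-l) of the
  completions there, which by hypothesis is less than 1 - \<beta>; so the set is denser than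
  \<beta>.\<close>

lemma eventually_dense_subset_embeds:
  fixes F :: "nat hypergraph"
  assumes F: "edges F \<noteq> {}" "l < k" and "0 < \<gamma>"
    and c: "1 - c < (1 - degree_turan_density k l F) * \<gamma> ^ (k - l)"
  shows "\<forall>\<^sub>F n in sequentially. \<forall>H :: nat hypergraph. kgraph k H \<longrightarrow> card (verts H) = n \<longrightarrow>
    ldense k l c H \<longrightarrow> (\<forall>A\<subseteq>verts H. \<gamma> * real n \<le> real (card A) \<longrightarrow> embeds F (induced H A))"
proof -
  define r where "r = k - l"
  have r: "1 \<le> r" using F(2) by (simp add: r_def)
  define \<beta> where "\<beta> = degree_turan_density k l F"
  have \<beta>: "0 \<le> \<beta>" "\<beta> \<le> 1" using degree_turan_density_bounds[OF F] by (simp_all add: \<beta>_def)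
  \<comment> \<open>Half of the slack: one \<epsilon> is the excess over \<beta>, the other pays for
    replacing a binomial coefficient by a power.\<close>
  define \<epsilon> where "\<epsilon> = ((1 - \<beta>) * \<gamma> ^ r - (1 - c)) / 2"
  have e: "0 < \<epsilon>" using c by (simp add: \<epsilon>_def \<beta>_def r_def)
  have "degree_turan_density k l F < \<beta> + \<epsilon>" using e by (simp add: \<beta>_def)
  from eventually_embeds_above_density[OF F this] obtain N where
    N: "\<forall>m\<ge>N. \<forall>H :: nat hypergraph. kgraph k H \<longrightarrow> card (verts H) = m \<longrightarrow> ldense k l (\<beta> + \<epsilon>) H \<longrightarrow> embeds F H"
    unfolding eventually_sequentially by (elim exE)
  have "\<forall>\<^sub>F n in sequentially. real N / \<gamma> \<le> real n"
    by (metis eventually_at_top_linorderI filterlim_at_top filterlim_real_sequentially)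
  with eventually_choose_ge[OF e r, of l] show ?thesis
  proof eventually_elim
    case (elim n)
    show ?case
    proof (intro allI impI)
      fix H :: "nat hypergraph" and A
      assume H: "kgraph k H" "card (verts H) = n" "ldense k l c H"
        and A: "A \<subseteq> verts H" "\<gamma> * real n \<le> real (card A)"
      define a where "a = card A"
      have fin: "finite (verts H)" using H(1) by (simp add: kgraph_def)
      have an: "a \<le> n" using card_mono[OF fin A(1)] H(2) by (simp add: a_def)
      have "real N \<le> \<gamma> * real n" using elim(2) \<open>0 < \<gamma>\<close> by (simp add: field_simps)
      then have "N \<le> card A" using A(2) by linarith
      have "ldense k l (\<beta> + \<epsilon>) (induced H A)"
        unfolding ldense_def
      proof (intro allI impI)
        fix S assume "S \<subseteq> verts (induced H A) \<and> card S = l"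
        then have S: "S \<subseteq> A" "card S = l" by auto
        have "real (set_degree H S + ((a - l) choose r)) \<le> real (set_degree (induced H A) S + ((n - l) choose r))"
          using set_degree_induced_ge[OF H(1) A(1) S] H(2) unfolding a_def r_def by (simp only: of_nat_le_iff)
        then have "fact r * (real (set_degree H S) + real ((a - l) choose r))
          \<le> fact r * (real (set_degree (induced H A) S) + real ((n - l) choose r))"
          by (intro mult_left_mono) auto
        then have 1: "fact r * real (set_degree H S) + fact r * real ((a - l) choose r)
           \<le> fact r * real (set_degree (induced H A) S) + fact r * real ((n - l) choose r)"
          by (simp add: algebra_simps)
        have "S \<subseteq> verts H" using S A by auto
        then have "c * real n ^ r / fact r \<le> real (set_degree H S)"
          using H(2,3) S(2) unfolding ldense_def r_def by auto
        then have 2: "c * real n ^ r \<le> fact r * real (set_degree H S)" by (simp add: field_simps)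
        have 3: "real a ^ r - \<epsilon> * real n ^ r \<le> fact r * real ((a - l) choose r)"
          using elim(1) an by blast
        have 4: "fact r * real ((n - l) choose r) \<le> real n ^ r" by (rule fact_mult_choose_shift_le)
        have "(\<gamma> * real n) ^ r \<le> real a ^ r"
          using A(2) \<open>0 < \<gamma>\<close> unfolding a_def by (intro power_mono) auto
        then have "(1 - \<beta>) * (\<gamma> * real n) ^ r \<le> (1 - \<beta>) * real a ^ r"
          using \<beta> by (intro mult_left_mono) auto
        moreover have "(1 - \<beta>) * (\<gamma> * real n) ^ r = (1 - c + 2 * \<epsilon>) * real n ^ r"
        proof -
          have "(1 - \<beta>) * \<gamma> ^ r = 1 - c + 2 * \<epsilon>" by (simp add: \<epsilon>_def field_simps)
          then show ?thesis by (metis mult.assoc power_mult_distrib)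
        qed
        ultimately have 5: "(1 - c + 2 * \<epsilon>) * real n ^ r \<le> (1 - \<beta>) * real a ^ r" by simp
        have "real a ^ r \<le> real n ^ r" using an by (intro power_mono) auto
        then have 6: "\<epsilon> * real a ^ r \<le> \<epsilon> * real n ^ r" using e by simp
        have "(\<beta> + \<epsilon>) * real a ^ r \<le> fact r * real (set_degree (induced H A) S)"
          using 1 2 3 4 5 6 by (simp add: algebra_simps)
        then show "(\<beta> + \<epsilon>) * real (card (verts (induced H A))) ^ (k - l) / fact (k - l)
            \<le> real (set_degree (induced H A) S)"
          by (simp add: a_def r_def field_simps)
      qed
      then show "embeds F (induced H A)"
        using N[rule_format, OF \<open>N \<le> card A\<close> kgraph_induced[OF H(1) A(1)]] by simp
    qed
  qed
qed

text \<open>A word is good if few of its completions are non-edges; by averaging, a good word has few bad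
  extensions, so a copy of \<open>F\<close> can be chosen among the good ones.\<close>

lemma embeds_tree_hypergraph_last:
  fixes H :: "'b hypergraph" and F :: "'a hypergraph"
  assumes F: "kgraph k F" and l: "1 \<le> l" "l < k" and H: "kgraph k H" "ldense k l c H"
    and b: "0 < b" "1 - c < b ^ (k - l)" and n: "0 < card (verts H)"
    and sub: "\<And>A. A \<subseteq> verts H \<Longrightarrow> \<gamma> * real (card (verts H)) \<le> real (card A) \<Longrightarrow> embeds F (induced H A)"
    and size: "(\<gamma> + b) * real (card (verts H)) + real (card (verts (tree_hypergraph k (k - 1) F)))
      \<le> real (card (verts H))"
  shows "embeds (tree_hypergraph k (k - 1) F) H"
proof -
  define V where "V = verts H"
  define n where "n = card V"
  define M where "M = card (verts (tree_hypergraph k (k - 1) F))"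
  have finV: "finite V" using H by (simp add: V_def kgraph_def)
  have n0: "0 < real n" using n by (simp add: n_def V_def)
  define mis where "mis w = real (num_ext V (k - length w) (\<lambda>x. set x \<notin> edges H) w)" for w
  \<comment> \<open>With j letters missing, fewer than (b n)^j bad completions are allowed, so
    averaging leaves at most b n bad next vertices. With no letter missing the threshold is 1, which
    forces an edge. Words shorter than l are unconstrained, and words of length l satisfy the
    condition by minimum degree, since 1 - c < b^(k-l).\<close>
  define Good where "Good w \<longleftrightarrow> length w < l \<or> mis w < (b * real n) ^ (k - length w)" for w
  have few_bad: "real (card {v \<in> V - U. \<not> Good (w @ [v])}) \<le> b * real n"
    if w: "length w < k" "Good w" "distinct w" "set w \<subseteq> V" "set w \<subseteq> U" for w U
  proof -
    consider "length w + 1 < l" | "length w + 1 = l" | "l \<le> length w" by linarith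
    then show ?thesis
    proof cases
      case 1
      then show ?thesis using b n0 by (simp add: Good_def)
    next
      case 2
      have "Good (w @ [v])" if v: "v \<in> V - U" for v
      proof -
        define w' where "w' = w @ [v]"
        define r where "r = k - l"
        have w': "distinct w'" "set w' \<subseteq> V" "length w' = l" using w v 2 by (auto simp: w'_def)
        have "c * real n ^ r / fact r \<le> real (set_degree H (set w'))"
          using H(2) w' unfolding ldense_def r_def n_def V_def by (auto simp: distinct_card)
        then have "c * real n ^ r \<le> fact r * real (set_degree H (set w'))" by (simp add: field_simps)
        also have "\<dots> = real (num_ext V r (\<lambda>x. set x \<in> edges H) w')"
          using num_ext_edges[OF H(1) w'(1)] w'(2,3) l(2) unfolding r_def V_def by simp
        finally have "c * real n ^ r \<le> real (num_ext V r (\<lambda>x. set x \<in> edges H) w')" .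
        moreover have "real (num_ext V r (\<lambda>x. set x \<in> edges H) w' + num_ext V r (\<lambda>x. set x \<notin> edges H) w') = real (n ^ r)"
          unfolding n_def by (rule arg_cong[OF num_ext_plus_not[OF finV]])
        ultimately have "mis w' \<le> (1 - c) * real n ^ r"
          by (simp add: mis_def w'(3) r_def[symmetric] algebra_simps)
        also have "\<dots> < b ^ r * real n ^ r"
          using b(2) n0 unfolding r_def by (intro mult_strict_right_mono) auto
        finally show ?thesis
          unfolding w'_def[symmetric] Good_def by (simp add: w'(3) r_def power_mult_distrib)
      qed
      then have "{v \<in> V - U. \<not> Good (w @ [v])} = {}" by blast
      then have "card {v \<in> V - U. \<not> Good (w @ [v])} = 0" by (simp only: card.empty)
      then show ?thesis using b n0 by (simp only: of_nat_0) simp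
    next
      case 3
      define j where "j = k - length w - 1"
      have j: "k - length w = Suc j" "k - length (w @ [v]) = j" for v
        using w(1) by (simp_all add: j_def)
      define B where "B = {v \<in> V - U. \<not> Good (w @ [v])}"
      have B: "B \<subseteq> V" "finite B" using finV by (auto simp: B_def)
      have "real (card B) * (b * real n) ^ j = (\<Sum>v\<in>B. (b * real n) ^ j)" by simp
      also have "\<dots> \<le> (\<Sum>v\<in>B. mis (w @ [v]))"
        by (rule sum_mono) (use 3 in \<open>auto simp: B_def Good_def j_def not_less\<close>)
      also have "\<dots> \<le> (\<Sum>v\<in>V. mis (w @ [v]))"
        by (rule sum_mono2) (use finV B in \<open>auto simp: mis_def\<close>)
      also have "\<dots> = mis w" by (simp add: mis_def j num_ext_Suc[OF finV] del: length_append)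
      also have "\<dots> < (b * real n) ^ Suc j" using w(2) 3 j by (simp add: Good_def)
      finally have "real (card B) * (b * real n) ^ j < (b * real n) * (b * real n) ^ j" by simp
      moreover have "0 < (b * real n) ^ j" using b n0 by simp
      ultimately show ?thesis unfolding B_def[symmetric] by (simp add: mult_less_cancel_right_pos)
    qed
  qed
  show ?thesis
  proof (rule embeds_tree_hypergraph[OF F, where Good = Good])
    show "Good []" using l by (simp add: Good_def)
    show "k - 1 < k" using l by simp
    fix w
    assume w: "length w = k" "Good w"
    then have "mis w < 1" using l by (simp add: Good_def)
    then show "set w \<in> edges H" using w(1) by (simp add: mis_def num_ext_0 split: if_splits)
  next
    fix w U
    assume w: "length w < k" "Good w" "distinct w" "set w \<subseteq> verts H" "finite U"
      "card U \<le> card (verts (tree_hypergraph k (k - 1) F))" "set w \<subseteq> U"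
    define A where "A = {v \<in> V - U. Good (w @ [v])}"
    have "V \<subseteq> A \<union> U \<union> {v \<in> V - U. \<not> Good (w @ [v])}" by (auto simp: A_def)
    moreover have "finite (A \<union> U \<union> {v \<in> V - U. \<not> Good (w @ [v])})" using finV w(5) by (simp add: A_def)
    ultimately have "n \<le> card (A \<union> U \<union> {v \<in> V - U. \<not> Good (w @ [v])})"
      unfolding n_def by (intro card_mono)
    also have "\<dots> \<le> card A + card U + card {v \<in> V - U. \<not> Good (w @ [v])}"
      by (meson add_le_mono card_Un_le le_refl order_trans)
    finally have "n \<le> card A + card U + card {v \<in> V - U. \<not> Good (w @ [v])}" .
    then have "real n \<le> real (card A) + real (card U) + real (card {v \<in> V - U. \<not> Good (w @ [v])})"
      by linarith
    also have "\<dots> \<le> real (card A) + real M + b * real n"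
    proof (intro add_mono order_refl)
      show "real (card U) \<le> real M" using w(6) by (simp add: M_def)
      show "real (card {v \<in> V - U. \<not> Good (w @ [v])}) \<le> b * real n"
        by (rule few_bad[OF w(1-3) _ w(7)]) (use w(4) in \<open>simp add: V_def\<close>)
    qed
    finally have "\<gamma> * real n \<le> real (card A)"
      using size by (simp add: n_def V_def M_def algebra_simps)
    then have "embeds F (induced H A)"
      by (intro sub) (auto simp: A_def V_def n_def)
    then obtain \<phi> where \<phi>: "inj_on \<phi> (verts F)" "\<phi> ` verts F \<subseteq> A" "\<forall>e\<in>edges F. \<phi> ` e \<in> edges H"
      by (rule embeds_inducedE)
    show "\<exists>\<phi>. inj_on \<phi> (verts F) \<and> \<phi> ` verts F \<subseteq> verts H - U \<and> (\<forall>x\<in>verts F. Good (w @ [\<phi> x])) \<and>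
        (length w \<le> k - 1 \<longrightarrow> (\<forall>e\<in>edges F. \<phi> ` e \<in> edges H))"
    proof (intro exI[of _ \<phi>] conjI impI \<phi>(1,3) ballI)
      show "\<phi> ` verts F \<subseteq> verts H - U" using \<phi>(2) by (auto simp: A_def V_def)
      show "Good (w @ [\<phi> x])" if "x \<in> verts F" for x
      proof -
        have "\<phi> x \<in> A" using \<phi>(2) that by blast
        then show ?thesis by (simp add: A_def)
      qed
    qed
  qed
qed

text \<open>A link set of \<open>S\<close> lies inside \<open>A\<close> or contains a vertex v
  outside \<open>A\<close>, and then it is counted in the degree of \<open>insert v S\<close>.
  Taking for \<open>A\<close> the vertices that extend \<open>S\<close> with large degree makes the
  sum small and bounds the size of \<open>A\<close> from below.\<close>

lemma set_degree_le_sum_insert: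
  assumes "kgraph k H" "S \<subseteq> verts H" "card S < k"
  shows "set_degree H S \<le> card {R. R \<subseteq> A \<and> card R = k - card S \<and> S \<union> R \<in> edges H}
    + (\<Sum>v\<in>verts H - S - A. set_degree H (insert v S))"
proof -
  have fin: "finite (verts H)" "finite S" "finite (edges H)"
    using assms finite_subset[OF assms(2)] finite_edges[OF assms(1)] by (auto simp: kgraph_def)
  define X where "X = {R. R \<subseteq> verts H - S \<and> card R = k - card S \<and> S \<union> R \<in> edges H}"
  define Y where "Y = {R. R \<subseteq> A \<and> card R = k - card S \<and> S \<union> R \<in> edges H}"
  define Z where "Z v = {R \<in> X. v \<in> R}" for v
  have finX: "finite X" unfolding X_def using fin by simp
  have "X \<subseteq> (Y \<inter> X) \<union> (\<Union>v\<in>verts H - S - A. Z v)"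
  proof
    fix R assume R: "R \<in> X"
    show "R \<in> (Y \<inter> X) \<union> (\<Union>v\<in>verts H - S - A. Z v)"
    proof (cases "R \<subseteq> A")
      case True then show ?thesis using R by (simp add: X_def Y_def)
    next
      case False
      then obtain v where "v \<in> R" "v \<notin> A" by blast
      then show ?thesis using R unfolding X_def Z_def by blast
    qed
  qed
  moreover have "finite ((Y \<inter> X) \<union> (\<Union>v\<in>verts H - S - A. Z v))"
    using finX fin by (simp add: Z_def)
  ultimately have "card X \<le> card ((Y \<inter> X) \<union> (\<Union>v\<in>verts H - S - A. Z v))" by (rule card_mono[rotated])
  also have "\<dots> \<le> card (Y \<inter> X) + card (\<Union>v\<in>verts H - S - A. Z v)" by (rule card_Un_le)
  also have "card (\<Union>v\<in>verts H - S - A. Z v) \<le> (\<Sum>v\<in>verts H - S - A. card (Z v))"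
    by (rule card_UN_le) (use fin in simp)
  also have "\<dots> \<le> (\<Sum>v\<in>verts H - S - A. set_degree H (insert v S))"
  proof (rule sum_mono)
    fix v
    have "card (Z v) = card ((\<union>) S ` Z v)"
      by (rule card_image[symmetric]) (auto simp: inj_on_def Z_def X_def)
    also have "\<dots> \<le> set_degree H (insert v S)"
      unfolding set_degree_def by (rule card_mono) (use fin in \<open>auto simp: Z_def X_def\<close>)
    finally show "card (Z v) \<le> set_degree H (insert v S)" .
  qed
  finally have "card X \<le> card (Y \<inter> X) + (\<Sum>v\<in>verts H - S - A. set_degree H (insert v S))" by simp
  moreover have "finite Y"
  proof (rule finite_subset)
    show "Y \<subseteq> Pow (verts H)" using assms(1) by (auto simp: Y_def kgraph_def)
    show "finite (Pow (verts H))" using fin(1) by simp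
  qed
  then have "card (Y \<inter> X) \<le> card Y" by (simp add: card_mono)
  ultimately show ?thesis
    unfolding set_degree_link[OF assms(1,2)] X_def[symmetric] Y_def[symmetric] by linarith
qed

text \<open>All vertices of the link of an \<open>l\<close>-set \<open>S\<close> are candidates for the next level, and there are
  many of them since the link is dense; below that, only one edge per branch is needed.\<close>

lemma embeds_tree_hypergraph_link:
  fixes H :: "'b hypergraph" and F :: "'a hypergraph"
  assumes F: "kgraph k F" and l: "l < k" and H: "kgraph k H" "ldense k l c H"
    and \<eta>: "0 < \<eta>" and n: "0 < card (verts H)" and \<gamma>: "0 \<le> \<gamma>"
    and sub: "\<And>A. A \<subseteq> verts H \<Longrightarrow> \<gamma> * real (card (verts H)) \<le> real (card A) \<Longrightarrow> embeds F (induced H A)"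
    and size1: "\<gamma> * real (card (verts H)) + real (card (verts (tree_hypergraph k l F))) \<le> real (card (verts H))"
    and size2: "(\<gamma> * real (card (verts H)) + real (card (verts (tree_hypergraph k l F)))) ^ (k - l)
      \<le> (c - fact (k - l) * \<eta>) * real (card (verts H)) ^ (k - l)"
    and size3: "real (card (verts (tree_hypergraph k l F)) + card (verts F)) \<le> \<eta> * (1 / 2) ^ k * real (card (verts H))"
  shows "embeds (tree_hypergraph k l F) H"
proof -
  define V where "V = verts H"
  define n where "n = card V"
  define M where "M = card (verts (tree_hypergraph k l F))"
  have finV: "finite V" using H by (simp add: V_def kgraph_def)
  have n0: "0 < real n" using n by (simp add: n_def V_def)
  \<comment> \<open>The factor 1/2 per level gives n \<theta>(i+1) = \<theta>(i) / 2: extensions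
    below the threshold use up at most half of the degree, and the other half guarantees many
    extensions above it. At i = k the threshold is nonnegative, so the branch lies in an edge and
    hence is one.\<close>
  define \<theta> where "\<theta> i = \<eta> * (1 / 2) ^ i * real n ^ (k - i)" for i
  define Good where "Good w \<longleftrightarrow> length w \<le> l \<or> \<theta> (length w) < real (set_degree H (set w))" for w
  show ?thesis
  proof (rule embeds_tree_hypergraph[OF F, where Good = Good])
    show "Good []" by (simp add: Good_def)
    show "l < k" by (rule l)
    fix w
    assume w: "length w = k" "Good w" "distinct w"
    then have "\<theta> k < real (set_degree H (set w))" using l by (simp add: Good_def)
    moreover have "0 \<le> \<theta> k" using \<eta> by (simp add: \<theta>_def)
    ultimately have "0 < set_degree H (set w)" by simp
    then have "{e \<in> edges H. set w \<subseteq> e} \<noteq> {}" unfolding set_degree_def by (metis card.empty less_irrefl)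
    then obtain e where e: "e \<in> edges H" "set w \<subseteq> e" by blast
    have "e \<subseteq> verts H" "card e = k" using H(1) e(1) by (auto simp: kgraph_def)
    then have "set w = e"
      using e(2) w(1,3) finite_subset[of e "verts H"] finV unfolding V_def
      by (intro card_subset_eq) (auto simp: distinct_card)
    then show "set w \<in> edges H" using e by simp
  next
    fix w U
    assume w: "length w < k" "Good w" "distinct w" "set w \<subseteq> verts H" "finite U"
      "card U \<le> card (verts (tree_hypergraph k l F))" "set w \<subseteq> U"
    define S where "S = set w"
    have S: "S \<subseteq> verts H" "card S = length w" "finite S"
      using w by (auto simp: S_def distinct_card)
    have UM: "real (card U) \<le> real M" using w(6) by (simp add: M_def)
    define X where "X = {v \<in> V - S. \<theta> (Suc (length w)) < real (set_degree H (insert v S))}"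
    have goodX: "Good (w @ [v])" if "v \<in> X" for v
      using that by (simp add: Good_def X_def S_def insert_commute)
    have card_diff: "real (card Y) - real M \<le> real (card (Y - U))" for Y
    proof -
      have "card Y - card U \<le> card (Y - U)" by (rule diff_card_le_card_Diff[OF w(5)])
      then show ?thesis using UM by linarith
    qed
    have tail: "(\<Sum>v\<in>verts H - S - X. real (set_degree H (insert v S))) \<le> real n * \<theta> (Suc (length w))"
    proof -
      have "(\<Sum>v\<in>verts H - S - X. real (set_degree H (insert v S))) \<le> (\<Sum>v\<in>verts H - S - X. \<theta> (Suc (length w)))"
        by (rule sum_mono) (auto simp: X_def V_def)
      also have "\<dots> = real (card (verts H - S - X)) * \<theta> (Suc (length w))" by simp
      also have "\<dots> \<le> real n * \<theta> (Suc (length w))"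
      proof (rule mult_right_mono)
        show "real (card (verts H - S - X)) \<le> real n"
          unfolding n_def V_def[symmetric] by (intro of_nat_mono card_mono[OF finV]) auto
        show "0 \<le> \<theta> (Suc (length w))" using \<eta> by (simp add: \<theta>_def)
      qed
      finally show ?thesis .
    qed
    have "\<exists>A \<phi>. A \<subseteq> V - U \<and> (\<forall>v\<in>A. Good (w @ [v])) \<and> inj_on \<phi> (verts F) \<and> \<phi> ` verts F \<subseteq> A \<and>
       (length w \<le> l \<longrightarrow> (\<forall>e\<in>edges F. \<phi> ` e \<in> edges H))"
    proof (cases "length w \<le> l")
      case True
      have "\<exists>A \<subseteq> V - U. (\<forall>v\<in>A. Good (w @ [v])) \<and> \<gamma> * real n \<le> real (card A)"
      proof (cases "length w < l")
        case True
        then have "\<forall>v\<in>V - U. Good (w @ [v])" by (simp add: Good_def)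
        moreover have "\<gamma> * real n \<le> real (card (V - U))"
          using card_diff[of V] size1 by (simp add: n_def V_def M_def)
        ultimately show ?thesis by blast
      next
        case False
        with True have len: "length w = l" by simp
        define r where "r = k - l"
        have kl: "k - card S = r" using S(2) len by (simp add: r_def)
        have "c * real n ^ r / fact r \<le> real (set_degree H S)"
          using H(2) S len unfolding ldense_def r_def n_def V_def by auto
        then have 1: "c * real n ^ r \<le> fact r * real (set_degree H S)" by (simp add: field_simps)
        have finX: "finite X" using finV by (simp add: X_def)
        \<comment> \<open>Apart from light extensions, the link of \<open>S\<close> lives on
          \<open>X\<close> and has at most card X choose r elements. A dense link therefore needs a
          large \<open>X\<close>, as a comparison of r-th powers shows below.\<close>
        have "card {R. R \<subseteq> X \<and> card R = k - card S \<and> S \<union> R \<in> edges H} \<le> card {R. R \<subseteq> X \<and> card R = r}"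
          by (rule card_mono) (use finX kl in auto)
        then have "card {R. R \<subseteq> X \<and> card R = k - card S \<and> S \<union> R \<in> edges H} \<le> card X choose r"
          by (simp add: n_subsets finX)
        with set_degree_le_sum_insert[OF H(1) S(1), of X] S(2) w(1)
        have "set_degree H S \<le> (card X choose r) + (\<Sum>v\<in>verts H - S - X. set_degree H (insert v S))"
          by simp
        then have "real (set_degree H S) \<le> real ((card X choose r) + (\<Sum>v\<in>verts H - S - X. set_degree H (insert v S)))"
          by (simp only: of_nat_le_iff)
        then have "real (set_degree H S) \<le> real (card X choose r) + real n * \<theta> (Suc l)"
          using tail len by simp
        also have "real n * \<theta> (Suc l) = \<eta> * (1 / 2) ^ Suc l * real n ^ r"
        proof -
          have "r = Suc (k - Suc l)" using l by (simp add: r_def)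
          then show ?thesis by (simp add: \<theta>_def)
        qed
        also have "\<dots> \<le> \<eta> * 1 * real n ^ r"
          using \<eta> by (intro mult_right_mono mult_left_mono power_le_one) auto
        finally have "fact r * real (set_degree H S) \<le> fact r * (real (card X choose r) + \<eta> * real n ^ r)"
          by (intro mult_left_mono) auto
        also have "\<dots> \<le> real (card X) ^ r + fact r * \<eta> * real n ^ r"
          using fact_mult_choose_le[of r "card X"] by (simp add: algebra_simps)
        finally have "(c - fact r * \<eta>) * real n ^ r \<le> real (card X) ^ r"
          using 1 by (simp add: algebra_simps)
        moreover have "(\<gamma> * real n + real M) ^ r \<le> (c - fact r * \<eta>) * real n ^ r"
          using size2 by (simp add: n_def V_def M_def r_def)
        ultimately have "(\<gamma> * real n + real M) ^ r \<le> real (card X) ^ r" by linarith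
        moreover have "0 < r" using l by (simp add: r_def)
        ultimately have "\<gamma> * real n + real M \<le> real (card X)"
          using power_mono_iff[of "\<gamma> * real n + real M" "real (card X)" r] \<gamma> n0 by simp
        then have "\<gamma> * real n \<le> real (card (X - U))" using card_diff[of X] by linarith
        moreover have "X - U \<subseteq> V - U" by (auto simp: X_def)
        ultimately show ?thesis using goodX by (intro exI[of _ "X - U"]) auto
      qed
      then obtain A where A: "A \<subseteq> V - U" "\<forall>v\<in>A. Good (w @ [v])" "\<gamma> * real n \<le> real (card A)" by blast
      have "embeds F (induced H A)"
        by (rule sub) (use A in \<open>auto simp: V_def n_def\<close>)
      then obtain \<phi> where "inj_on \<phi> (verts F)" "\<phi> ` verts F \<subseteq> A" "\<forall>e\<in>edges F. \<phi> ` e \<in> edges H"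
        by (rule embeds_inducedE)
      then show ?thesis using A(1,2) by (intro exI[of _ A] exI[of _ \<phi>]) simp
    next
      case False
      define j where "j = k - Suc (length w)"
      have j: "k - length w = Suc j" using w(1) by (simp add: j_def)
      have finX: "finite X" using finV by (simp add: X_def)
      \<comment> \<open>The splitting lemma is applied with the empty set as \<open>A\<close>: a
        link set is nonempty here, so only the sum over extensions remains.\<close>
      have "{R. R \<subseteq> {} \<and> card R = k - card S \<and> S \<union> R \<in> edges H} = {}" using S(2) j by auto
      then have z: "card {R. R \<subseteq> {} \<and> card R = k - card S \<and> S \<union> R \<in> edges H} = 0"
        by (simp only: card.empty)
      have "card S < k" using S(2) w(1) by simp
      from set_degree_le_sum_insert[OF H(1) S(1) this, of "{}"]
      have "set_degree H S \<le> (\<Sum>v\<in>verts H - S. set_degree H (insert v S))" unfolding z by simp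
      then have "real (set_degree H S) \<le> real (\<Sum>v\<in>verts H - S. set_degree H (insert v S))"
        by (simp only: of_nat_le_iff)
      also have "\<dots> = (\<Sum>v\<in>verts H - S. real (set_degree H (insert v S)))" by simp
      also have "\<dots> = (\<Sum>v\<in>verts H - S - X. real (set_degree H (insert v S))) + (\<Sum>v\<in>X. real (set_degree H (insert v S)))"
        by (rule sum.subset_diff) (use finV in \<open>auto simp: X_def V_def\<close>)
      also have "\<dots> \<le> real n * \<theta> (Suc (length w)) + (\<Sum>v\<in>X. real n ^ j)"
      proof (intro add_mono tail sum_mono)
        fix v assume "v \<in> X"
        then have v: "v \<in> verts H" "v \<notin> S" by (auto simp: X_def V_def)
        then have "set_degree H (insert v S) \<le> (n - card (insert v S)) choose (k - card (insert v S))"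
          using set_degree_le[OF H(1), of "insert v S"] S(1) unfolding n_def V_def by simp
        also have "\<dots> = (n - Suc (length w)) choose j" using v S by (simp add: j_def)
        finally have "real (set_degree H (insert v S)) \<le> 1 * real ((n - Suc (length w)) choose j)" by simp
        also have "\<dots> \<le> fact j * real ((n - Suc (length w)) choose j)"
          by (intro mult_right_mono) auto
        also have "\<dots> \<le> real n ^ j" by (rule fact_mult_choose_shift_le)
        finally show "real (set_degree H (insert v S)) \<le> real n ^ j" .
      qed
      finally have up: "real (set_degree H S) \<le> real n * \<theta> (Suc (length w)) + real (card X) * real n ^ j" by simp
      have "\<theta> (length w) < real (set_degree H S)" using w(2) False by (simp add: Good_def S_def)
      then have "\<eta> * (1 / 2) ^ length w * real n ^ Suc j <
         real n * (\<eta> * (1 / 2) ^ Suc (length w) * real n ^ j) + real (card X) * real n ^ j"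
        using up by (simp add: \<theta>_def j j_def[symmetric])
      then have "(\<eta> * (1 / 2) ^ Suc (length w) * real n) * real n ^ j < real (card X) * real n ^ j"
        by (simp add: algebra_simps)
      then have "\<eta> * (1 / 2) ^ Suc (length w) * real n < real (card X)"
        using n0 by simp
      moreover have "\<eta> * (1 / 2) ^ k * real n \<le> \<eta> * (1 / 2) ^ Suc (length w) * real n"
        using \<eta> w(1) by (intro mult_right_mono mult_left_mono power_decreasing) auto
      ultimately have "real M + real (card (verts F)) \<le> real (card X)"
        using size3 by (simp add: n_def V_def M_def)
      then have "card (verts F) \<le> card (X - U)" using card_diff[of X] by linarith
      then obtain \<phi> where \<phi>: "inj_on \<phi> (verts F)" "\<phi> ` verts F \<subseteq> X - U"
        using card_le_inj[of "verts F" "X - U"] F finX unfolding kgraph_def by auto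
      moreover have "X - U \<subseteq> V - U" by (auto simp: X_def)
      ultimately show ?thesis using goodX False by (intro exI[of _ "X - U"] exI[of _ \<phi>]) auto
    qed
    then obtain A \<phi> where A: "A \<subseteq> V - U" "\<forall>v\<in>A. Good (w @ [v])" "inj_on \<phi> (verts F)" "\<phi> ` verts F \<subseteq> A"
       "length w \<le> l \<longrightarrow> (\<forall>e\<in>edges F. \<phi> ` e \<in> edges H)" by (elim exE conjE)
    show "\<exists>\<phi>. inj_on \<phi> (verts F) \<and> \<phi> ` verts F \<subseteq> verts H - U \<and> (\<forall>x\<in>verts F. Good (w @ [\<phi> x])) \<and>
        (length w \<le> l \<longrightarrow> (\<forall>e\<in>edges F. \<phi> ` e \<in> edges H))"
    proof (intro exI[of _ \<phi>] conjI A(3,5) ballI)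
      show "\<phi> ` verts F \<subseteq> verts H - U" using A(1,4) by (auto simp: V_def)
      fix x assume "x \<in> verts F"
      then have "\<phi> x \<in> A" using A(4) by blast
      then show "Good (w @ [\<phi> x])" using A(2) by blast
    qed
  qed
qed

section \<open>Hosts without tree hypergraphs\<close>

text \<open>No edge lies inside \<open>B\<close>. For t = k - 1 the last condition excludes nothing
  more, as an edge meeting the disjoint set \<open>verts G\<close> has at most k - 1 vertices in
  \<open>B\<close>; for t = 1 the mixed edges have exactly one vertex there.\<close>

definition host :: "nat \<Rightarrow> nat \<Rightarrow> 'a hypergraph \<Rightarrow> 'a set \<Rightarrow> 'a hypergraph" where
  "host k t G B = (verts G \<union> B, edges G \<union>
     {e. e \<subseteq> verts G \<union> B \<and> card e = k \<and> e \<inter> verts G \<noteq> {} \<and> e \<inter> B \<noteq> {} \<and> card (e \<inter> B) \<le> t})"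

lemma verts_host [simp]: "verts (host k t G B) = verts G \<union> B"
  by (simp add: host_def)

lemma edges_host: "edges (host k t G B) = edges G \<union>
     {e. e \<subseteq> verts G \<union> B \<and> card e = k \<and> e \<inter> verts G \<noteq> {} \<and> e \<inter> B \<noteq> {} \<and> card (e \<inter> B) \<le> t}"
  by (simp add: host_def)

lemma kgraph_host:
  assumes "kgraph k G" "finite B"
  shows "kgraph k (host k t G B)"
  using assms unfolding kgraph_def edges_host by auto

lemma not_embeds_tree_hypergraph_host:
  assumes F: "kgraph k F" "verts F \<noteq> {}" and "t < k" and G: "kgraph k G" "finite B" "verts G \<inter> B = {}"
    and free: "\<not> embeds F G"
  shows "\<not> embeds (tree_hypergraph k t F) (host k t G B)"
proof (rule not_embeds_tree_hypergraph[OF F \<open>t < k\<close> kgraph_host[OF G(1,2)]])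
  show "\<not> embeds F (induced (host k t G B) (verts G))"
  proof
    assume "embeds F (induced (host k t G B) (verts G))"
    then have "embeds F G"
      by (rule embeds_mono) (use G(3) in \<open>auto simp: edges_host\<close>)
    with free show False by contradiction
  qed
  fix e assume "e \<in> edges (host k t G B)"
  then consider "e \<in> edges G" | "e \<subseteq> verts G \<union> B" "card (e \<inter> B) \<le> t" by (auto simp: edges_host)
  then show "card (e - verts G) \<le> t"
  proof cases
    case 1
    then have "e \<subseteq> verts G" using G(1) by (simp add: kgraph_def)
    then have "e - verts G = {}" by blast
    then show ?thesis by (simp only: card.empty)
  next
    case 2
    then have "e - verts G = e \<inter> B" using G(3) by blast
    then show ?thesis using 2 by simp
  qed
qed

text \<open>\<open>S\<close> lies in \<open>verts G\<close>, so a completion puts at most k - l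
  vertices into \<open>B\<close>. With k - l <= t every completion that leaves
  \<open>verts G\<close> is an edge, and only those inside are governed by \<open>G\<close>.\<close>

lemma set_degree_host_inside:
  assumes G: "kgraph k G" "finite B" "verts G \<inter> B = {}" and S: "S \<subseteq> verts G" "card S = l"
    and "1 \<le> l" "l < k" "k - l \<le> t"
  shows "set_degree G S + ((card (verts G) + card B - l) choose (k - l))
    \<le> set_degree (host k t G B) S + ((card (verts G) - l) choose (k - l))"
proof -
  define A where "A = verts G"
  have fin: "finite A" "finite S" using G S finite_subset unfolding A_def kgraph_def by auto
  define X where "X = {R. R \<subseteq> A - S \<and> card R = k - l \<and> S \<union> R \<in> edges G}"
  define Y where "Y = {R. R \<subseteq> (A \<union> B) - S \<and> card R = k - l \<and> \<not> R \<subseteq> A - S}"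
  have AB: "card (A \<union> B) = card A + card B"
    using G fin by (intro card_Un_disjoint) (auto simp: A_def)
  have SB: "S \<inter> B = {}" using S G(3) by auto
  have "card X + card Y = card (X \<union> Y)"
    by (rule card_Un_disjoint[symmetric]) (use fin G(2) in \<open>auto simp: X_def Y_def\<close>)
  also have "\<dots> \<le> set_degree (host k t G B) S"
  proof (rule set_degree_ge_card[OF kgraph_host[OF G(1,2)]])
    show "S \<subseteq> verts (host k t G B)" using S by auto
    fix R assume "R \<in> X \<union> Y"
    then show "R \<subseteq> verts (host k t G B) - S \<and> card R = k - card S \<and> S \<union> R \<in> edges (host k t G B)"
    proof
      assume "R \<in> X" then show ?thesis using S by (auto simp: X_def edges_host A_def)
    next
      assume R: "R \<in> Y"
      then have finR: "finite R" using fin G(2) finite_subset[of R "A \<union> B - S"] by (auto simp: Y_def)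
      have "S \<inter> R = {}" using R by (auto simp: Y_def)
      then have "card (S \<union> R) = k"
        using card_Un_disjoint[OF fin(2) finR] R S(2) \<open>l < k\<close> by (simp add: Y_def)
      moreover have "S \<noteq> {}" using S(2) \<open>1 \<le> l\<close> by auto
      then have "(S \<union> R) \<inter> A \<noteq> {}" using S(1) by (auto simp: A_def)
      moreover have "(S \<union> R) \<inter> B \<noteq> {}" using R by (auto simp: Y_def)
      moreover have "card ((S \<union> R) \<inter> B) \<le> card R"
        by (rule card_mono[OF finR]) (use SB in auto)
      then have "card ((S \<union> R) \<inter> B) \<le> t" using R \<open>k - l \<le> t\<close> by (simp add: Y_def)
      ultimately show ?thesis using R S by (auto simp: Y_def edges_host A_def)
    qed
  qed
  also have "card X = set_degree G S"
    using set_degree_link[OF G(1) S(1)] S(2) by (simp add: X_def A_def)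
  also have "card Y = ((card A + card B - l) choose (k - l)) - ((card A - l) choose (k - l))"
  proof -
    have "card Y = (card (A \<union> B - S) choose (k - l)) - (card (A - S) choose (k - l))"
      unfolding Y_def by (rule card_subsets_not_inside) (use fin G(2) in auto)
    then show ?thesis using S fin AB by (simp add: card_Diff_subset A_def le_supI1)
  qed
  finally have "set_degree G S + (((card A + card B - l) choose (k - l)) - ((card A - l) choose (k - l)))
    \<le> set_degree (host k t G B) S" .
  then show ?thesis unfolding A_def by linarith
qed

text \<open>Completing inside \<open>verts G\<close> adds no vertex of \<open>B\<close>, and
  \<open>S\<close> itself has at most l <= t of them; all these completions are edges.\<close>

lemma set_degree_host_outside:
  assumes G: "kgraph k G" "finite B" "verts G \<inter> B = {}" and S: "S \<subseteq> verts G \<union> B" "\<not> S \<subseteq> verts G" "card S = l"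
    and "l < k" "l \<le> t"
  shows "(card (verts G) - l) choose (k - l) \<le> set_degree (host k t G B) S"
proof -
  define A where "A = verts G"
  have fin: "finite A" "finite S" using G S(1) finite_subset[OF S(1)] unfolding A_def kgraph_def by auto
  have "(card A - l) choose (k - l) \<le> card (A - S) choose (k - l)"
    by (rule binomial_right_mono) (use diff_card_le_card_Diff[OF fin(2), of A] S(3) in simp)
  also have "\<dots> = card {R. R \<subseteq> A - S \<and> card R = k - l}" using fin by (simp add: n_subsets)
  also have "\<dots> \<le> set_degree (host k t G B) S"
  proof (rule set_degree_ge_card[OF kgraph_host[OF G(1,2)]])
    show "S \<subseteq> verts (host k t G B)" using S by simp
    fix R assume "R \<in> {R. R \<subseteq> A - S \<and> card R = k - l}"
    then have R: "R \<subseteq> A - S" "card R = k - l" by auto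
    then have finR: "finite R" using fin finite_subset by blast
    have "S \<inter> R = {}" using R by auto
    then have "card (S \<union> R) = k"
      using card_Un_disjoint[OF fin(2) finR] R S(3) \<open>l < k\<close> by simp
    moreover have "R \<noteq> {}" using R(2) \<open>l < k\<close> by auto
    then have "(S \<union> R) \<inter> A \<noteq> {}" using R by auto
    moreover have "(S \<union> R) \<inter> B \<noteq> {}" using S by auto
    moreover have "card ((S \<union> R) \<inter> B) \<le> card S"
      by (rule card_mono[OF fin(2)]) (use R G(3) in \<open>auto simp: A_def\<close>)
    then have "card ((S \<union> R) \<inter> B) \<le> t" using S(3) \<open>l \<le> t\<close> by simp
    ultimately show "R \<subseteq> verts (host k t G B) - S \<and> card R = k - card S \<and> S \<union> R \<in> edges (host k t G B)"
      using R S by (auto simp: edges_host A_def)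
  qed
  finally show ?thesis by (simp add: A_def)
qed

text \<open>When all mixed k-sets are edges, a completion that meets \<open>verts G\<close> always
  works, so at most the completions inside \<open>B\<close> are lost.\<close>

lemma set_degree_host_outside_full:
  assumes G: "kgraph k G" "finite B" "verts G \<inter> B = {}" and S: "S \<subseteq> verts G \<union> B" "\<not> S \<subseteq> verts G" "card S = l"
    and "l < k"
  shows "(card (verts G) + card B - l) choose (k - l) \<le> set_degree (host k (k - 1) G B) S + (card B choose (k - l))"
proof -
  define A where "A = verts G"
  have fin: "finite A" "finite S" "finite (A \<union> B - S)"
    using G S(1) finite_subset[OF S(1)] unfolding A_def kgraph_def by auto
  define Y where "Y = {R. R \<subseteq> (A \<union> B) - S \<and> card R = k - l \<and> \<not> R \<subseteq> B - S}"
  have AB: "card (A \<union> B) = card A + card B"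
    using G fin by (intro card_Un_disjoint) (auto simp: A_def)
  have cY: "card Y = (card (A \<union> B - S) choose (k - l)) - (card (B - S) choose (k - l))"
    unfolding Y_def by (rule card_subsets_not_inside) (use fin in auto)
  have cAB: "card (A \<union> B - S) = card A + card B - l"
    using S AB fin by (simp add: card_Diff_subset A_def)
  have cB: "card (B - S) choose (k - l) \<le> card B choose (k - l)"
    by (rule binomial_right_mono, rule card_mono) (use G in auto)
  have "card Y \<le> set_degree (host k (k - 1) G B) S"
  proof (rule set_degree_ge_card[OF kgraph_host[OF G(1,2)]])
    show "S \<subseteq> verts (host k (k - 1) G B)" using S by simp
    fix R assume R: "R \<in> Y"
    then have finR: "finite R" using fin finite_subset[of R "A \<union> B - S"] by (auto simp: Y_def)
    have "S \<inter> R = {}" using R by (auto simp: Y_def)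
    then have ck: "card (S \<union> R) = k"
      using card_Un_disjoint[OF fin(2) finR] R S(3) \<open>l < k\<close> by (simp add: Y_def)
    moreover have meetA: "(S \<union> R) \<inter> A \<noteq> {}" using R by (auto simp: Y_def)
    moreover have "(S \<union> R) \<inter> B \<noteq> {}" using S by auto
    moreover have "card ((S \<union> R) \<inter> B) < card (S \<union> R)"
      by (rule psubset_card_mono) (use finR fin meetA G(3) in \<open>auto simp: A_def\<close>)
    ultimately show "R \<subseteq> verts (host k (k - 1) G B) - S \<and> card R = k - card S \<and> S \<union> R \<in> edges (host k (k - 1) G B)"
      using R S by (auto simp: edges_host A_def Y_def)
  qed
  with cY cAB have "(card A + card B - l choose (k - l)) - (card (B - S) choose (k - l))
      \<le> set_degree (host k (k - 1) G B) S" by metis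
  then show ?thesis using cB unfolding A_def by linarith
qed

text \<open>The case l = 1, where k - l <= t may fail: besides the edges of \<open>G\<close>,
  exactly the completions with a single vertex in \<open>B\<close> are counted, since they are
  available already for t = 1.\<close>

lemma set_degree_host_vertex:
  assumes G: "kgraph k G" "finite B" "verts G \<inter> B = {}" and v: "v \<in> verts G" and k: "1 < k" "1 \<le> t"
  shows "set_degree G {v} + card B * ((card (verts G) - 1) choose (k - 2)) \<le> set_degree (host k t G B) {v}"
proof -
  define A where "A = verts G"
  have fin: "finite A" using G by (simp add: A_def kgraph_def)
  define X where "X = {R. R \<subseteq> A - {v} \<and> card R = k - 1 \<and> {v} \<union> R \<in> edges G}"
  define Q where "Q = {R. R \<subseteq> A - {v} \<and> card R = k - 2}"
  define Y where "Y = (\<lambda>(b, R). insert b R) ` (B \<times> Q)"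
  have disj: "b \<notin> A" if "b \<in> B" for b using G(3) that by (auto simp: A_def)
  have "card Y = card (B \<times> Q)"
    unfolding Y_def
  proof (rule card_image, rule inj_onI, clarify)
    fix b R b' R' assume *: "b \<in> B" "R \<in> Q" "b' \<in> B" "R' \<in> Q" "insert b R = insert b' R'"
    have "R = insert b R \<inter> A" using *(1,2) disj by (auto simp: Q_def)
    moreover have "R' = insert b' R' \<inter> A" using *(3,4) disj by (auto simp: Q_def)
    ultimately have RR: "R = R'" using *(5) by metis
    have "b \<notin> R" "b' \<notin> R'" using *(1-4) disj by (auto simp: Q_def)
    then show "b = b' \<and> R = R'" using *(5) RR by auto
  qed
  also have "\<dots> = card B * ((card A - 1) choose (k - 2))"
    using fin v by (simp add: card_cartesian_product Q_def n_subsets A_def)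
  finally have cY: "card Y = card B * ((card A - 1) choose (k - 2))" .
  have finQ: "finite Q" "finite X" using fin by (simp_all add: Q_def X_def)
  have "card X + card Y = card (X \<union> Y)"
  proof (rule card_Un_disjoint[symmetric])
    show "finite X" "finite Y" using finQ G(2) by (simp_all add: Y_def)
    have "R \<subseteq> A" if "R \<in> X" for R using that by (auto simp: X_def)
    moreover have "\<not> R \<subseteq> A" if "R \<in> Y" for R using that disj by (auto simp: Y_def)
    ultimately show "X \<inter> Y = {}" by blast
  qed
  also have "\<dots> \<le> set_degree (host k t G B) {v}"
  proof (rule set_degree_ge_card[OF kgraph_host[OF G(1,2)]])
    show "{v} \<subseteq> verts (host k t G B)" using v by simp
    fix R assume "R \<in> X \<union> Y"
    then show "R \<subseteq> verts (host k t G B) - {v} \<and> card R = k - card {v} \<and> {v} \<union> R \<in> edges (host k t G B)"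
    proof
      assume "R \<in> X" then show ?thesis by (auto simp: X_def edges_host A_def)
    next
      assume "R \<in> Y"
      then obtain b Q' where bQ: "b \<in> B" "R = insert b Q'" "Q' \<subseteq> A - {v}" "card Q' = k - 2"
        by (auto simp: Y_def Q_def)
      have finQ': "finite Q'" using bQ(3) fin finite_subset by blast
      have b: "b \<notin> Q'" "b \<noteq> v" using disj[OF bQ(1)] bQ(3) v by (auto simp: A_def)
      then have cR: "card R = k - 1" using finQ' bQ k by simp
      have vR: "v \<notin> R" using b bQ by auto
      have "finite R" using finQ' bQ(2) by simp
      then have "card (insert v R) = Suc (card R)" using vR by (rule card_insert_disjoint)
      then have "card ({v} \<union> R) = k" using cR k by simp
      moreover have inB: "({v} \<union> R) \<inter> B = {b}" using bQ v disj by (auto simp: A_def)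
      then have "({v} \<union> R) \<inter> B \<noteq> {}" "card (({v} \<union> R) \<inter> B) \<le> t" using k by simp_all
      moreover have "({v} \<union> R) \<inter> verts G \<noteq> {}" using v by blast
      moreover have RV: "R \<subseteq> verts G \<union> B" using bQ by (auto simp: A_def)
      then have "{v} \<union> R \<subseteq> verts G \<union> B" using v by blast
      ultimately have "{v} \<union> R \<in> edges (host k t G B)" unfolding edges_host by blast
      then show ?thesis using RV vR cR by auto
    qed
  qed
  also have "card X = set_degree G {v}"
    using set_degree_link[OF G(1), of "{v}"] v by (simp add: X_def A_def)
  finally show ?thesis using cY by (simp add: A_def)
qed

section \<open>Rounding the size of the parts\<close>

lemma floor_ratio_tendsto:
  fixes \<alpha> :: real
  assumes "0 \<le> \<alpha>"
  shows "(\<lambda>n. real (nat \<lfloor>\<alpha> * real n\<rfloor>) / real n) \<longlonglongrightarrow> \<alpha>"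
proof (rule tendsto_sandwich)
  show "\<forall>\<^sub>F n in sequentially. (\<alpha> * real n - 1) / real n \<le> real (nat \<lfloor>\<alpha> * real n\<rfloor>) / real n"
    by (intro always_eventually allI divide_right_mono) linarith+
  show "\<forall>\<^sub>F n in sequentially. real (nat \<lfloor>\<alpha> * real n\<rfloor>) / real n \<le> \<alpha>"
    using eventually_gt_at_top[of 0]
  proof eventually_elim
    case (elim n)
    have "real (nat \<lfloor>\<alpha> * real n\<rfloor>) \<le> \<alpha> * real n" using assms by simp
    then show ?case using elim by (simp add: field_simps)
  qed
  show "(\<lambda>n. (\<alpha> * real n - 1) / real n) \<longlonglongrightarrow> \<alpha>" by real_asymp
qed simp

lemma eventually_floor_power_ge:
  fixes \<alpha> \<epsilon> :: real
  assumes "0 \<le> \<alpha>" "0 < \<epsilon>"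
  shows "\<forall>\<^sub>F n in sequentially. (\<alpha> ^ j - \<epsilon>) * real n ^ j \<le> real (nat \<lfloor>\<alpha> * real n\<rfloor>) ^ j"
proof -
  have "(\<lambda>n. (real (nat \<lfloor>\<alpha> * real n\<rfloor>) / real n) ^ j) \<longlonglongrightarrow> \<alpha> ^ j"
    by (intro tendsto_power floor_ratio_tendsto assms)
  then have "\<forall>\<^sub>F n in sequentially. \<alpha> ^ j - \<epsilon> < (real (nat \<lfloor>\<alpha> * real n\<rfloor>) / real n) ^ j"
    using assms by (intro order_tendstoD(1)) auto
  then show ?thesis using eventually_gt_at_top[of 0]
  proof eventually_elim
    case (elim n)
    then have "0 < real n ^ j" by simp
    moreover have "\<alpha> ^ j - \<epsilon> < real (nat \<lfloor>\<alpha> * real n\<rfloor>) ^ j / real n ^ j"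
      using elim(1) by (simp only: power_divide)
    ultimately show ?case by (simp add: pos_less_divide_eq)
  qed
qed

lemma eventually_cofloor_power_le:
  fixes \<alpha> \<epsilon> :: real
  assumes "0 \<le> \<alpha>" "\<alpha> \<le> 1" "0 < \<epsilon>"
  shows "\<forall>\<^sub>F n in sequentially. real (n - nat \<lfloor>\<alpha> * real n\<rfloor>) ^ j \<le> ((1 - \<alpha>) ^ j + \<epsilon>) * real n ^ j"
proof -
  have "(\<lambda>n. (1 - real (nat \<lfloor>\<alpha> * real n\<rfloor>) / real n) ^ j) \<longlonglongrightarrow> (1 - \<alpha>) ^ j"
    by (intro tendsto_power tendsto_diff tendsto_const floor_ratio_tendsto assms)
  then have "\<forall>\<^sub>F n in sequentially. (1 - real (nat \<lfloor>\<alpha> * real n\<rfloor>) / real n) ^ j < (1 - \<alpha>) ^ j + \<epsilon>"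
    using assms by (intro order_tendstoD(2)) auto
  then show ?thesis using eventually_gt_at_top[of 0]
  proof eventually_elim
    case (elim n)
    have "real (nat \<lfloor>\<alpha> * real n\<rfloor>) \<le> \<alpha> * real n" using assms by simp
    also have "\<dots> \<le> 1 * real n" using assms by (intro mult_right_mono) auto
    finally have "nat \<lfloor>\<alpha> * real n\<rfloor> \<le> n" by simp
    then have "1 - real (nat \<lfloor>\<alpha> * real n\<rfloor>) / real n = real (n - nat \<lfloor>\<alpha> * real n\<rfloor>) / real n"
      using elim(2) by (simp add: of_nat_diff field_simps)
    then have "real (n - nat \<lfloor>\<alpha> * real n\<rfloor>) ^ j / real n ^ j < (1 - \<alpha>) ^ j + \<epsilon>"
      using elim(1) by (simp only: power_divide)
    moreover have "0 < real n ^ j" using elim(2) by simp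
    ultimately show ?case by (simp add: pos_divide_less_eq)
  qed
qed

definition host_dense :: "nat \<Rightarrow> nat \<Rightarrow> nat \<Rightarrow> real \<Rightarrow> real \<Rightarrow> real \<Rightarrow> nat \<Rightarrow> bool" where
  "host_dense k l t \<alpha> c d n \<longleftrightarrow> (\<forall>(G :: nat hypergraph) B. kgraph k G \<longrightarrow>
     card (verts G) = nat \<lfloor>\<alpha> * real n\<rfloor> \<longrightarrow> finite B \<longrightarrow> verts G \<inter> B = {} \<longrightarrow> card B = n - card (verts G) \<longrightarrow>
     card (verts G) + card B = n \<longrightarrow> ldense k l c G \<longrightarrow> ldense k l d (host k t G B))"

text \<open>The common part of the three lower bounds; only the degree estimate \<open>deg\<close>
  differs. It allows \<delta> to depend on \<epsilon>, so \<open>G\<close> need only be nearly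
  extremal for \<open>F\<close>.\<close>

lemma degree_turan_density_ge_host:
  fixes F T :: "nat hypergraph"
  assumes F: "kgraph k F" "edges F \<noteq> {}" "verts F \<noteq> {}" and "l < k" "t < k"
    and T: "edges T \<noteq> {}" "\<And>H :: nat hypergraph. embeds T H \<longleftrightarrow> embeds (tree_hypergraph k t F) H"
    and \<alpha>: "0 < \<alpha>" "\<alpha> \<le> 1"
    and deg: "\<And>\<epsilon>. 0 < \<epsilon> \<Longrightarrow> \<exists>\<delta>>0. \<forall>\<^sub>F n in sequentially. host_dense k l t \<alpha> (degree_turan_density k l F - \<delta>) (x - \<epsilon>) n"
  shows "x \<le> degree_turan_density k l T"
proof (rule degree_turan_density_ge[OF T(1) \<open>l < k\<close>])
  fix \<epsilon> :: real assume "0 < \<epsilon>"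
  from deg[OF this] obtain \<delta> where \<delta>: "0 < \<delta>" and
    ev: "\<forall>\<^sub>F n in sequentially. host_dense k l t \<alpha> (degree_turan_density k l F - \<delta>) (x - \<epsilon>) n"
    by (elim exE conjE)
  have "degree_turan_density k l F - \<delta> < degree_turan_density k l F" using \<delta> by simp
  from eventually_free_below_density[OF F(2) \<open>l < k\<close> this]
  have ev2: "\<forall>\<^sub>F m in sequentially. \<exists>G :: nat hypergraph. kgraph k G \<and> card (verts G) = m \<and>
     \<not> embeds F G \<and> ldense k l (degree_turan_density k l F - \<delta>) G" .
  \<comment> \<open>The rounded size of \<open>A\<close> tends to infinity, so \<open>F\<close>-free
    graphs of that order exist for all large n.\<close>
  have "filterlim (\<lambda>n. nat \<lfloor>\<alpha> * real n\<rfloor>) sequentially sequentially"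
    using \<alpha>(1) by real_asymp
  from eventually_compose_filterlim[OF ev2 this] ev
  show "\<forall>\<^sub>F n in sequentially. \<exists>H :: nat hypergraph. kgraph k H \<and> card (verts H) = n \<and> \<not> embeds T H \<and> ldense k l (x - \<epsilon>) H"
  proof eventually_elim
    case (elim n)
    from elim(1) obtain G :: "nat hypergraph" where G: "kgraph k G" "card (verts G) = nat \<lfloor>\<alpha> * real n\<rfloor>"
      "\<not> embeds F G" "ldense k l (degree_turan_density k l F - \<delta>) G" by (elim exE conjE)
    have fin: "finite (verts G)" using G by (simp add: kgraph_def)
    have "real (nat \<lfloor>\<alpha> * real n\<rfloor>) \<le> \<alpha> * real n" using \<alpha> by simp
    also have "\<dots> \<le> 1 * real n" using \<alpha> by (intro mult_right_mono) auto
    finally have le: "card (verts G) \<le> n" using G(2) by simp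
    have "infinite (UNIV - verts G)" using fin by (simp add: Diff_infinite_finite)
    then obtain B where B: "finite B" "card B = n - card (verts G)" "B \<subseteq> UNIV - verts G"
      using infinite_arbitrarily_large by metis
    have disj: "verts G \<inter> B = {}" using B(3) by auto
    have sum: "card (verts G) + card B = n" using B(2) le by simp
    have "ldense k l (x - \<epsilon>) (host k t G B)"
      using elim(2)[unfolded host_dense_def, rule_format, OF G(1,2) B(1) disj B(2) sum G(4)] .
    moreover have "\<not> embeds T (host k t G B)"
      unfolding T(2) by (rule not_embeds_tree_hypergraph_host[OF F(1,3) \<open>t < k\<close> G(1) B(1) disj G(3)])
    moreover have "card (verts (host k t G B)) = n"
      using card_Un_disjoint[OF fin B(1) disj] sum by simp
    ultimately show ?case using kgraph_host[OF G(1) B(1)] by blast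
  qed
qed

section \<open>Transfer functions\<close>

lemma ldenseI:
  assumes "\<And>S. S \<subseteq> verts H \<Longrightarrow> card S = l \<Longrightarrow>
    c * real (card (verts H)) ^ (k - l) \<le> fact (k - l) * real (set_degree H S)"
  shows "ldense k l c H"
  unfolding ldense_def
proof (intro allI impI)
  fix S assume "S \<subseteq> verts H \<and> card S = l"
  then have "c * real (card (verts H)) ^ (k - l) \<le> fact (k - l) * real (set_degree H S)"
    using assms by blast
  then show "c * real (card (verts H)) ^ (k - l) / fact (k - l) \<le> real (set_degree H S)"
    by (simp add: field_simps)
qed

lemma ldenseD:
  assumes "ldense k l c H" "S \<subseteq> verts H" "card S = l"
  shows "c * real (card (verts H)) ^ (k - l) \<le> fact (k - l) * real (set_degree H S)"
proof -
  have "c * real (card (verts H)) ^ (k - l) / fact (k - l) \<le> real (set_degree H S)"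
    using assms unfolding ldense_def by blast
  then show ?thesis by (simp add: field_simps)
qed

text \<open>The spectrum ranges over hypergraphs on \<open>nat\<close>, so words are encoded as
  numbers; embeddability is not affected.\<close>

lemma nat_tree_hypergraph:
  fixes F :: "nat hypergraph"
  assumes "kgraph k F" "edges F \<noteq> {}" "t < k"
  obtains T :: "nat hypergraph" where "kgraph k T" "edges T \<noteq> {}"
    "\<And>H :: nat hypergraph. embeds T H \<longleftrightarrow> embeds (tree_hypergraph k t F) H"
proof -
  define T0 where "T0 = tree_hypergraph k t F"
  have T0: "kgraph k T0" unfolding T0_def by (rule kgraph_tree_hypergraph[OF assms(1,3)])
  define T :: "nat hypergraph" where "T = (to_nat ` verts T0, (\<lambda>e. to_nat ` e) ` edges T0)"
  have "kgraph k T"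
    using T0 unfolding T_def kgraph_def by (auto simp: card_image)
  moreover have "edges T \<noteq> {}"
  proof -
    obtain e where "e \<in> edges F" using assms(2) by blast
    then have "(\<lambda>x. [] @ [x]) ` e \<in> edges T0"
      unfolding T0_def tree_hypergraph_def snd_conv by (intro UnI1 CollectI exI[of _ "[]"] exI[of _ e]) simp
    then show ?thesis by (auto simp: T_def)
  qed
  moreover have "embeds T H \<longleftrightarrow> embeds (tree_hypergraph k t F) H" for H :: "nat hypergraph"
    unfolding T_def T0_def[symmetric]
    by (rule embeds_relabel_iff) (use T0 in \<open>simp_all add: kgraph_def\<close>)
  ultimately show thesis by (rule that)
qed

lemma verts_nonempty:
  assumes "kgraph k F" "edges F \<noteq> {}" "0 < k"
  shows "verts F \<noteq> {}"
proof -
  obtain e where "e \<in> edges F" using assms(2) by blast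
  then have "e \<subseteq> verts F" "card e = k" using assms(1) by (simp_all add: kgraph_def)
  then show ?thesis using assms(3) by auto
qed

lemma degree_turan_spectrumI:
  assumes "kgraph k F" "edges F \<noteq> {}" "degree_turan_density k l F = x"
  shows "x \<in> degree_turan_spectrum k l"
  unfolding degree_turan_spectrum_def nonempty_hypergraph_def using assms by blast

text \<open>Witnessed by a single edge, which every host of positive minimum degree
  contains.\<close>

lemma zero_in_degree_turan_spectrum:
  assumes "l < k"
  shows "0 \<in> degree_turan_spectrum k l"
proof -
  define F :: "nat hypergraph" where "F = ({..<k}, {{..<k}})"
  have F: "kgraph k F" "edges F \<noteq> {}" by (auto simp: F_def kgraph_def)
  have "degree_turan_density k l F \<le> 0"
  proof (rule degree_turan_density_le[OF F(2) assms])
    fix c :: real assume c: "0 < c"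
    show "\<forall>\<^sub>F n in sequentially. \<forall>H :: nat hypergraph.
      kgraph k H \<longrightarrow> card (verts H) = n \<longrightarrow> ldense k l c H \<longrightarrow> embeds F H"
      using eventually_ge_at_top[of l] eventually_gt_at_top[of 0]
    proof eventually_elim
      case (elim n)
      show ?case
      proof (intro allI impI)
        fix H :: "nat hypergraph"
        assume H: "kgraph k H" "card (verts H) = n" "ldense k l c H"
        obtain S where S: "S \<subseteq> verts H" "card S = l"
          using obtain_subset_with_card_n[of l "verts H"] elim(1) H(2) by metis
        have "0 < c * real n ^ (k - l)" using c elim(2) by simp
        also have "\<dots> \<le> fact (k - l) * real (set_degree H S)" using ldenseD[OF H(3) S] H(2) by simp
        finally have "0 < set_degree H S" by (simp add: zero_less_mult_iff)
        then have "{e \<in> edges H. S \<subseteq> e} \<noteq> {}" unfolding set_degree_def by (metis card.empty less_irrefl)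
        then obtain e where e: "e \<in> edges H" by blast
        then have e': "e \<subseteq> verts H" "card e = k" using H(1) by (simp_all add: kgraph_def)
        have "finite e" using e'(2) assms by (metis card.infinite not_less0)
        then obtain f where "bij_betw f {0..<card e} e" using ex_bij_betw_nat_finite by blast
        then have "inj_on f {..<k}" "f ` {..<k} = e"
          using e'(2) by (simp_all add: bij_betw_def lessThan_atLeast0)
        then show "embeds F H" using e e' unfolding embeds_def F_def by (intro exI[of _ f]) simp
      qed
    qed
  qed simp
  then have "degree_turan_density k l F = 0" using degree_turan_density_bounds(1)[OF F(2) assms] by simp
  with F show ?thesis by (rule degree_turan_spectrumI)
qed

text \<open>All completions are edges except a share 1 - \<beta> of those inside
  \<open>verts G\<close>, which are a share \<alpha>^(k-l) of all. One e is the defect of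
  \<open>G\<close>, the other the binomial error.\<close>

lemma host_degree_inside_ge:
  fixes \<alpha> e \<beta> :: real
  assumes G: "kgraph k G" "finite B" "verts G \<inter> B = {}" and S: "S \<subseteq> verts G" "card S = l"
    and l: "1 \<le> l" "l < k" "k - l \<le> t" and n: "card (verts G) + card B = n"
    and \<alpha>: "0 \<le> \<alpha>" "\<alpha> \<le> 1" "real (card (verts G)) \<le> \<alpha> * real n" and "\<beta> \<le> 1" "0 < e"
    and dense: "ldense k l (\<beta> - e) G"
    and large: "real n ^ (k - l) - e * real n ^ (k - l) \<le> fact (k - l) * real ((n - l) choose (k - l))"
  shows "(1 - (1 - \<beta>) * \<alpha> ^ (k - l) - 2 * e) * real n ^ (k - l) \<le> fact (k - l) * real (set_degree (host k t G B) S)"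
proof -
  define r where "r = k - l"
  define a where "a = card (verts G)"
  have "real (set_degree G S + ((n - l) choose r)) \<le> real (set_degree (host k t G B) S + ((a - l) choose r))"
    using set_degree_host_inside[OF G S l] n unfolding a_def r_def by (simp only: of_nat_le_iff)
  then have "fact r * (real (set_degree G S) + real ((n - l) choose r))
     \<le> fact r * (real (set_degree (host k t G B) S) + real ((a - l) choose r))"
    by (intro mult_left_mono) auto
  moreover have "(\<beta> - e) * real a ^ r \<le> fact r * real (set_degree G S)"
    using ldenseD[OF dense S] by (simp add: a_def r_def)
  moreover have "fact r * real ((a - l) choose r) \<le> real a ^ r" by (rule fact_mult_choose_shift_le)
  ultimately have 1: "real n ^ r - e * real n ^ r - (1 - \<beta> + e) * real a ^ r
      \<le> fact r * real (set_degree (host k t G B) S)"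
    using large by (simp add: r_def[symmetric] algebra_simps)
  have "real a ^ r \<le> (\<alpha> * real n) ^ r" using \<alpha> by (intro power_mono) (auto simp: a_def)
  then have 2: "(1 - \<beta>) * real a ^ r \<le> (1 - \<beta>) * (\<alpha> ^ r * real n ^ r)"
    using \<open>\<beta> \<le> 1\<close> by (intro mult_left_mono) (auto simp: power_mult_distrib)
  have "real a ^ r \<le> real n ^ r" using n by (intro power_mono) (auto simp: a_def)
  then have "e * real a ^ r \<le> e * real n ^ r" using \<open>0 < e\<close> by simp
  with 1 2 show ?thesis unfolding r_def[symmetric] by (simp add: algebra_simps)
qed

lemma host_degree_outside_ge:
  fixes \<alpha> e :: real
  assumes G: "kgraph k G" "finite B" "verts G \<inter> B = {}" and S: "S \<subseteq> verts G \<union> B" "\<not> S \<subseteq> verts G" "card S = l"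
    and l: "l < k" "l \<le> t"
    and large: "real (card (verts G)) ^ (k - l) - e * real n ^ (k - l) \<le> fact (k - l) * real ((card (verts G) - l) choose (k - l))"
      "(\<alpha> ^ (k - l) - e) * real n ^ (k - l) \<le> real (card (verts G)) ^ (k - l)"
  shows "(\<alpha> ^ (k - l) - 2 * e) * real n ^ (k - l) \<le> fact (k - l) * real (set_degree (host k t G B) S)"
proof -
  have "real ((card (verts G) - l) choose (k - l)) \<le> real (set_degree (host k t G B) S)"
    using set_degree_host_outside[OF G S l] by (simp only: of_nat_le_iff)
  then have "fact (k - l) * real ((card (verts G) - l) choose (k - l)) \<le> fact (k - l) * real (set_degree (host k t G B) S)"
    by (intro mult_left_mono) auto
  moreover have "(\<alpha> ^ (k - l) - 2 * e) * real n ^ (k - l) = (\<alpha> ^ (k - l) - e) * real n ^ (k - l) - e * real n ^ (k - l)"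
    by (simp add: algebra_simps)
  ultimately show ?thesis using large by linarith
qed

section \<open>The transfer function \<open>Phi\<close>\<close>

lemma floor_fraction_le:
  assumes "0 \<le> \<alpha>" shows "real (nat \<lfloor>\<alpha> * real n\<rfloor>) \<le> \<alpha> * real n"
  using assms by simp

text \<open>With a share b of the vertices in \<open>B\<close>, the two degree bounds 1 - (1 -
  \<beta>)(1 - b)^r and 1 - b^r are balanced, and \<open>Phi\<close> is their common value.\<close>

lemma Phi_transfer:
  assumes l: "1 \<le> l" "l < k" and \<beta>: "\<beta> \<in> degree_turan_spectrum k l"
  shows "Phi k l \<beta> \<in> degree_turan_spectrum k l"
proof (cases "\<beta> = 1")
  case True
  \<comment> \<open>The bounds on the density do not exclude 1. There \<open>0 powr _\<close> is 0
    by convention, so the value of \<open>Phi\<close> is 0.\<close>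
  then show ?thesis using zero_in_degree_turan_spectrum[OF l(2)] by (simp add: Phi_def)
next
  case False
  define r where "r = k - l"
  have r: "0 < r" "1 \<le> r" using l by (simp_all add: r_def)
  from \<beta> obtain F where F: "kgraph k F" "edges F \<noteq> {}" "\<beta> = degree_turan_density k l F"
    unfolding degree_turan_spectrum_def nonempty_hypergraph_def by blast
  have \<beta>01: "0 \<le> \<beta>" "\<beta> < 1"
    using degree_turan_density_bounds[OF F(2) l(2)] False F(3) by auto
  \<comment> \<open>Taking r-th roots in (1 - \<beta>)(1 - b)^r = b^r gives z (1 - b) = b, hence b =
    z / (1 + z).\<close>
  define z where "z = root r (1 - \<beta>)"
  have z: "0 < z" "z ^ r = 1 - \<beta>"
    using r \<beta>01 by (simp_all add: z_def real_root_gt_zero)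
  define b where "b = z / (1 + z)"
  have b: "0 < b" "b < 1" "1 - b = 1 / (1 + z)" using z(1) by (simp_all add: b_def field_simps)
  have bal: "(1 - \<beta>) * (1 - b) ^ r = b ^ r"
    unfolding b(3) z(2)[symmetric] by (simp add: b_def power_divide)
  have Phi_eq: "Phi k l \<beta> = 1 - b ^ r"
  proof -
    have "(1 - \<beta>) powr (- 1 / real r) = 1 / z"
    proof -
      have "z = (1 - \<beta>) powr (1 / real r)" unfolding z_def using r \<beta>01 by (simp add: root_powr_inverse)
      then show ?thesis by (simp add: powr_minus_divide)
    qed
    then have "Phi k l \<beta> = 1 - (1 + 1 / z) powr (- real r)" by (simp add: Phi_def r_def)
    also have "(1 + 1 / z) powr (- real r) = 1 / (1 + 1 / z) ^ r"
    proof -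
      have "0 < 1 + 1 / z" using z(1) by (simp add: add_pos_pos)
      then show ?thesis by (simp add: powr_minus_divide powr_realpow)
    qed
    also have "\<dots> = b ^ r" using z(1) by (simp add: b_def field_simps flip: power_divide power_one_over)
    finally show ?thesis .
  qed
  have k1: "k - 1 < k" using l by simp
  obtain T :: "nat hypergraph" where T: "kgraph k T" "edges T \<noteq> {}"
    "\<And>H :: nat hypergraph. embeds T H \<longleftrightarrow> embeds (tree_hypergraph k (k - 1) F) H"
    using nat_tree_hypergraph[OF F(1,2) k1] by blast
  have lower: "1 - b ^ r \<le> degree_turan_density k l T"
  proof (rule degree_turan_density_ge_host[OF F(1,2) verts_nonempty[OF F(1,2)] l(2) k1 T(2,3), where \<alpha> = "1 - b"])
    show "0 < k" "0 < 1 - b" "1 - b \<le> 1" using l b(1,2) by simp_all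
    fix \<epsilon> :: real assume "0 < \<epsilon>"
    define e where "e = \<epsilon> / 2"
    have e: "0 < e" using \<open>0 < \<epsilon>\<close> by (simp add: e_def)
    have "\<forall>\<^sub>F n in sequentially. host_dense k l (k - 1) (1 - b) (degree_turan_density k l F - e) (1 - b ^ r - \<epsilon>) n"
      using eventually_choose_ge[OF e r(2), of l]
        eventually_cofloor_power_le[of "1 - b" e r, OF less_imp_le[OF \<open>0 < 1 - b\<close>] \<open>1 - b \<le> 1\<close> e]
    proof eventually_elim
      case (elim n)
      show ?case
        unfolding host_dense_def
      proof (intro allI impI, rule ldenseI)
        fix G :: "nat hypergraph" and B S
        assume G: "kgraph k G" "card (verts G) = nat \<lfloor>(1 - b) * real n\<rfloor>" "finite B" "verts G \<inter> B = {}"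
          "card B = n - card (verts G)" "card (verts G) + card B = n"
          "ldense k l (degree_turan_density k l F - e) G"
          and S: "S \<subseteq> verts (host k (k - 1) G B)" "card S = l"
        have fin: "finite (verts G)" using G(1) by (simp add: kgraph_def)
        have cV: "card (verts (host k (k - 1) G B)) = n"
          using card_Un_disjoint[OF fin G(3,4)] G(6) by simp
        have large: "real n ^ r - e * real n ^ r \<le> fact r * real ((n - l) choose r)"
          using elim(1) by blast
        have "(1 - b ^ r - \<epsilon>) * real n ^ r \<le> fact r * real (set_degree (host k (k - 1) G B) S)"
        proof (cases "S \<subseteq> verts G")
          case True
          have "(1 - (1 - \<beta>) * (1 - b) ^ (k - l) - 2 * e) * real n ^ (k - l)
              \<le> fact (k - l) * real (set_degree (host k (k - 1) G B) S)"
          proof (rule host_degree_inside_ge[OF G(1,3,4) True S(2) l])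
            show "real (card (verts G)) \<le> (1 - b) * real n"
              unfolding G(2) using b(2) by (intro floor_fraction_le) simp
          qed (use l b(1,2) \<beta>01 e G F(3) large in \<open>auto simp: r_def\<close>)
          then show ?thesis unfolding r_def[symmetric] bal by (simp add: e_def)
        next
          case False
          have "real ((card (verts G) + card B - l) choose r) \<le> real (set_degree (host k (k - 1) G B) S + (card B choose r))"
            using set_degree_host_outside_full[OF G(1,3,4) _ False S(2) l(2)] S(1)
            unfolding r_def by (simp only: of_nat_le_iff verts_host)
          then have "fact r * real ((n - l) choose r) \<le> fact r * (real (set_degree (host k (k - 1) G B) S) + real (card B choose r))"
            using G(6) by (intro mult_left_mono) auto
          moreover have "fact r * real (card B choose r) \<le> real (card B) ^ r" by (rule fact_mult_choose_le)
          moreover have "real (card B) ^ r \<le> (b ^ r + e) * real n ^ r" using elim(2) G(2,5) by simp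
          ultimately show ?thesis using large by (simp add: e_def algebra_simps)
        qed
        then show "(1 - b ^ r - \<epsilon>) * real (card (verts (host k (k - 1) G B))) ^ (k - l)
           \<le> fact (k - l) * real (set_degree (host k (k - 1) G B) S)"
          unfolding cV r_def[symmetric] .
      qed
    qed
    with e show "\<exists>\<delta>>0. \<forall>\<^sub>F n in sequentially. host_dense k l (k - 1) (1 - b) (degree_turan_density k l F - \<delta>) (1 - b ^ r - \<epsilon>) n"
      by (intro exI[of _ e] conjI)
  qed
  have upper: "degree_turan_density k l T \<le> 1 - b ^ r"
  proof (rule degree_turan_density_le[OF T(2) l(2)])
    show "1 - b ^ r < 1" using b by simp
    fix c :: real assume c: "1 - b ^ r < c" "c < 1"
    \<comment> \<open>The r-th power is the midpoint of 1 - c and b^r. So b' still exceeds the bound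
      needed at level l, and b - b' leaves room for the constantly many used vertices.\<close>
    define b' where "b' = root r ((1 - c + b ^ r) / 2)"
    have pos: "0 < (1 - c + b ^ r) / 2" using c(2) b(1) by (simp add: add_pos_pos)
    have b': "0 < b'" "b' ^ r = (1 - c + b ^ r) / 2"
      using r pos by (simp_all add: b'_def real_root_gt_zero)
    have "b' ^ r < b ^ r" using c b'(2) by simp
    then have bb: "b' < b" using power_less_imp_less_base[of b' r b] b(1) by simp
    have c': "1 - c < b' ^ (k - l)" using c b'(2) by (simp add: r_def)
    define M where "M = real (card (verts (tree_hypergraph k (k - 1) F)))"
    have "\<forall>\<^sub>F n in sequentially. M / (b - b') \<le> real n"
      by (metis eventually_at_top_linorderI filterlim_at_top filterlim_real_sequentially)
    \<comment> \<open>The balance equation turns 1 - c < b^r into the condition under which sets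
      with a share 1 - b of the vertices contain \<open>F\<close>.\<close>
    moreover have "\<forall>\<^sub>F n in sequentially. \<forall>H :: nat hypergraph. kgraph k H \<longrightarrow> card (verts H) = n \<longrightarrow>
        ldense k l c H \<longrightarrow> (\<forall>A\<subseteq>verts H. (1 - b) * real n \<le> real (card A) \<longrightarrow> embeds F (induced H A))"
      by (rule eventually_dense_subset_embeds[OF F(2) l(2)])
        (use b(1,2) bal c F(3) in \<open>auto simp: r_def[symmetric]\<close>)
    ultimately show "\<forall>\<^sub>F n in sequentially. \<forall>H :: nat hypergraph.
      kgraph k H \<longrightarrow> card (verts H) = n \<longrightarrow> ldense k l c H \<longrightarrow> embeds T H"
      using eventually_gt_at_top[of 0]
    proof eventually_elim
      case (elim n)
      show ?case
      proof (intro allI impI)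
        fix H :: "nat hypergraph"
        assume H: "kgraph k H" "card (verts H) = n" "ldense k l c H"
        have "M \<le> (b - b') * real n" using elim(1) bb by (simp add: field_simps)
        then have size: "((1 - b) + b') * real n + M \<le> real n" by (simp add: algebra_simps)
        show "embeds T H"
          unfolding T(3)
        proof (rule embeds_tree_hypergraph_last[OF F(1) l H(1,3) b'(1) c'])
          show "0 < card (verts H)" using H(2) elim(3) by simp
          show "embeds F (induced H A)" if "A \<subseteq> verts H" "(1 - b) * real (card (verts H)) \<le> real (card A)" for A
            using elim(2)[rule_format, OF H that(1)] that(2) H(2) by simp
          show "((1 - b) + b') * real (card (verts H)) + real (card (verts (tree_hypergraph k (k - 1) F)))
            \<le> real (card (verts H))" using size H(2) by (simp add: M_def)
        qed
      qed
    qed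
  qed
  show ?thesis
    unfolding Phi_eq using degree_turan_spectrumI[OF T(1,2)] lower upper by (metis order_antisym)
qed

section \<open>The transfer function \<open>Psi\<close>\<close>

lemma eventually_link_sizes:
  fixes \<gamma> c :: real and M w :: nat
  assumes "0 \<le> \<gamma>" "\<gamma> < 1" "\<gamma> ^ r < c"
  shows "\<exists>\<eta>>0. \<forall>\<^sub>F n in sequentially. \<gamma> * real n + real M \<le> real n \<and>
    (\<gamma> * real n + real M) ^ r \<le> (c - fact r * \<eta>) * real n ^ r \<and>
    real (M + w) \<le> \<eta> * (1 / 2) ^ k * real n"
proof -
  \<comment> \<open>Subtracting r! \<eta> from c halves the gap above \<gamma>^r; the remaining half
    absorbs the constant \<open>M\<close>.\<close>
  define \<eta> where "\<eta> = (c - \<gamma> ^ r) / (2 * fact r)"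
  have \<eta>: "0 < \<eta>" using assms(3) by (simp add: \<eta>_def)
  have c: "c - fact r * \<eta> = (c + \<gamma> ^ r) / 2" by (simp add: \<eta>_def field_simps)
  have "(\<lambda>n. (\<gamma> + real M / real n) ^ r) \<longlonglongrightarrow> (\<gamma> + 0) ^ r"
    by (intro tendsto_power tendsto_add tendsto_const) real_asymp
  then have "\<forall>\<^sub>F n in sequentially. (\<gamma> + real M / real n) ^ r < c - fact r * \<eta>"
    unfolding c using assms(3) by (intro order_tendstoD(2)) auto
  moreover have "\<forall>\<^sub>F n in sequentially. real M / (1 - \<gamma>) \<le> real n"
    by (metis eventually_at_top_linorderI filterlim_at_top filterlim_real_sequentially)
  moreover have "\<forall>\<^sub>F n in sequentially. real (M + w) / (\<eta> * (1 / 2) ^ k) \<le> real n"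
    by (metis eventually_at_top_linorderI filterlim_at_top filterlim_real_sequentially)
  ultimately have "\<forall>\<^sub>F n in sequentially. \<gamma> * real n + real M \<le> real n \<and>
    (\<gamma> * real n + real M) ^ r \<le> (c - fact r * \<eta>) * real n ^ r \<and>
    real (M + w) \<le> \<eta> * (1 / 2) ^ k * real n"
    using eventually_gt_at_top[of 0]
  proof eventually_elim
    case (elim n)
    have n: "0 < real n" using elim(4) by simp
    have "real M \<le> (1 - \<gamma>) * real n" using elim(2) assms(2) by (simp add: field_simps)
    then have 1: "\<gamma> * real n + real M \<le> real n" by (simp add: algebra_simps)
    have "\<gamma> * real n + real M = (\<gamma> + real M / real n) * real n" using n by (simp add: field_simps)
    then have "(\<gamma> * real n + real M) ^ r = (\<gamma> + real M / real n) ^ r * real n ^ r"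
      by (simp only: power_mult_distrib)
    also have "\<dots> \<le> (c - fact r * \<eta>) * real n ^ r"
      using elim(1) by (intro mult_right_mono) auto
    finally have 2: "(\<gamma> * real n + real M) ^ r \<le> (c - fact r * \<eta>) * real n ^ r" .
    have "0 < \<eta> * (1 / 2) ^ k" using \<eta> by simp
    then have "real (M + w) \<le> \<eta> * (1 / 2) ^ k * real n"
      using elim(3) by (simp only: pos_divide_le_eq mult.commute[of "real n"])
    with 1 2 show ?case by simp
  qed
  with \<eta> show ?thesis by blast
qed

text \<open>Put a^r = x. Sets inside \<open>A\<close> have degree 1 - (1 - \<beta>) x, all others x,
  and \<open>Psi\<close> solves the equation between the two. The hypothesis k - l <= l is what the
  first value needs when t = l.\<close>

lemma Psi_transfer:
  assumes l: "1 \<le> l" "l < k" "k - l \<le> l" and \<beta>: "\<beta> \<in> degree_turan_spectrum k l"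
  shows "Psi \<beta> \<in> degree_turan_spectrum k l"
proof (cases "\<beta> = 1")
  case True
  then show ?thesis using \<beta> by (simp add: Psi_def)
next
  case False
  define r where "r = k - l"
  have r: "0 < r" "1 \<le> r" using l by (simp_all add: r_def)
  from \<beta> obtain F where F: "kgraph k F" "edges F \<noteq> {}" "\<beta> = degree_turan_density k l F"
    unfolding degree_turan_spectrum_def nonempty_hypergraph_def by blast
  have \<beta>01: "0 \<le> \<beta>" "\<beta> < 1"
    using degree_turan_density_bounds[OF F(2) l(2)] False F(3) by auto
  define x where "x = Psi \<beta>"
  have x: "0 < x" "x < 1" "1 - (1 - \<beta>) * x = x"
    using \<beta>01 by (simp_all add: x_def Psi_def field_simps)
  define a where "a = root r x"
  have a: "0 < a" "a ^ r = x" using r x(1) by (simp_all add: a_def real_root_gt_zero)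
  have a1: "a < 1"
  proof (rule ccontr)
    assume "\<not> a < 1"
    then have "1 \<le> a ^ r" by (simp add: one_le_power)
    then show False using a x by simp
  qed
  obtain T :: "nat hypergraph" where T: "kgraph k T" "edges T \<noteq> {}"
    "\<And>H :: nat hypergraph. embeds T H \<longleftrightarrow> embeds (tree_hypergraph k l F) H"
    using nat_tree_hypergraph[OF F(1,2) l(2)] by blast
  have lower: "x \<le> degree_turan_density k l T"
  proof (rule degree_turan_density_ge_host[OF F(1,2) verts_nonempty[OF F(1,2)] l(2) l(2) T(2,3), where \<alpha> = a])
    show "0 < k" "0 < a" "a \<le> 1" using l a a1 by simp_all
    fix \<epsilon> :: real assume "0 < \<epsilon>"
    define e where "e = \<epsilon> / 2"
    have e: "0 < e" using \<open>0 < \<epsilon>\<close> by (simp add: e_def)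
    have "\<forall>\<^sub>F n in sequentially. host_dense k l l a (degree_turan_density k l F - e) (x - \<epsilon>) n"
      using eventually_choose_ge[OF e r(2), of l] eventually_floor_power_ge[of a e r, OF less_imp_le[OF a(1)] e]
    proof eventually_elim
      case (elim n)
      show ?case
        unfolding host_dense_def
      proof (intro allI impI, rule ldenseI)
        fix G :: "nat hypergraph" and B S
        assume G: "kgraph k G" "card (verts G) = nat \<lfloor>a * real n\<rfloor>" "finite B" "verts G \<inter> B = {}"
          "card B = n - card (verts G)" "card (verts G) + card B = n"
          "ldense k l (degree_turan_density k l F - e) G"
          and S: "S \<subseteq> verts (host k l G B)" "card S = l"
        have fin: "finite (verts G)" using G(1) by (simp add: kgraph_def)
        have cV: "card (verts (host k l G B)) = n"
          using card_Un_disjoint[OF fin G(3,4)] G(6) by simp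
        have large: "real m ^ r - e * real n ^ r \<le> fact r * real ((m - l) choose r)" if "m \<le> n" for m
          using elim(1) that by blast
        have "(x - 2 * e) * real n ^ (k - l) \<le> fact (k - l) * real (set_degree (host k l G B) S)"
        proof (cases "S \<subseteq> verts G")
          case True
          have "(1 - (1 - \<beta>) * a ^ (k - l) - 2 * e) * real n ^ (k - l)
              \<le> fact (k - l) * real (set_degree (host k l G B) S)"
          proof (rule host_degree_inside_ge[OF G(1,3,4) True S(2) l])
            show "real (card (verts G)) \<le> a * real n"
              unfolding G(2) using a by (intro floor_fraction_le) simp
          qed (use a a1 \<beta>01 e G F(3) large in \<open>auto simp: r_def\<close>)
          then show ?thesis using a(2) x(3) by (simp add: r_def)
        next
          case False
          have "(a ^ (k - l) - 2 * e) * real n ^ (k - l) \<le> fact (k - l) * real (set_degree (host k l G B) S)"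
          proof (rule host_degree_outside_ge[OF G(1,3,4) _ False S(2) l(2) order_refl])
            show "S \<subseteq> verts G \<union> B" using S(1) by simp
            show "real (card (verts G)) ^ (k - l) - e * real n ^ (k - l)
              \<le> fact (k - l) * real (card (verts G) - l choose (k - l))"
              using large[of "card (verts G)"] G(6) by (simp add: r_def)
            show "(a ^ (k - l) - e) * real n ^ (k - l) \<le> real (card (verts G)) ^ (k - l)"
              using elim(2) G(2) by (simp add: r_def)
          qed
          then show ?thesis using a(2) by (simp add: r_def)
        qed
        then show "(x - \<epsilon>) * real (card (verts (host k l G B))) ^ (k - l)
           \<le> fact (k - l) * real (set_degree (host k l G B) S)"
          unfolding cV by (simp add: e_def)
      qed
    qed
    with e show "\<exists>\<delta>>0. \<forall>\<^sub>F n in sequentially. host_dense k l l a (degree_turan_density k l F - \<delta>) (x - \<epsilon>) n"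
      by (intro exI[of _ e] conjI)
  qed
  have upper: "degree_turan_density k l T \<le> x"
  proof (rule degree_turan_density_le[OF T(2) l(2) x(2)])
    fix c :: real assume c: "x < c" "c < 1"
    \<comment> \<open>The inequality c > x is used twice: the link of an l-set spans more than a
      share a of the vertices, and by 1 - x = (1 - \<beta>) x every set of that size contains
      \<open>F\<close>.\<close>
    have "a ^ (k - l) < c" using a(2) c by (simp add: r_def)
    from eventually_link_sizes[OF less_imp_le[OF a(1)] a1 this] obtain \<eta> where \<eta>: "0 < \<eta>" and
      sizes: "\<forall>\<^sub>F n in sequentially. a * real n + real (card (verts (tree_hypergraph k l F))) \<le> real n \<and>
        (a * real n + real (card (verts (tree_hypergraph k l F)))) ^ (k - l)
           \<le> (c - fact (k - l) * \<eta>) * real n ^ (k - l) \<and>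
        real (card (verts (tree_hypergraph k l F)) + card (verts F)) \<le> \<eta> * (1 / 2) ^ k * real n"
      by blast
    have "1 - c < (1 - degree_turan_density k l F) * a ^ (k - l)"
      using a(2) x(3) c(1) F(3) by (simp add: r_def)
    from eventually_dense_subset_embeds[OF F(2) l(2) a(1) this] sizes eventually_gt_at_top[of 0]
    show "\<forall>\<^sub>F n in sequentially. \<forall>H :: nat hypergraph.
      kgraph k H \<longrightarrow> card (verts H) = n \<longrightarrow> ldense k l c H \<longrightarrow> embeds T H"
    proof eventually_elim
      case (elim n)
      show ?case
      proof (intro allI impI)
        fix H :: "nat hypergraph"
        assume H: "kgraph k H" "card (verts H) = n" "ldense k l c H"
        show "embeds T H"
          unfolding T(3)
        proof (rule embeds_tree_hypergraph_link[OF F(1) l(2) H(1,3) \<eta>, where \<gamma> = a])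
          show "embeds F (induced H A)" if "A \<subseteq> verts H" "a * real (card (verts H)) \<le> real (card A)" for A
            using elim(1)[rule_format, OF H that(1)] that(2) H(2) by simp
        qed (use elim(2,3) H(2) a in auto)
      qed
    qed
  qed
  show ?thesis
    unfolding x_def[symmetric] using degree_turan_spectrumI[OF T(1,2)] lower upper by (metis order_antisym)
qed

section \<open>The transfer function \<open>Upsilon\<close>\<close>

lemma weighted_power_mean:
  fixes x y :: real
  assumes "0 < x" "0 \<le> y" "0 < k"
  shows "real k * y * x ^ (k - 1) \<le> (real k - 1) * x ^ k + y ^ k"
proof -
  \<comment> \<open>Weighted AM-GM for k - 1 copies of x^k and one of y^k is Bernoulli's inequality
    at y/x - 1.\<close>
  have "1 + real k * (y / x - 1) \<le> (1 + (y / x - 1)) ^ k"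
    by (rule Bernoulli_inequality) (use assms in auto)
  then have "x ^ k * (1 + real k * (y / x - 1)) \<le> x ^ k * (y / x) ^ k"
    using assms by simp
  also have "\<dots> = y ^ k" using assms by (simp add: power_divide)
  also have "x ^ k * (1 + real k * (y / x - 1)) = x ^ k - real k * x ^ k + real k * y * x ^ (k - 1)"
    using assms by (cases k) (auto simp: field_simps)
  finally show ?thesis by (simp add: algebra_simps)
qed

text \<open>With \<open>a = (k - 1) / (k - \<beta>)\<close> this says that \<open>(k x - (k - 1)) / x ^ k\<close> is decreasing on
  \<open>[a, 1]\<close>.\<close>

lemma Upsilon_optimal:
  fixes a \<beta> x :: real
  assumes "0 < k" "0 < a" "a \<le> x" "x \<le> 1" and \<beta>: "a * (real k - \<beta>) = real k - 1"
  shows "\<beta> * x ^ k \<le> (real k * x - (real k - 1)) * a ^ (k - 1)"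
proof -
  obtain j where j: "k = Suc j" using \<open>0 < k\<close> by (cases k) auto
  have x: "0 < x" using assms by linarith
  have "real k * a * x ^ j \<le> (real k - 1) * x ^ k + a ^ k"
    using weighted_power_mean[OF x less_imp_le[OF \<open>0 < a\<close>] \<open>0 < k\<close>] by (simp add: j)
  moreover have "a ^ j \<le> x ^ j" using assms by (intro power_mono) auto
  \<comment> \<open>Here x <= 1 lowers the degree by one, so that the AM-GM inequality above closes
    the estimate.\<close>
  then have "real k * a * (x * (x ^ j - a ^ j)) \<le> real k * a * (1 * (x ^ j - a ^ j))"
    using assms by (intro mult_left_mono mult_right_mono) auto
  ultimately have "(real k * a - (real k - 1)) * x ^ k \<le> (real k * x - (real k - 1)) * a ^ k"
    by (simp add: j algebra_simps)
  moreover have "real k * a - (real k - 1) = a * \<beta>" using \<beta> by (simp add: algebra_simps)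
  ultimately have "(a * \<beta>) * x ^ k \<le> (real k * x - (real k - 1)) * a ^ k" by (simp only:)
  also have "a ^ k = a * a ^ j" by (simp add: j)
  finally have "a * (\<beta> * x ^ k) \<le> a * ((real k * x - (real k - 1)) * a ^ j)"
    by (simp only: mult.assoc mult.left_commute[of _ a])
  then show ?thesis using \<open>0 < a\<close> by (simp add: j)
qed

text \<open>The degree sum over \<open>A\<close> counts an edge k times if it lies inside
  \<open>A\<close> and at most k - 1 times otherwise. An \<open>F\<close>-free \<open>A\<close> has
  few inner edges, which limits its degrees.\<close>

lemma sum_degrees_inside_le:
  assumes H: "kgraph k H" and A: "A \<subseteq> verts H"
  shows "(\<Sum>v\<in>A. set_degree H {v}) + card (edges H) \<le> card (edges (induced H A)) + k * card (edges H)"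
proof -
  have fin: "finite (verts H)" "finite (edges H)"
    using H finite_edges[OF H] by (auto simp: kgraph_def)
  have "edges H \<subseteq> edges (induced H A) \<union> (\<Union>v\<in>verts H - A. {e \<in> edges H. {v} \<subseteq> e})"
  proof
    fix e assume e: "e \<in> edges H"
    then have "e \<subseteq> verts H" using H by (simp add: kgraph_def)
    then show "e \<in> edges (induced H A) \<union> (\<Union>v\<in>verts H - A. {e \<in> edges H. {v} \<subseteq> e})"
      using e by auto
  qed
  then have "card (edges H) \<le> card (edges (induced H A) \<union> (\<Union>v\<in>verts H - A. {e \<in> edges H. {v} \<subseteq> e}))"
    by (rule card_mono[rotated]) (use fin in auto)
  also have "\<dots> \<le> card (edges (induced H A)) + card (\<Union>v\<in>verts H - A. {e \<in> edges H. {v} \<subseteq> e})"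
    by (rule card_Un_le)
  also have "card (\<Union>v\<in>verts H - A. {e \<in> edges H. {v} \<subseteq> e}) \<le> (\<Sum>v\<in>verts H - A. set_degree H {v})"
    unfolding set_degree_def by (rule card_UN_le) (use fin in simp)
  finally have "card (edges H) \<le> card (edges (induced H A)) + (\<Sum>v\<in>verts H - A. set_degree H {v})" by simp
  moreover have "(\<Sum>v\<in>verts H. set_degree H {v}) = (\<Sum>v\<in>verts H - A. set_degree H {v}) + (\<Sum>v\<in>A. set_degree H {v})"
    by (rule sum.subset_diff[OF A fin(1)])
  ultimately show ?thesis using sum_degrees[OF H] by linarith
qed

text \<open>Edges inside \<open>verts G\<close> contribute \<beta> a^(k-1), and those with one
  vertex in \<open>B\<close> contribute (k-1)(1-a) a^(k-2). The first term is off by 2 e and the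
  second by 2 (k-1) e, in total 2 k e.\<close>

lemma host_degree_vertex_ge:
  fixes a e \<beta> :: real
  assumes G: "kgraph k G" "finite B" "verts G \<inter> B = {}" and v: "v \<in> verts G" and k: "1 < k"
    and n: "card (verts G) + card B = n" and a: "0 < a" "a < 1" "real (card (verts G)) \<le> a * real n"
    and \<beta>: "0 \<le> \<beta>" "\<beta> < 1" "a * (real k - \<beta>) = real k - 1" and e: "0 < e"
    and dense: "ldense k 1 (\<beta> - e) G"
    and large: "real (card (verts G)) ^ (k - 2) - e * real n ^ (k - 2)
        \<le> fact (k - 2) * real ((card (verts G) - 1) choose (k - 2))"
      "(a ^ (k - 2) - e) * real n ^ (k - 2) \<le> real (card (verts G)) ^ (k - 2)"
      "(a ^ (k - 1) - e) * real n ^ (k - 1) \<le> real (card (verts G)) ^ (k - 1)"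
  shows "(a ^ (k - 1) - 2 * real k * e) * real n ^ (k - 1) \<le> fact (k - 1) * real (set_degree (host k 1 G B) {v})"
proof -
  define j where "j = k - 2"
  have j: "k - 1 = Suc j" "k - 2 = j" "real k - 1 = real (Suc j)" using k by (simp_all add: j_def of_nat_diff)
  define A where "A = real (card (verts G))"
  define N where "N = real n"
  define C where "C = fact j * real ((card (verts G) - 1) choose j)"
  have AN: "0 \<le> A" "A \<le> a * N" "A \<le> N" "0 \<le> N" "real (card B) = N - A"
    using a n by (auto simp: A_def N_def)
  have "real (set_degree G {v} + card B * ((card (verts G) - 1) choose j)) \<le> real (set_degree (host k 1 G B) {v})"
    using set_degree_host_vertex[OF G v k order_refl] unfolding j by (simp only: of_nat_le_iff)
  then have "fact (Suc j) * (real (set_degree G {v}) + real (card B) * real ((card (verts G) - 1) choose j))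
     \<le> fact (Suc j) * real (set_degree (host k 1 G B) {v})"
    by (intro mult_left_mono) auto
  moreover have "fact (Suc j) * (real (set_degree G {v}) + real (card B) * real ((card (verts G) - 1) choose j))
      = fact (Suc j) * real (set_degree G {v}) + (real k - 1) * ((N - A) * C)"
    unfolding AN(5)[symmetric] j(3) C_def by (simp add: algebra_simps)
  moreover have "(\<beta> - e) * A ^ Suc j \<le> fact (Suc j) * real (set_degree G {v})"
    unfolding A_def j(1)[symmetric] by (rule ldenseD[OF dense]) (use v in auto)
  ultimately have 1: "(\<beta> - e) * A ^ Suc j + (real k - 1) * ((N - A) * C)
      \<le> fact (Suc j) * real (set_degree (host k 1 G B) {v})"
    by linarith
  have "(N - A) * (A ^ j - e * N ^ j) \<le> (N - A) * C"
    using large(1) AN by (intro mult_left_mono) (auto simp: C_def A_def N_def j)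
  moreover have "(N - A) * (e * N ^ j) \<le> N * (e * N ^ j)"
    using AN e by (intro mult_right_mono) auto
  moreover have "((1 - a) * N) * ((a ^ j - e) * N ^ j) \<le> (N - A) * A ^ j"
  proof -
    have "((1 - a) * N) * ((a ^ j - e) * N ^ j) \<le> ((1 - a) * N) * A ^ j"
      using large(2) a AN by (intro mult_left_mono) (auto simp: A_def N_def j)
    also have "\<dots> \<le> (N - A) * A ^ j"
      using AN by (intro mult_right_mono) (auto simp: algebra_simps)
    finally show ?thesis .
  qed
  moreover have "(1 - a) * e * N ^ Suc j \<le> 1 * e * N ^ Suc j"
    using a e AN by (intro mult_right_mono) auto
  ultimately have "((1 - a) * a ^ j - 2 * e) * N ^ Suc j \<le> (N - A) * C"
    by (simp add: algebra_simps)
  then have 2: "(real k - 1) * (((1 - a) * a ^ j - 2 * e) * N ^ Suc j) \<le> (real k - 1) * ((N - A) * C)"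
    using k by (intro mult_left_mono) auto
  have "\<beta> * ((a ^ Suc j - e) * N ^ Suc j) \<le> \<beta> * A ^ Suc j"
    using large(3)[unfolded j(1)] \<beta>(1) unfolding A_def N_def by (rule mult_left_mono)
  moreover have "\<beta> * (e * N ^ Suc j) \<le> 1 * (e * N ^ Suc j)"
    using \<beta> e AN by (intro mult_right_mono) auto
  moreover have "e * A ^ Suc j \<le> e * N ^ Suc j"
    using AN e by (intro mult_left_mono power_mono) auto
  ultimately have 3: "(\<beta> * a ^ Suc j - 2 * e) * N ^ Suc j \<le> (\<beta> - e) * A ^ Suc j"
    by (simp add: algebra_simps)
  have "\<beta> * a ^ Suc j + (real k - 1) * ((1 - a) * a ^ j) = (\<beta> * a + (real k - 1) * (1 - a)) * a ^ j"
    by (simp add: algebra_simps)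
  \<comment> \<open>This is where the choice of a enters: the inside degree becomes a^(k-1), the
    degree of a vertex of \<open>B\<close>.\<close>
  also have "\<beta> * a + (real k - 1) * (1 - a) = a" using \<beta>(3) by (simp add: algebra_simps)
  finally have eq: "\<beta> * a ^ Suc j + (real k - 1) * ((1 - a) * a ^ j) = a ^ Suc j" by simp
  have "(\<beta> * a ^ Suc j - 2 * e) * N ^ Suc j + (real k - 1) * (((1 - a) * a ^ j - 2 * e) * N ^ Suc j)
     = (\<beta> * a ^ Suc j + (real k - 1) * ((1 - a) * a ^ j) - 2 * real k * e) * N ^ Suc j"
    by (simp add: algebra_simps)
  also have "\<dots> = (a ^ Suc j - 2 * real k * e) * N ^ Suc j" unfolding eq ..
  finally have "(\<beta> * a ^ Suc j - 2 * e) * N ^ Suc j + (real k - 1) * (((1 - a) * a ^ j - 2 * e) * N ^ Suc j)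
     = (a ^ Suc j - 2 * real k * e) * N ^ Suc j" .
  with 1 2 3 show ?thesis unfolding j N_def[symmetric] by linarith
qed

text \<open>For the upper bound an assumed gap \<delta> > x is exploited. A nearly extremal
  \<open>T\<close>-free host has all degrees at least about \<delta>, yet its average is at most
  about \<delta>. An \<open>F\<close>-free part of relative size \<alpha> would give (k \<alpha> -
  (k-1)) \<delta> <= \<beta> \<alpha>^k up to errors, which \<open>Upsilon_optimal\<close> refutes
  for \<alpha> > a; so all such parts contain \<open>F\<close>, and then the tree embeds.\<close>

lemma Upsilon_transfer:
  assumes k: "1 < k" and \<beta>: "\<beta> \<in> degree_turan_spectrum k 1"
  shows "Upsilon k \<beta> \<in> degree_turan_spectrum k 1"
proof (cases "\<beta> = 1")
  case True
  \<comment> \<open>The value 1 is a fixed point of \<open>Upsilon\<close>.\<close>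
  then show ?thesis using \<beta> k by (simp add: Upsilon_def)
next
  case False
  from \<beta> obtain F where F: "kgraph k F" "edges F \<noteq> {}" "\<beta> = degree_turan_density k 1 F"
    unfolding degree_turan_spectrum_def nonempty_hypergraph_def by blast
  have \<beta>01: "0 \<le> \<beta>" "\<beta> < 1"
    using degree_turan_density_bounds[OF F(2) k] False F(3) by auto
  have k1: "1 \<le> k - 1" using k by simp
  define a where "a = (real k - 1) / (real k - \<beta>)"
  have a: "0 < a" "a < 1" "a * (real k - \<beta>) = real k - 1"
    using k \<beta>01 by (simp_all add: a_def)
  define x where "x = a ^ (k - 1)"
  have x_eq: "Upsilon k \<beta> = x" by (simp add: Upsilon_def x_def a_def)
  have x: "0 < x" "x < 1"
    using a k power_strict_mono[of a 1 "k - 1"] by (simp_all add: x_def)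
  obtain T :: "nat hypergraph" where T: "kgraph k T" "edges T \<noteq> {}"
    "\<And>H :: nat hypergraph. embeds T H \<longleftrightarrow> embeds (tree_hypergraph k 1 F) H"
    using nat_tree_hypergraph[OF F(1,2) k] by blast
  define \<delta> where "\<delta> = degree_turan_density k 1 T"
  have lower: "x \<le> \<delta>"
    unfolding \<delta>_def
  proof (rule degree_turan_density_ge_host[OF F(1,2) verts_nonempty[OF F(1,2)] k k T(2,3), where \<alpha> = a])
    show "0 < k" "0 < a" "a \<le> 1" using k a by simp_all
    fix \<epsilon> :: real assume "0 < \<epsilon>"
    define e where "e = \<epsilon> / (2 * real k)"
    have e: "0 < e" "2 * real k * e = \<epsilon>" using \<open>0 < \<epsilon>\<close> k by (simp_all add: e_def)
    have "\<forall>\<^sub>F n in sequentially. host_dense k 1 1 a (degree_turan_density k 1 F - e) (x - \<epsilon>) n"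
      using eventually_choose_ge'[OF e(1), of "k - 2" 1] eventually_choose_ge[OF e(1) k1, of 1]
        eventually_floor_power_ge[of a e "k - 2", OF less_imp_le[OF a(1)] e(1)]
        eventually_floor_power_ge[of a e "k - 1", OF less_imp_le[OF a(1)] e(1)]
    proof eventually_elim
      case (elim n)
      show ?case
        unfolding host_dense_def
      proof (intro allI impI, rule ldenseI)
        fix G :: "nat hypergraph" and B S
        assume G: "kgraph k G" "card (verts G) = nat \<lfloor>a * real n\<rfloor>" "finite B" "verts G \<inter> B = {}"
          "card B = n - card (verts G)" "card (verts G) + card B = n"
          "ldense k 1 (degree_turan_density k 1 F - e) G"
          and S: "S \<subseteq> verts (host k 1 G B)" "card S = 1"
        have fin: "finite (verts G)" using G(1) by (simp add: kgraph_def)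
        have cV: "card (verts (host k 1 G B)) = n"
          using card_Un_disjoint[OF fin G(3,4)] G(6) by simp
        have le: "card (verts G) \<le> n" using G(6) by simp
        have le_a: "real (card (verts G)) \<le> a * real n"
          unfolding G(2) using a by (intro floor_fraction_le) simp
        have "(x - \<epsilon>) * real n ^ (k - 1) \<le> fact (k - 1) * real (set_degree (host k 1 G B) S)"
        proof (cases "S \<subseteq> verts G")
          case True
          obtain v where v: "S = {v}" using S(2) card_1_singletonE by metis
          then have "v \<in> verts G" using True by simp
          from host_degree_vertex_ge[OF G(1,3,4) this k G(6) a(1,2) le_a \<beta>01 a(3) e(1)]
          have "(a ^ (k - 1) - 2 * real k * e) * real n ^ (k - 1) \<le> fact (k - 1) * real (set_degree (host k 1 G B) {v})"
            using G(7) F(3) elim(1)[rule_format, OF le] elim(3,4) G(2) by simp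
          then show ?thesis unfolding v x_def e(2) .
        next
          case False
          have "(a ^ (k - 1) - 2 * e) * real n ^ (k - 1) \<le> fact (k - 1) * real (set_degree (host k 1 G B) S)"
          proof (rule host_degree_outside_ge[OF G(1,3,4) _ False S(2) k order_refl])
            show "S \<subseteq> verts G \<union> B" using S(1) by simp
            show "real (card (verts G)) ^ (k - 1) - e * real n ^ (k - 1)
              \<le> fact (k - 1) * real (card (verts G) - 1 choose (k - 1))"
              using elim(2)[rule_format, OF le] .
            show "(a ^ (k - 1) - e) * real n ^ (k - 1) \<le> real (card (verts G)) ^ (k - 1)"
              using elim(4) G(2) by simp
          qed
          moreover have "(x - \<epsilon>) * real n ^ (k - 1) \<le> (a ^ (k - 1) - 2 * e) * real n ^ (k - 1)"
          proof (rule mult_right_mono)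
            have "2 * 1 * e \<le> 2 * real k * e" using k e(1) by (intro mult_right_mono mult_left_mono) auto
            then show "x - \<epsilon> \<le> a ^ (k - 1) - 2 * e" using e(2) by (simp add: x_def)
          qed simp
          ultimately show ?thesis by linarith
        qed
        then show "(x - \<epsilon>) * real (card (verts (host k 1 G B))) ^ (k - 1)
           \<le> fact (k - 1) * real (set_degree (host k 1 G B) S)"
          unfolding cV .
      qed
    qed
    with e(1) show "\<exists>\<delta>>0. \<forall>\<^sub>F n in sequentially. host_dense k 1 1 a (degree_turan_density k 1 F - \<delta>) (x - \<epsilon>) n"
      by (intro exI[of _ e] conjI)
  qed
  have upper: "\<delta> \<le> x"
  proof (rule ccontr)
    assume "\<not> \<delta> \<le> x"
    then have gap: "x < \<delta>" by simp
    have \<delta>1: "\<delta> \<le> 1" unfolding \<delta>_def by (rule degree_turan_density_bounds(2)[OF T(2) k])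
    \<comment> \<open>The power is the midpoint of x and \<delta>: a' exceeds a, which makes the
      edge count strict, while a'^(k-1) stays below \<delta>, as the link argument requires.\<close>
    define a' where "a' = root (k - 1) ((x + \<delta>) / 2)"
    have a': "0 < a'" "a' ^ (k - 1) = (x + \<delta>) / 2"
      using k gap x by (simp_all add: a'_def real_root_gt_zero)
    have aa': "a < a'"
      using power_less_imp_less_base[of a "k - 1" a'] a'(1,2) gap by (simp add: x_def)
    have a'1: "a' < 1"
      using power_less_imp_less_base[of a' "k - 1" 1] a'(2) x(2) \<delta>1 by simp
    \<comment> \<open>The count below has main term k (a' - a)(\<delta> - x) and error 2 k
      \<epsilon>; this choice makes the error half of the main term.\<close>
    define \<epsilon> where "\<epsilon> = (a' - a) * (\<delta> - x) / 4"
    have \<epsilon>: "0 < \<epsilon>" using aa' gap by (simp add: \<epsilon>_def)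
    have "(a' - a) * (\<delta> - x) \<le> 1 * (\<delta> - x)"
      using aa' a'1 a(1) gap by (intro mult_right_mono) auto
    then have c: "a' ^ (k - 1) < \<delta> - \<epsilon>" using gap unfolding a'(2) \<epsilon>_def by (simp add: field_simps)
    have "degree_turan_density k 1 F < \<beta> + \<epsilon>" using \<epsilon> F(3) by simp
    from eventually_card_edges_le[OF F(2) k this] obtain N where
      N: "\<forall>m\<ge>N. \<forall>H :: nat hypergraph. kgraph k H \<longrightarrow> card (verts H) = m \<longrightarrow> \<not> embeds F H \<longrightarrow>
         fact k * real (card (edges H)) \<le> (\<beta> + \<epsilon>) * real m ^ k"
      unfolding eventually_sequentially by (elim exE)
    from eventually_link_sizes[OF less_imp_le[OF a'(1)] a'1 c] obtain \<eta> where \<eta>: "0 < \<eta>" and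
      sizes: "\<forall>\<^sub>F n in sequentially. a' * real n + real (card (verts (tree_hypergraph k 1 F))) \<le> real n \<and>
        (a' * real n + real (card (verts (tree_hypergraph k 1 F)))) ^ (k - 1)
           \<le> (\<delta> - \<epsilon> - fact (k - 1) * \<eta>) * real n ^ (k - 1) \<and>
        real (card (verts (tree_hypergraph k 1 F)) + card (verts F)) \<le> \<eta> * (1 / 2) ^ k * real n"
      by blast
    have 1: "\<forall>\<^sub>F n in sequentially. \<exists>H :: nat hypergraph.
        kgraph k H \<and> card (verts H) = n \<and> \<not> embeds T H \<and> ldense k 1 (\<delta> - \<epsilon>) H"
      by (rule eventually_free_below_density[OF T(2) k]) (use \<epsilon> in \<open>simp add: \<delta>_def\<close>)
    have 2: "\<forall>\<^sub>F n in sequentially. \<forall>H :: nat hypergraph. kgraph k H \<longrightarrow> card (verts H) = n \<longrightarrow>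
        \<not> embeds T H \<longrightarrow> fact k * real (card (edges H)) \<le> (\<delta> + \<epsilon>) * real n ^ k"
      by (rule eventually_card_edges_le[OF T(2) k]) (use \<epsilon> in \<open>simp add: \<delta>_def\<close>)
    have 3: "\<forall>\<^sub>F n in sequentially. real N / a' \<le> real n"
      by (metis eventually_at_top_linorderI filterlim_at_top filterlim_real_sequentially)
    \<comment> \<open>A single large n at which all the statements hold gives the contradiction,
      since the filter is proper.\<close>
    have "\<forall>\<^sub>F n in sequentially. False"
      using 1 2 3 sizes eventually_gt_at_top[of 0]
    proof eventually_elim
      case (elim n)
      from elim(1) obtain H :: "nat hypergraph" where
        H: "kgraph k H" "card (verts H) = n" "\<not> embeds T H" "ldense k 1 (\<delta> - \<epsilon>) H" by (elim exE conjE)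
      have fin: "finite (verts H)" using H(1) by (simp add: kgraph_def)
      have n0: "0 < real n" using elim(5) by simp
      have edges_H: "fact k * real (card (edges H)) \<le> (\<delta> + \<epsilon>) * real n ^ k"
        using elim(2)[rule_format, OF H(1,2,3)] .
      have sub: "embeds F (induced H A)" if A: "A \<subseteq> verts H" "a' * real (card (verts H)) \<le> real (card A)" for A
      proof (rule ccontr)
        assume free: "\<not> embeds F (induced H A)"
        define \<alpha> where "\<alpha> = real (card A) / real n"
        have \<alpha>: "a' \<le> \<alpha>" "\<alpha> \<le> 1" "real (card A) = \<alpha> * real n"
          using A n0 H(2) card_mono[OF fin A(1)] by (simp_all add: \<alpha>_def field_simps)
        have "real N \<le> a' * real n" using elim(3) a'(1) by (simp add: field_simps)
        then have "N \<le> card A" using A(2) H(2) by simp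
        have "fact k * real (card (edges (induced H A))) \<le> (\<beta> + \<epsilon>) * real (card A) ^ k"
          using N[rule_format, OF \<open>N \<le> card A\<close> kgraph_induced[OF H(1) A(1)] _ free] by simp
        then have eA: "fact k * real (card (edges (induced H A))) \<le> (\<beta> + \<epsilon>) * \<alpha> ^ k * real n ^ k"
          unfolding \<alpha>(3) by (simp add: power_mult_distrib)
        have "(\<Sum>v\<in>A. (\<delta> - \<epsilon>) * real n ^ (k - 1)) \<le> (\<Sum>v\<in>A. fact (k - 1) * real (set_degree H {v}))"
          by (rule sum_mono, rule ldenseD[OF H(4), unfolded H(2)]) (use A(1) in auto)
        then have "real (card A) * ((\<delta> - \<epsilon>) * real n ^ (k - 1)) \<le> fact (k - 1) * (\<Sum>v\<in>A. real (set_degree H {v}))"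
          by (simp add: sum_distrib_left)
        then have "real k * (real (card A) * ((\<delta> - \<epsilon>) * real n ^ (k - 1)))
            \<le> real k * (fact (k - 1) * (\<Sum>v\<in>A. real (set_degree H {v})))"
          by (intro mult_left_mono) auto
        also have "real k * (fact (k - 1) * (\<Sum>v\<in>A. real (set_degree H {v}))) = fact k * (\<Sum>v\<in>A. real (set_degree H {v}))"
          using k by (simp add: fact_reduce)
        also have "real k * (real (card A) * ((\<delta> - \<epsilon>) * real n ^ (k - 1))) = real k * \<alpha> * (\<delta> - \<epsilon>) * real n ^ k"
          unfolding \<alpha>(3) using k by (cases k) (simp_all add: algebra_simps)
        \<comment> \<open>The minimum degree bounds the degree sum over \<open>A\<close> from below;
          next, the edge bounds for \<open>A\<close> and for the host bound it from above.\<close>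
        finally have degs: "real k * \<alpha> * (\<delta> - \<epsilon>) * real n ^ k \<le> fact k * (\<Sum>v\<in>A. real (set_degree H {v}))" .
        have "real ((\<Sum>v\<in>A. set_degree H {v}) + card (edges H)) \<le> real (card (edges (induced H A)) + k * card (edges H))"
          using sum_degrees_inside_le[OF H(1) A(1)] by (simp only: of_nat_le_iff)
        then have "fact k * ((\<Sum>v\<in>A. real (set_degree H {v})) + real (card (edges H)))
           \<le> fact k * (real (card (edges (induced H A))) + real k * real (card (edges H)))"
          by (intro mult_left_mono) auto
        then have "fact k * (\<Sum>v\<in>A. real (set_degree H {v}))
           \<le> fact k * real (card (edges (induced H A))) + (real k - 1) * (fact k * real (card (edges H)))"
          by (simp only: distrib_left left_diff_distrib mult.left_commute[of "real k"])
        also have "\<dots> \<le> (\<beta> + \<epsilon>) * \<alpha> ^ k * real n ^ k + (real k - 1) * ((\<delta> + \<epsilon>) * real n ^ k)"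
          using k by (intro add_mono eA mult_left_mono edges_H) auto
        finally have "real k * \<alpha> * (\<delta> - \<epsilon>) * real n ^ k
            \<le> ((\<beta> + \<epsilon>) * \<alpha> ^ k + (real k - 1) * (\<delta> + \<epsilon>)) * real n ^ k"
          using degs by (simp add: distrib_right mult.assoc)
        then have main: "real k * \<alpha> * (\<delta> - \<epsilon>) \<le> (\<beta> + \<epsilon>) * \<alpha> ^ k + (real k - 1) * (\<delta> + \<epsilon>)"
          using n0 by simp
        \<comment> \<open>Subtracting this from \<open>main\<close> replaces \<delta> by the gap
          \<delta> - x and leaves only error terms on the right.\<close>
        have opt: "\<beta> * \<alpha> ^ k \<le> (real k * \<alpha> - (real k - 1)) * x"
          unfolding x_def by (rule Upsilon_optimal) (use k a aa' \<alpha> in auto)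
        have "\<alpha> ^ k \<le> 1" using \<alpha> a'(1) by (intro power_le_one) auto
        then have "\<epsilon> * \<alpha> ^ k \<le> \<epsilon> * 1" using \<epsilon> by (intro mult_left_mono) auto
        moreover have "\<epsilon> * (real k * \<alpha>) \<le> \<epsilon> * (real k * 1)"
          using \<epsilon> \<alpha> by (intro mult_left_mono) auto
        moreover have "(real k * \<alpha> - (real k - 1)) * (\<delta> - x)
            \<le> \<epsilon> * (real k * \<alpha>) + \<epsilon> * \<alpha> ^ k + (real k - 1) * \<epsilon>"
          using main opt by (simp add: algebra_simps)
        ultimately have "(real k * \<alpha> - (real k - 1)) * (\<delta> - x) \<le> 2 * real k * \<epsilon>"
          by (simp add: algebra_simps)
        moreover have "real k * (a' - a) * (\<delta> - x) \<le> (real k * \<alpha> - (real k - 1)) * (\<delta> - x)"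
        proof (rule mult_right_mono)
          have "real k * a' \<le> real k * \<alpha>" using \<alpha>(1) by (intro mult_left_mono) auto
          moreover have "real k * a - (real k - 1) = a * \<beta>" using a(3) by (simp add: algebra_simps)
          moreover have "0 \<le> a * \<beta>" using a \<beta>01 by simp
          ultimately show "real k * (a' - a) \<le> real k * \<alpha> - (real k - 1)" by (simp add: algebra_simps)
        qed (use gap in simp)
        moreover have "2 * real k * \<epsilon> = real k * (a' - a) * (\<delta> - x) / 2" by (simp add: \<epsilon>_def)
        ultimately have "real k * (a' - a) * (\<delta> - x) \<le> real k * (a' - a) * (\<delta> - x) / 2"
          by linarith
        moreover have "0 < real k * (a' - a) * (\<delta> - x)" using k aa' gap by simp
        ultimately show False by linarith
      qed
      have "embeds (tree_hypergraph k 1 F) H"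
      proof (rule embeds_tree_hypergraph_link[OF F(1) k H(1,4) \<eta>, where \<gamma> = a'])
        show "embeds F (induced H A)" if "A \<subseteq> verts H" "a' * real (card (verts H)) \<le> real (card A)" for A
          by (rule sub[OF that])
      qed (use elim(4,5) H(2) a' in auto)
      then show False using H(3) T(3) by blast
    qed
    then show False by simp
  qed
  show ?thesis
    unfolding x_eq using degree_turan_spectrumI[OF T(1,2)] lower upper unfolding \<delta>_def by (metis order_antisym)
qed

theorem theorem1p1:
  fixes k l :: nat
  assumes "1 \<le> l" and "l < k"
  shows "transfer_function (degree_turan_spectrum k l) (Phi k l)
       \<and> (real k / 2 \<le> real l \<longrightarrow> transfer_function (degree_turan_spectrum k l) Psi)
       \<and> degree_turan_spectrum k 1 = turan_spectrum k
       \<and> transfer_function (degree_turan_spectrum k 1) (Upsilon k)"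
proof (intro conjI impI)
  have k: "1 < k" using assms by simp
  show "transfer_function (degree_turan_spectrum k l) (Phi k l)"
    unfolding transfer_function_def using Phi_transfer[OF assms] by blast
  show "transfer_function (degree_turan_spectrum k l) Psi" if "real k / 2 \<le> real l"
  proof -
    have "k - l \<le> l" using that by linarith
    then show ?thesis unfolding transfer_function_def using Psi_transfer[OF assms] by blast
  qed
  show "degree_turan_spectrum k 1 = turan_spectrum k" by (rule degree_turan_spectrum_one[OF k])
  show "transfer_function (degree_turan_spectrum k 1) (Upsilon k)"
    unfolding transfer_function_def using Upsilon_transfer[OF k] by blast
qed

end
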